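(* Let $M$ be a hypersurface in a semi-Riemannian space of constant curvature $N_{s}^{n+1}(c)$, $n \geq 4$, whose second fundamental tensor $H$ satisfies on $\mathcal{U}_{H} \subset M$ the equation $$H^{3} = \phi\, H^{2} + \psi\, H + \rho\, g ,$$ where $\phi,\psi,\rho$ are some functions on $\mathcal{U}_{H}$, and let $\tau$ be the function on $\mathcal{U}_{H}$ defined by $$\tau = \rho + (\phi - \mathrm{tr}(H))\bigl(\psi + \mathrm{tr}(H)(\phi - \mathrm{tr}(H))\bigr).$$ Then the following hold. (i) If $\tau$ vanishes at a point $x \in \mathcal{U}_{H}$, then $M$ is partially Einstein at $x$. (ii) If $\tau$ is non-zero at a point $x \in \mathcal{U}_{H}$, then on some neighbourhood $U \subset \mathcal{U}_{H}$ of $x$ we have $$H = \tau^{-1} A = \tau^{-1}(S^{2} - \rho_{1} S - \rho_{0} g),$$ $$R = \frac{\varepsilon}{2}\tau^{-2} A\wedge A + \frac{c}{2}\, g\wedge g = \frac{\varepsilon}{2}\tau^{-2}\,(S^{2} - \rho_{1} S - \rho_{0} g)\wedge (S^{2} - \rho_{1} S - \rho_{0} g) + \frac{c}{2}\, g\wedge g ,$$ $$R\cdot S = -\tau^{-1}\beta_{1}\, Q(S,S^{2}) + \tau^{-1}(\rho + (n-1)c\beta_{1})\, Q(g,S^{2}) + \bigl(c - \tau^{-1}\rho\rho_{1} - \tau^{-1}\beta_{1}(\rho_{0} + (n-1)c\rho_{1})\bigr) Q(g,S),$$ $$C\cdot S = -\tau^{-1}\beta_{1}\, Q(S,S^{2})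 + \tau^{-1}\beta_{4}\, Q(g,S^{2}) + \bigl(\beta_{2} - \tau^{-1}(\beta_{1}\rho_{0} + \beta_{4}\rho_{1})\bigr) Q(g,S),$$ and at every point of $U$ the tensor $S^{3}$ is a linear combination of the tensors $g$, $S$ and $S^{2}$. Here $A$, $\rho_0,\rho_1$ and $\beta_1,\beta_2,\beta_4$ are the tensor and functions on $\mathcal{U}_H$ defined in the context.
   Context: All manifolds are connected, paracompact and of class $C^\infty$. $N_s^{n+1}(c)$ is a semi-Riemannian space of constant curvature with signature $(s,n+1-s)$, $c = \widetilde\kappa/(n(n+1))$, where $\widetilde\kappa$ is its scalar curvature. $M$ is a hypersurface isometrically immersed in it, with induced (semi-Riemannian) metric $g$; $\mathcal{A}$ is its shape operator and $H(X,Y)=g(\mathcal{A}X,Y)$ its second fundamental tensor. Curvature conventions: $\mathcal{R}(X,Y)Z=\nabla_X\nabla_YZ-\nabla_Y\nabla_XZ-\nabla_{[X,Y]}Z$, $R(X_1,X_2,X_3,X_4)=g(\mathcal{R}(X_1,X_2)X_3,X_4)$, $S(X,Y)=\mathrm{tr}\{Z\mapsto\mathcal{R}(Z,X)Y\}$ (Ricci tensor), $g(\mathcal{S}X,Y)=S(X,Y)$ (Ricci operator), $\kappa=\mathrm{tr}\,\mathcal{S}$. For a symmetric $(0,2)$-tensor $T$ with associated operator $\mathcal{T}$, $g(\mathcal{T}X,Y)=T(X,Y)$, put $T^1=T$, $T^{p}(X,Y)=T^{p-1}(\mathcal{T}X,Y)$ and $\mathrm{tr}(T)=\mathrm{tr}\,\mathcal{T}$.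 The Kulkarni-Nomizu product of symmetric $(0,2)$-tensors $E,F$ is $(E\wedge F)(X_1,X_2,X_3,X_4)=E(X_1,X_4)F(X_2,X_3)+E(X_2,X_3)F(X_1,X_4)-E(X_1,X_3)F(X_2,X_4)-E(X_2,X_4)F(X_1,X_3)$. The Weyl tensor is $C=R-\frac{1}{n-2}g\wedge S+\frac{\kappa}{2(n-2)(n-1)}g\wedge g$. For $B=R$ or $B=C$, with $\mathcal{B}(X,Y)$ the endomorphism given by $g(\mathcal{B}(X_1,X_2)X_3,X_4)=B(X_1,X_2,X_3,X_4)$, and a $(0,2)$-tensor $T$: $(B\cdot T)(X_1,X_2,X,Y)=-T(\mathcal{B}(X,Y)X_1,X_2)-T(X_1,\mathcal{B}(X,Y)X_2)$. For a symmetric $(0,2)$-tensor $E$, with $(X\wedge_E Y)Z=E(Y,Z)X-E(X,Z)Y$: $Q(E,T)(X_1,X_2,X,Y)=-T((X\wedge_EY)X_1,X_2)-T(X_1,(X\wedge_EY)X_2)$. The Gauss equation of $M$ reads $R=\frac{\varepsilon}{2}H\wedge H+\frac{c}{2}g\wedge g$, where $\varepsilon=\pm1$. $\mathcal{U}_H$ is the set of all points of $M$ at which $H^2$ is not a linear combination of $H$ and $g$. $M$ is partially Einstein at a point if $S^2$ is a linear combination of $S$ and $g$ at that point. On $\mathcal{U}_H$ define $$A=S^2-\rho_1S-\rho_0g,\qquad \rho_1=2(n-1)c-\varepsilon(\psi+(\phi-\mathrm{tr}(H))^2),$$ $$\rho_0=-(n-1)^2c^2+\varepsilon(\psi+(\phi-\mathrm{tr}(H))^2)(n-1)c+\rho(\phi-2\,\mathrm{tr}(H)),$$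 $$\mu=\frac{1}{n-2}\left(\frac{\kappa}{n-1}-\frac{\widetilde\kappa}{n+1}\right),\quad \beta_1=\varepsilon(\phi-\mathrm{tr}(H)),\quad \beta_2=\mu+\frac{\varepsilon}{n-2}(\beta_1^2+\psi),$$ $$\beta_3=\varepsilon\mu\,\mathrm{tr}(H)+\frac{1}{n-2}\bigl(\psi(2\,\mathrm{tr}(H)-\phi)+(n-3)\rho\bigr),\quad \beta_4=\beta_3-\varepsilon\beta_2\mathrm{tr}(H)+\frac{(n-1)\widetilde\kappa\beta_1}{n(n+1)}.$$ *)

theory Defs
  imports "HOL-Analysis.Analysis"
begin

section \<open>Smooth manifolds\<close>

text \<open>Partial derivatives of all orders exist and are continuous; since the differential of a
  smooth map depends linearly on the direction, quantifying over all constant directions \<open>v\<close>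
  is the same as quantifying over the coordinate directions.\<close>

primrec Ck_on :: "nat \<Rightarrow> ('a::real_normed_vector \<Rightarrow> 'b::real_normed_vector) \<Rightarrow> 'a set \<Rightarrow> bool" where
  "Ck_on 0 f S \<longleftrightarrow> continuous_on S f"
| "Ck_on (Suc k) f S \<longleftrightarrow>
     f differentiable_on S \<and> (\<forall>v. Ck_on k (\<lambda>x. frechet_derivative f (at x) v) S)"

definition smooth_on :: "'a::euclidean_space set \<Rightarrow> ('a \<Rightarrow> 'b::euclidean_space) \<Rightarrow> bool" where
  "smooth_on S f \<longleftrightarrow> open S \<and> (\<forall>k. Ck_on k f S)"

definition paracompact_space :: "'p::t2_space itself \<Rightarrow> bool" where
  "paracompact_space _ \<longleftrightarrow>
     (\<forall>\<U>::'p set set. (\<forall>U\<in>\<U>. open U) \<and> \<Union>\<U> = UNIV \<longrightarrow>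
       (\<exists>\<V>. (\<forall>V\<in>\<V>. open V \<and> (\<exists>U\<in>\<U>. V \<subseteq> U)) \<and> \<Union>\<V> = UNIV \<and> locally_finite_in euclidean \<V>))"

type_synonym ('p, 'n) chart = "'p set \<times> ('p \<Rightarrow> real ^ 'n)"

abbreviation chart_inv :: "('p, 'n::finite) chart \<Rightarrow> real ^ 'n \<Rightarrow> 'p" where
  "chart_inv c \<equiv> inv_into (fst c) (snd c)"

text \<open>A semi-Riemannian manifold is a type of points together with an atlas and a metric. The
  tangent space at a point \<open>p\<close> is \<open>real ^ 'n\<close>, namely the space of components with respect to one
  chart \<open>chart_at M p\<close> around \<open>p\<close> which is chosen once and for all. Accordingly, tensor fields
  assign to \<open>p\<close> a multilinear map on \<open>real ^ 'n\<close>, and smoothness of a tensor field always refers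
  to its components with respect to the charts of the atlas, never to \<open>p \<mapsto> metric M p\<close> itself
  (which may jump where \<open>chart_at M p\<close> does).\<close>

record ('p, 'n) semi_riem =
  atlas :: "('p, 'n) chart set"
  metric :: "'p \<Rightarrow> real ^ 'n \<Rightarrow> real ^ 'n \<Rightarrow> real"

definition smooth_atlas :: "('p::t2_space, 'n::finite) chart set \<Rightarrow> bool" where
  "smooth_atlas \<A> \<longleftrightarrow>
     (\<Union>c\<in>\<A>. fst c) = UNIV \<and>
     (\<forall>c\<in>\<A>. open (fst c) \<and> open (snd c ` fst c) \<and>
        homeomorphism (fst c) (snd c ` fst c) (snd c) (chart_inv c)) \<and>
     (\<forall>c\<in>\<A>. \<forall>d\<in>\<A>. smooth_on (snd c ` (fst c \<inter> fst d)) (snd d \<circ> chart_inv c))"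

definition chart_at :: "('p, 'n::finite) semi_riem \<Rightarrow> 'p \<Rightarrow> ('p, 'n) chart" where
  "chart_at M p = (SOME c. c \<in> atlas M \<and> p \<in> fst c)"

text \<open>Transition of tangent vectors at \<open>p\<close> from components in the chart \<open>c\<close> to components in \<open>d\<close>.\<close>

definition coord_change ::
    "('p, 'n::finite) chart \<Rightarrow> ('p, 'n) chart \<Rightarrow> 'p \<Rightarrow> real ^ 'n \<Rightarrow> real ^ 'n" where
  "coord_change c d p = frechet_derivative (snd d \<circ> chart_inv c) (at (snd c p))"

text \<open>The components of the metric in the chart \<open>c\<close>, as functions on the image of \<open>c\<close>.\<close>

definition metric_in ::
    "('p, 'n::finite) semi_riem \<Rightarrow> ('p, 'n) chart \<Rightarrow> real ^ 'n \<Rightarrow> real ^ 'n \<Rightarrow> real ^ 'n \<Rightarrow> real" where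
  "metric_in M c u v w =
     (let p = chart_inv c u
      in metric M p (coord_change c (chart_at M p) p v) (coord_change c (chart_at M p) p w))"

definition semi_riemannian :: "('p::t2_space, 'n::finite) semi_riem \<Rightarrow> bool" where
  "semi_riemannian M \<longleftrightarrow>
     connected (UNIV :: 'p set) \<and> paracompact_space TYPE('p) \<and> smooth_atlas (atlas M) \<and>
     (\<forall>p. bilinear (metric M p) \<and> (\<forall>v w. metric M p v w = metric M p w v) \<and>
          (\<forall>v. (\<forall>w. metric M p v w = 0) \<longrightarrow> v = 0)) \<and>
     (\<forall>c\<in>atlas M. \<forall>v w. smooth_on (snd c ` fst c) (\<lambda>u. metric_in M c u v w))"

text \<open>Signature \<open>(s, CARD('n) - s)\<close>: some orthonormal basis has exactly \<open>s\<close> timelike vectors.\<close>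

definition has_index :: "('p, 'n::finite) semi_riem \<Rightarrow> nat \<Rightarrow> bool" where
  "has_index M s \<longleftrightarrow>
     (\<forall>p. \<exists>(e :: 'n \<Rightarrow> real ^ 'n) I. card I = s \<and>
        (\<forall>i j. metric M p (e i) (e j) = (if i \<noteq> j then 0 else if i \<in> I then -1 else 1)))"


section \<open>Levi-Civita connection and curvature\<close>

text \<open>In this part \<open>G\<close> is a metric on an open subset of \<open>real ^ 'n\<close>, and vector fields are
  functions from \<open>real ^ 'n\<close> to \<open>real ^ 'n\<close>. The vector \<open>christoffel G u v w\<close> is the covariant
  derivative at \<open>u\<close> of the constant field \<open>w\<close> in direction \<open>v\<close>, determined by the Koszul formula.\<close>

definition christoffel ::
    "(real ^ 'n \<Rightarrow> real ^ 'n \<Rightarrow> real ^ 'n \<Rightarrow> real) \<Rightarrow> real ^ 'n \<Rightarrow> real ^ 'n \<Rightarrow> real ^ 'n \<Rightarrow> real ^ 'n::finite" where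
  "christoffel G u v w =
     (THE z. \<forall>y. 2 * G u z y =
        frechet_derivative (\<lambda>t. G t w y) (at u) v
      + frechet_derivative (\<lambda>t. G t v y) (at u) w
      - frechet_derivative (\<lambda>t. G t v w) (at u) y)"

definition nabla ::
    "(real ^ 'n \<Rightarrow> real ^ 'n \<Rightarrow> real ^ 'n \<Rightarrow> real) \<Rightarrow>
     (real ^ 'n \<Rightarrow> real ^ 'n) \<Rightarrow> (real ^ 'n \<Rightarrow> real ^ 'n) \<Rightarrow> real ^ 'n \<Rightarrow> real ^ 'n::finite" where
  "nabla G X Y u = frechet_derivative Y (at u) (X u) + christoffel G u (X u) (Y u)"

definition lie_bracket ::
    "(real ^ 'n \<Rightarrow> real ^ 'n) \<Rightarrow> (real ^ 'n \<Rightarrow> real ^ 'n) \<Rightarrow> real ^ 'n \<Rightarrow> real ^ 'n::finite" where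
  "lie_bracket X Y u = frechet_derivative Y (at u) (X u) - frechet_derivative X (at u) (Y u)"

definition curvature_field ::
    "(real ^ 'n \<Rightarrow> real ^ 'n \<Rightarrow> real ^ 'n \<Rightarrow> real) \<Rightarrow>
     (real ^ 'n \<Rightarrow> real ^ 'n) \<Rightarrow> (real ^ 'n \<Rightarrow> real ^ 'n) \<Rightarrow> (real ^ 'n \<Rightarrow> real ^ 'n) \<Rightarrow>
     real ^ 'n \<Rightarrow> real ^ 'n::finite" where
  "curvature_field G X Y Z u =
     nabla G X (nabla G Y Z) u - nabla G Y (nabla G X Z) u - nabla G (lie_bracket X Y) Z u"

text \<open>Curvature is tensorial, so its value on tangent vectors may be computed with any extension
  to vector fields; here the extensions are constant in the chart \<open>chart_at M p\<close>.\<close>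

definition curvature_op ::
    "('p, 'n::finite) semi_riem \<Rightarrow> 'p \<Rightarrow> real ^ 'n \<Rightarrow> real ^ 'n \<Rightarrow> real ^ 'n \<Rightarrow> real ^ 'n" where
  "curvature_op M p x y z =
     curvature_field (metric_in M (chart_at M p)) (\<lambda>_. x) (\<lambda>_. y) (\<lambda>_. z) (snd (chart_at M p) p)"


section \<open>Tensor algebra on a single tangent space\<close>

type_synonym 'n form2 = "real ^ 'n \<Rightarrow> real ^ 'n \<Rightarrow> real"
type_synonym 'n form4 = "real ^ 'n \<Rightarrow> real ^ 'n \<Rightarrow> real ^ 'n \<Rightarrow> real ^ 'n \<Rightarrow> real"

text \<open>In the following, \<open>g\<close> is the metric on the tangent space.\<close>

definition assoc_op :: "'n::finite form2 \<Rightarrow> 'n form2 \<Rightarrow> real ^ 'n \<Rightarrow> real ^ 'n" where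
  "assoc_op g T x = (THE z. \<forall>y. g z y = T x y)"

definition form_trace :: "'n::finite form2 \<Rightarrow> 'n form2 \<Rightarrow> real" where
  "form_trace g T = trace (matrix (assoc_op g T))"

fun form_power :: "'n::finite form2 \<Rightarrow> 'n form2 \<Rightarrow> nat \<Rightarrow> 'n form2" where
  "form_power g T 0 = g"
| "form_power g T (Suc 0) = T"
| "form_power g T (Suc (Suc k)) = (\<lambda>x y. form_power g T (Suc k) (assoc_op g T x) y)"

definition kulkarni_nomizu :: "'n::finite form2 \<Rightarrow> 'n form2 \<Rightarrow> 'n form4" where
  "kulkarni_nomizu E F x1 x2 x3 x4 =
     E x1 x4 * F x2 x3 + E x2 x3 * F x1 x4 - E x1 x3 * F x2 x4 - E x2 x4 * F x1 x3"

definition assoc_endo ::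
    "'n::finite form2 \<Rightarrow> 'n form4 \<Rightarrow> real ^ 'n \<Rightarrow> real ^ 'n \<Rightarrow> real ^ 'n \<Rightarrow> real ^ 'n" where
  "assoc_endo g B x1 x2 x3 = (THE z. \<forall>x4. g z x4 = B x1 x2 x3 x4)"

text \<open>The tensor \<open>B \<cdot> T\<close>.\<close>

definition curv_dot :: "'n::finite form2 \<Rightarrow> 'n form4 \<Rightarrow> 'n form2 \<Rightarrow> 'n form4" where
  "curv_dot g B T x1 x2 x y =
     - T (assoc_endo g B x y x1) x2 - T x1 (assoc_endo g B x y x2)"

definition wedge_op :: "'n::finite form2 \<Rightarrow> real ^ 'n \<Rightarrow> real ^ 'n \<Rightarrow> real ^ 'n \<Rightarrow> real ^ 'n" where
  "wedge_op E x y z = E y z *\<^sub>R x - E x z *\<^sub>R y"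

definition tachibana :: "'n::finite form2 \<Rightarrow> 'n form2 \<Rightarrow> 'n form4" where
  "tachibana E T x1 x2 x y = - T (wedge_op E x y x1) x2 - T x1 (wedge_op E x y x2)"


section \<open>Curvature tensors of a semi-Riemannian manifold\<close>

definition riemann :: "('p, 'n::finite) semi_riem \<Rightarrow> 'p \<Rightarrow> 'n form4" where
  "riemann M p x1 x2 x3 x4 = metric M p (curvature_op M p x1 x2 x3) x4"

definition ricci :: "('p, 'n::finite) semi_riem \<Rightarrow> 'p \<Rightarrow> 'n form2" where
  "ricci M p x y = trace (matrix (\<lambda>z. curvature_op M p z x y))"

definition scalar_curvature :: "('p, 'n::finite) semi_riem \<Rightarrow> 'p \<Rightarrow> real" where
  "scalar_curvature M p = form_trace (metric M p) (ricci M p)"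

definition weyl :: "('p, 'n::finite) semi_riem \<Rightarrow> 'p \<Rightarrow> 'n form4" where
  "weyl M p x1 x2 x3 x4 =
     (let n = real CARD('n); g = metric M p in
        riemann M p x1 x2 x3 x4
      - 1 / (n - 2) * kulkarni_nomizu g (ricci M p) x1 x2 x3 x4
      + scalar_curvature M p / (2 * (n - 2) * (n - 1)) * kulkarni_nomizu g g x1 x2 x3 x4)"

definition constant_curvature :: "('p, 'n::finite) semi_riem \<Rightarrow> real \<Rightarrow> bool" where
  "constant_curvature N c \<longleftrightarrow>
     (\<forall>p x1 x2 x3 x4. riemann N p x1 x2 x3 x4 =
        c / 2 * kulkarni_nomizu (metric N p) (metric N p) x1 x2 x3 x4)"

definition partially_einstein_at :: "('p, 'n::finite) semi_riem \<Rightarrow> 'p \<Rightarrow> bool" where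
  "partially_einstein_at M p \<longleftrightarrow>
     (\<exists>a b. \<forall>x y. form_power (metric M p) (ricci M p) 2 x y =
        a * ricci M p x y + b * metric M p x y)"


section \<open>Hypersurfaces\<close>

definition smooth_map ::
    "('p::t2_space, 'n::finite) semi_riem \<Rightarrow> ('q::t2_space, 'm::finite) semi_riem \<Rightarrow> ('p \<Rightarrow> 'q) \<Rightarrow> bool" where
  "smooth_map M N f \<longleftrightarrow> continuous_on UNIV f \<and>
     (\<forall>c\<in>atlas M. \<forall>d\<in>atlas N.
        smooth_on (snd c ` (fst c \<inter> f -` fst d)) (snd d \<circ> f \<circ> chart_inv c))"

definition differential ::
    "('p, 'n::finite) semi_riem \<Rightarrow> ('q, 'm::finite) semi_riem \<Rightarrow> ('p \<Rightarrow> 'q) \<Rightarrow>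
     'p \<Rightarrow> real ^ 'n \<Rightarrow> real ^ 'm" where
  "differential M N f p =
     frechet_derivative (snd (chart_at N (f p)) \<circ> f \<circ> chart_inv (chart_at M p))
       (at (snd (chart_at M p) p))"

definition isometric_immersion ::
    "('p::t2_space, 'n::finite) semi_riem \<Rightarrow> ('q::t2_space, 'm::finite) semi_riem \<Rightarrow> ('p \<Rightarrow> 'q) \<Rightarrow> bool" where
  "isometric_immersion M N f \<longleftrightarrow>
     smooth_map M N f \<and>
     (\<forall>p. inj (differential M N f p)) \<and>
     (\<forall>p v w. metric M p v w =
        metric N (f p) (differential M N f p v) (differential M N f p w))"

definition hypersurface ::
    "('p::t2_space, 'n::finite) semi_riem \<Rightarrow> ('q::t2_space, 'm::finite) semi_riem \<Rightarrow> ('p \<Rightarrow> 'q) \<Rightarrow> bool" where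
  "hypersurface M N f \<longleftrightarrow>
     semi_riemannian M \<and> semi_riemannian N \<and> CARD('m) = CARD('n) + 1 \<and> isometric_immersion M N f"

text \<open>The components, in the charts \<open>c\<close> of \<open>M\<close> and \<open>d\<close> of \<open>N\<close>, of a vector field \<open>\<xi>\<close> along \<open>f\<close>;
  here \<open>\<xi> p\<close> is a tangent vector of \<open>N\<close> at \<open>f p\<close>.\<close>

definition field_along_in ::
    "('q, 'm::finite) semi_riem \<Rightarrow> ('p \<Rightarrow> 'q) \<Rightarrow> ('p \<Rightarrow> real ^ 'm) \<Rightarrow>
     ('p, 'n::finite) chart \<Rightarrow> ('q, 'm) chart \<Rightarrow> real ^ 'n \<Rightarrow> real ^ 'm" where
  "field_along_in N f \<xi> c d u =
     (let p = chart_inv c u in coord_change (chart_at N (f p)) d (f p) (\<xi> p))"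

definition unit_normal_field ::
    "('p::t2_space, 'n::finite) semi_riem \<Rightarrow> ('q::t2_space, 'm::finite) semi_riem \<Rightarrow> ('p \<Rightarrow> 'q) \<Rightarrow>
     'p set \<Rightarrow> real \<Rightarrow> ('p \<Rightarrow> real ^ 'm) \<Rightarrow> bool" where
  "unit_normal_field M N f W \<epsilon> \<xi> \<longleftrightarrow>
     open W \<and> \<epsilon> \<in> {-1, 1} \<and>
     (\<forall>p\<in>W. metric N (f p) (\<xi> p) (\<xi> p) = \<epsilon> \<and>
        (\<forall>v. metric N (f p) (\<xi> p) (differential M N f p v) = 0)) \<and>
     (\<forall>c\<in>atlas M. \<forall>d\<in>atlas N.
        smooth_on (snd c ` (fst c \<inter> W \<inter> f -` fst d)) (field_along_in N f \<xi> c d))"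

text \<open>Covariant derivative, with respect to the Levi-Civita connection of \<open>N\<close>, of the field \<open>\<xi>\<close>
  along \<open>f\<close> in the direction of the tangent vector \<open>x\<close> of \<open>M\<close> at \<open>p\<close>.\<close>

definition cov_deriv_along ::
    "('p, 'n::finite) semi_riem \<Rightarrow> ('q, 'm::finite) semi_riem \<Rightarrow> ('p \<Rightarrow> 'q) \<Rightarrow>
     ('p \<Rightarrow> real ^ 'm) \<Rightarrow> 'p \<Rightarrow> real ^ 'n \<Rightarrow> real ^ 'm" where
  "cov_deriv_along M N f \<xi> p x =
     (let c = chart_at M p; d = chart_at N (f p) in
        frechet_derivative (field_along_in N f \<xi> c d) (at (snd c p)) x
      + christoffel (metric_in N d) (snd d (f p)) (differential M N f p x) (\<xi> p))"

text \<open>Weingarten formula.\<close>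

definition shape_operator ::
    "('p, 'n::finite) semi_riem \<Rightarrow> ('q, 'm::finite) semi_riem \<Rightarrow> ('p \<Rightarrow> 'q) \<Rightarrow>
     ('p \<Rightarrow> real ^ 'm) \<Rightarrow> 'p \<Rightarrow> real ^ 'n \<Rightarrow> real ^ 'n" where
  "shape_operator M N f \<xi> p x =
     (THE a. differential M N f p a = - cov_deriv_along M N f \<xi> p x)"

definition second_fundamental ::
    "('p, 'n::finite) semi_riem \<Rightarrow> ('q, 'm::finite) semi_riem \<Rightarrow> ('p \<Rightarrow> 'q) \<Rightarrow>
     ('p \<Rightarrow> real ^ 'm) \<Rightarrow> 'p \<Rightarrow> 'n form2" where
  "second_fundamental M N f \<xi> p x y = metric M p (shape_operator M N f \<xi> p x) y"

text \<open>The set of points at which \<open>H\<^sup>2\<close> is not a linear combination of \<open>H\<close> and \<open>g\<close>, within the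
  domain \<open>W\<close> of the unit normal field. (Replacing \<open>\<xi>\<close> by \<open>- \<xi>\<close> does not change this set.)\<close>

definition U_H ::
    "('p, 'n::finite) semi_riem \<Rightarrow> ('q, 'm::finite) semi_riem \<Rightarrow> ('p \<Rightarrow> 'q) \<Rightarrow>
     'p set \<Rightarrow> ('p \<Rightarrow> real ^ 'm) \<Rightarrow> 'p set" where
  "U_H M N f W \<xi> =
     {p \<in> W. \<not> (\<exists>a b. \<forall>x y.
        form_power (metric M p) (second_fundamental M N f \<xi> p) 2 x y =
        a * second_fundamental M N f \<xi> p x y + b * metric M p x y)}"

end

theory Submission
  imports Defs
begin

text \<open>
  There are three ingredients: the Gauss equation, linear algebra on one tangent space, and a
  continuity argument.

  \<^bold>\<open>Linear algebra.\<close> By the Gauss equation the curvature of the hypersurface is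
  \<open>R = \<epsilon>/2 H \<and> H + c/2 g \<and> g\<close>, and its trace gives \<open>S = \<epsilon> (tr(H) H - H\<^sup>2) + (n-1) c g\<close>. Hence
  \<open>S\<^sup>2\<close> is a polynomial of degree four in the shape operator. The cubic equation reduces it to a
  combination of \<open>g\<close>, \<open>H\<close>, \<open>H\<^sup>2\<close>, and trading \<open>H\<^sup>2\<close> for \<open>S\<close> leaves
  \<open>S\<^sup>2 = \<tau> H + \<rho>\<^sub>1 S + \<rho>\<^sub>0 g\<close> (lemma \<open>S2_eq\<close>), that is, \<open>A = \<tau> H\<close>. This one identity contains the
  theorem. If \<open>\<tau> = 0\<close>, it says that \<open>S\<^sup>2\<close> is a combination of \<open>S\<close> and \<open>g\<close>. If \<open>\<tau> \<noteq> 0\<close>, it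
  expresses \<open>H\<close>, and with it \<open>R\<close>, by \<open>S\<close> and \<open>g\<close>. The tensors \<open>R \<cdot> S\<close> and \<open>C \<cdot> S\<close> are first
  written as combinations of \<open>Q(S,H)\<close>, \<open>Q(g,H)\<close> and \<open>Q(g,S)\<close>, from which \<open>H\<close> is then eliminated
  by \<open>\<tau> Q(g,H) = Q(g,S\<^sup>2) - \<rho>\<^sub>1 Q(g,S)\<close> and \<open>\<tau> Q(S,H) = Q(S,S\<^sup>2) + \<rho>\<^sub>0 Q(g,S)\<close>.

  \<^bold>\<open>The Gauss equation.\<close> It concerns the curvature at one point, so it can be proved in the
  charts that define the tangent spaces there. Lowered with the metric, the curvature consists of
  derivatives of the Christoffel symbols of the first kind (\<open>koszul\<close>) and of products of
  Christoffel symbols. Writing the metric of \<open>M\<close> as a pullback, \<open>koszul_pullback\<close> and its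
  derivative express everything through the ambient metric; third derivatives of the immersion
  cancel by symmetry, and what remains is the ambient curvature plus products of second
  derivatives (\<open>curvature_pullback\<close>). Their tangential parts cancel against the products of
  Christoffel symbols of \<open>M\<close>, their normal parts are the second fundamental tensor.

  \<^bold>\<open>Continuity.\<close> For the neighbourhood in the second assertion, \<open>\<U>\<^sub>H\<close> has to be open and \<open>\<tau>\<close>
  continuous, where \<open>\<phi>\<close>, \<open>\<psi>\<close>, \<open>\<rho>\<close> are arbitrary functions that satisfy the cubic equation. On \<open>\<U>\<^sub>H\<close> the tensors \<open>g\<close>, \<open>H\<close>,
  \<open>H\<^sup>2\<close> are linearly independent, so some three of their components form an invertible matrix, and
  Cramer's rule writes \<open>\<phi>\<close>, \<open>\<psi>\<close>, \<open>\<rho>\<close> as quotients of components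
  (\<open>cubic_nonvanishing_stable\<close>). The components have to be taken in fixed charts near the point,
  whereas \<open>H\<close> is defined through charts that may vary from point to point; this is why the
  covariant derivative of the normal field is shown to be independent of the charts
  (\<open>cov_transition\<close>).
\<close>

section \<open>Derivatives of smooth maps\<close>

abbreviation fd :: "('a::real_normed_vector \<Rightarrow> 'b::real_normed_vector) \<Rightarrow> 'a \<Rightarrow> 'a \<Rightarrow> 'b" where
  "fd f u \<equiv> frechet_derivative f (at u)"

lemma fd_unique: "(f has_derivative f') (at u) \<Longrightarrow> fd f u = f'"
  using frechet_derivative_at by metis

lemma fd_works: "f differentiable at u \<Longrightarrow> (f has_derivative fd f u) (at u)"
  using frechet_derivative_works by blast

lemma fd_linear: "f differentiable at u \<Longrightarrow> linear (fd f u)"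
  using fd_works has_derivative_linear by blast

text \<open>
  The operator \<open>frechet_derivative\<close> is a choice among all derivatives at \<open>u\<close>, and functions that
  agree near \<open>u\<close> have the same ones, possibly none.
\<close>
lemma fd_cong:
  assumes "open S" "u \<in> S" "\<And>t. t \<in> S \<Longrightarrow> f t = g t"
  shows "fd f u = fd g u"
proof -
  have "(f has_derivative D) (at u) \<longleftrightarrow> (g has_derivative D) (at u)" for D
    using assms has_derivative_transform_within_open[of f D u UNIV S g]
      has_derivative_transform_within_open[of g D u UNIV S f] by auto
  then show ?thesis by (simp add: frechet_derivative_def)
qed

lemma differentiable_cong_open:
  assumes "open S" "u \<in> S" "\<And>t. t \<in> S \<Longrightarrow> f t = g t" "f differentiable at u"
  shows "g differentiable at u"
  using assms has_derivative_transform_within_open[of f _ u UNIV S g]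
  unfolding differentiable_def by blast

lemma smooth_on_open: "smooth_on S f \<Longrightarrow> open S"
  by (simp add: smooth_on_def)

lemma smooth_on_differentiable:
  assumes "smooth_on S f" "u \<in> S" shows "f differentiable at u"
proof -
  have "Ck_on (Suc 0) f S" "open S" using assms unfolding smooth_on_def by blast+
  then show ?thesis using assms(2) differentiable_on_eq_differentiable_at by auto
qed

lemma smooth_on_fd: "smooth_on S f \<Longrightarrow> smooth_on S (\<lambda>u. fd f u v)"
  unfolding smooth_on_def by (metis Ck_on.simps(2))

lemma smooth_on_continuous: "smooth_on S f \<Longrightarrow> continuous_on S f"
  unfolding smooth_on_def by (metis Ck_on.simps(1))

lemma Ck_on_subset: "Ck_on k f S \<Longrightarrow> T \<subseteq> S \<Longrightarrow> Ck_on k f T"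
  by (induction k arbitrary: f)
    (auto intro: continuous_on_subset differentiable_on_subset)

lemma smooth_on_subset: "smooth_on S f \<Longrightarrow> T \<subseteq> S \<Longrightarrow> open T \<Longrightarrow> smooth_on T f"
  unfolding smooth_on_def using Ck_on_subset by blast

text \<open>
  Tensor fields depend differentiably on the point only for fixed arguments. In finite dimension
  this suffices for moving arguments as well: expanding the argument in a basis leaves a finite sum
  of products. Applying the linear case to one argument after the other gives the multilinear
  product rules below.
\<close>
lemma has_derivative_linear_family:
  fixes L :: "'a::real_normed_vector \<Rightarrow> 'b::euclidean_space \<Rightarrow> 'c::real_normed_vector"
  assumes S: "open S" "u \<in> S"
    and lin: "\<And>t. t \<in> S \<Longrightarrow> linear (L t)"
    and L': "\<And>v. ((\<lambda>t. L t v) has_derivative L' v) (at u)"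
    and V: "(V has_derivative V') (at u)"
  shows "((\<lambda>t. L t (V t)) has_derivative (\<lambda>h. L' (V u) h + L u (V' h))) (at u)"
proof -
  have expand: "L t v = (\<Sum>b\<in>Basis. (v \<bullet> b) *\<^sub>R L t b)" if "t \<in> S" for t v
  proof -
    have "L t v = L t (\<Sum>b\<in>Basis. (v \<bullet> b) *\<^sub>R b)" by (simp add: euclidean_representation)
    also have "\<dots> = (\<Sum>b\<in>Basis. (v \<bullet> b) *\<^sub>R L t b)"
      using lin[OF that] by (simp add: linear_sum linear_scale)
    finally show ?thesis .
  qed
  have L'_expand: "L' v h = (\<Sum>b\<in>Basis. (v \<bullet> b) *\<^sub>R L' b h)" for v h
  proof -
    have "((\<lambda>t. \<Sum>b\<in>Basis. (v \<bullet> b) *\<^sub>R L t b) has_derivative (\<lambda>h. \<Sum>b\<in>Basis. (v \<bullet> b) *\<^sub>R L' b h)) (at u)"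
      by (intro has_derivative_sum has_derivative_scaleR_right L')
    then have "((\<lambda>t. L t v) has_derivative (\<lambda>h. \<Sum>b\<in>Basis. (v \<bullet> b) *\<^sub>R L' b h)) (at u)"
      by (rule has_derivative_transform_within_open[OF _ S]) (simp add: expand)
    from has_derivative_unique[OF L' this] show ?thesis by metis
  qed
  have "((\<lambda>t. \<Sum>b\<in>Basis. (V t \<bullet> b) *\<^sub>R L t b) has_derivative
      (\<lambda>h. \<Sum>b\<in>Basis. (V u \<bullet> b) *\<^sub>R L' b h + (V' h \<bullet> b) *\<^sub>R L u b)) (at u)"
    by (intro has_derivative_sum has_derivative_scaleR L' has_derivative_inner_left V)
  moreover have "(\<Sum>b\<in>Basis. (V u \<bullet> b) *\<^sub>R L' b h + (V' h \<bullet> b) *\<^sub>R L u b)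
      = L' (V u) h + L u (V' h)" for h
    unfolding sum.distrib L'_expand[of "V u" h] expand[OF S(2), of "V' h"] ..
  ultimately have "((\<lambda>t. \<Sum>b\<in>Basis. (V t \<bullet> b) *\<^sub>R L t b) has_derivative
      (\<lambda>h. L' (V u) h + L u (V' h))) (at u)" by simp
  then show ?thesis
    by (rule has_derivative_transform_within_open[OF _ S]) (simp add: expand)
qed

lemma has_derivative_bilinear_family:
  fixes B :: "'a::real_normed_vector \<Rightarrow> 'b::euclidean_space \<Rightarrow> 'c::euclidean_space \<Rightarrow> 'd::real_normed_vector"
  assumes S: "open S" "u \<in> S"
    and bil: "\<And>t. t \<in> S \<Longrightarrow> bilinear (B t)"
    and B': "\<And>v w. ((\<lambda>t. B t v w) has_derivative B' v w) (at u)"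
    and V: "(V has_derivative V') (at u)" and W: "(W has_derivative W') (at u)"
  shows "((\<lambda>t. B t (V t) (W t)) has_derivative
    (\<lambda>h. B' (V u) (W u) h + B u (V' h) (W u) + B u (V u) (W' h))) (at u)"
proof -
  have 1: "((\<lambda>t. B t v (W t)) has_derivative (\<lambda>h. B' v (W u) h + B u v (W' h))) (at u)" for v
    by (rule has_derivative_linear_family[OF S _ B' W]) (use bil in \<open>simp add: bilinear_def\<close>)
  have "((\<lambda>t. B t (V t) (W t)) has_derivative
     (\<lambda>h. (B' (V u) (W u) h + B u (V u) (W' h)) + B u (V' h) (W u))) (at u)"
    by (rule has_derivative_linear_family[OF S _ 1 V]) (use bil in \<open>simp add: bilinear_def\<close>)
  then show ?thesis by (simp add: algebra_simps)
qed

lemma has_derivative_trilinear_family: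
  fixes T :: "'a::real_normed_vector \<Rightarrow> 'b::euclidean_space \<Rightarrow> 'c::euclidean_space \<Rightarrow> 'd::euclidean_space \<Rightarrow> 'e::real_normed_vector"
  assumes S: "open S" "u \<in> S"
    and lin: "\<And>t w z. t \<in> S \<Longrightarrow> linear (\<lambda>v. T t v w z)"
    and bil: "\<And>t v. t \<in> S \<Longrightarrow> bilinear (T t v)"
    and T': "\<And>v w z. ((\<lambda>t. T t v w z) has_derivative T' v w z) (at u)"
    and V: "(V has_derivative V') (at u)" and W: "(W has_derivative W') (at u)"
    and Z: "(Z has_derivative Z') (at u)"
  shows "((\<lambda>t. T t (V t) (W t) (Z t)) has_derivative
    (\<lambda>h. T' (V u) (W u) (Z u) h + T u (V' h) (W u) (Z u) + T u (V u) (W' h) (Z u) + T u (V u) (W u) (Z' h))) (at u)"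
proof -
  have 1: "((\<lambda>t. T t v (W t) (Z t)) has_derivative
      (\<lambda>h. T' v (W u) (Z u) h + T u v (W' h) (Z u) + T u v (W u) (Z' h))) (at u)" for v
    by (rule has_derivative_bilinear_family[OF S _ T' W Z]) (rule bil)
  have "((\<lambda>t. T t (V t) (W t) (Z t)) has_derivative
     (\<lambda>h. (T' (V u) (W u) (Z u) h + T u (V u) (W' h) (Z u) + T u (V u) (W u) (Z' h)) + T u (V' h) (W u) (Z u))) (at u)"
    by (rule has_derivative_linear_family[OF S _ 1 V]) (rule lin)
  then show ?thesis by (simp add: algebra_simps)
qed

text \<open>
  The left hand side of the equation is symmetric in \<open>v\<close> and \<open>w\<close>, while the right hand side
  contains the mixed derivative in one order. Comparing both orders as \<open>h\<close> tends to zero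
  shows that mixed derivatives commute.
\<close>
lemma mixed_difference_mean_value:
  fixes f :: "'a::euclidean_space \<Rightarrow> real"
  assumes diff: "\<And>t. t \<in> ball u r \<Longrightarrow> f differentiable at t"
    and diff2: "\<And>t. t \<in> ball u r \<Longrightarrow> (\<lambda>t. fd f t v) differentiable at t"
    and h: "h > 0" "h * (norm v + norm w) < r"
  shows "\<exists>p. dist p u \<le> h * (norm v + norm w) \<and>
     f (u + h *\<^sub>R v + h *\<^sub>R w) - f (u + h *\<^sub>R v) - f (u + h *\<^sub>R w) + f u = h * h * fd (\<lambda>t. fd f t v) p w"
proof -
  have near: "dist (u + a *\<^sub>R v + b *\<^sub>R w) u \<le> h * (norm v + norm w)"
    if "0 \<le> a" "a \<le> h" "0 \<le> b" "b \<le> h" for a b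
  proof -
    have "dist (u + a *\<^sub>R v + b *\<^sub>R w) u \<le> norm (a *\<^sub>R v) + norm (b *\<^sub>R w)"
      unfolding dist_norm by (metis (no_types, opaque_lifting) add.assoc add_diff_cancel_left' norm_triangle_ineq)
    also have "\<dots> \<le> h * norm v + h * norm w"
      using that by (intro add_mono) (auto intro: mult_right_mono)
    finally show ?thesis by (simp add: distrib_left)
  qed
  then have inball: "u + a *\<^sub>R v + b *\<^sub>R w \<in> ball u r" if "0 \<le> a" "a \<le> h" "0 \<le> b" "b \<le> h" for a b
    using that h(2) by (fastforce simp: dist_commute)
  \<comment> \<open>The summand with the factor 0 gives both terms the same form, so that one derivative rule covers both.\<close>
  define A where "A a = f (u + a *\<^sub>R v + h *\<^sub>R w) - f (u + a *\<^sub>R v + 0 *\<^sub>R w)" for a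
  have dA: "DERIV A a :> fd f (u + a *\<^sub>R v + h *\<^sub>R w) v - fd f (u + a *\<^sub>R v + 0 *\<^sub>R w) v"
    if a: "0 \<le> a" "a \<le> h" for a
  proof -
    have 1: "((\<lambda>a. f (u + a *\<^sub>R v + b *\<^sub>R w)) has_derivative (\<lambda>k. fd f (u + a *\<^sub>R v + b *\<^sub>R w) (k *\<^sub>R v))) (at a)"
      if b: "0 \<le> b" "b \<le> h" for b
      by (rule has_derivative_compose[where g = f and f = "\<lambda>a. u + a *\<^sub>R v + b *\<^sub>R w", OF _ fd_works[OF diff[OF inball[OF a b]]]])
        (auto intro!: derivative_eq_intros)
    have 2: "fd f (u + a *\<^sub>R v + b *\<^sub>R w) (k *\<^sub>R v) = fd f (u + a *\<^sub>R v + b *\<^sub>R w) v * k" if b: "0 \<le> b" "b \<le> h" for b k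
      using fd_linear[OF diff[OF inball[OF a b]]] by (simp add: linear_scale)
    have "(A has_derivative (\<lambda>k. fd f (u + a *\<^sub>R v + h *\<^sub>R w) (k *\<^sub>R v) - fd f (u + a *\<^sub>R v + 0 *\<^sub>R w) (k *\<^sub>R v))) (at a)"
      unfolding A_def by (intro has_derivative_diff 1) (use h in auto)
    moreover have "fd f (u + a *\<^sub>R v + h *\<^sub>R w) (k *\<^sub>R v) - fd f (u + a *\<^sub>R v + 0 *\<^sub>R w) (k *\<^sub>R v)
       = (fd f (u + a *\<^sub>R v + h *\<^sub>R w) v - fd f (u + a *\<^sub>R v + 0 *\<^sub>R w) v) * k" for k
      using 2[of h k] 2[of 0 k] h by (simp only: left_diff_distrib)
    ultimately show ?thesis
      unfolding has_field_derivative_def by simp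
  qed
  obtain a where a: "0 < a" "a < h"
    "A h - A 0 = (h - 0) * (fd f (u + a *\<^sub>R v + h *\<^sub>R w) v - fd f (u + a *\<^sub>R v + 0 *\<^sub>R w) v)"
    using MVT2[OF h(1) dA] by blast
  have dB: "DERIV (\<lambda>b. fd f (u + a *\<^sub>R v + b *\<^sub>R w) v) b :> fd (\<lambda>t. fd f t v) (u + a *\<^sub>R v + b *\<^sub>R w) w"
    if b: "0 \<le> b" "b \<le> h" for b
  proof -
    have in': "u + a *\<^sub>R v + b *\<^sub>R w \<in> ball u r" using inball a b by simp
    have "((\<lambda>b. fd f (u + a *\<^sub>R v + b *\<^sub>R w) v) has_derivative
        (\<lambda>k. fd (\<lambda>t. fd f t v) (u + a *\<^sub>R v + b *\<^sub>R w) (k *\<^sub>R w))) (at b)"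
      by (rule has_derivative_compose[where g = "\<lambda>t. fd f t v" and f = "\<lambda>b. u + a *\<^sub>R v + b *\<^sub>R w", OF _ fd_works[OF diff2[OF in']]])
        (auto intro!: derivative_eq_intros)
    then show ?thesis
      using fd_linear[OF diff2[OF in']] unfolding has_field_derivative_def
      by (simp add: linear_scale mult.commute[of _ "fd _ _ w"])
  qed
  obtain b where b: "0 < b" "b < h"
    "fd f (u + a *\<^sub>R v + h *\<^sub>R w) v - fd f (u + a *\<^sub>R v + 0 *\<^sub>R w) v
      = (h - 0) * fd (\<lambda>t. fd f t v) (u + a *\<^sub>R v + b *\<^sub>R w) w"
    using MVT2[OF h(1) dB] by blast
  show ?thesis
  proof (intro exI conjI)
    show "dist (u + a *\<^sub>R v + b *\<^sub>R w) u \<le> h * (norm v + norm w)" using near a b by simp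
    show "f (u + h *\<^sub>R v + h *\<^sub>R w) - f (u + h *\<^sub>R v) - f (u + h *\<^sub>R w) + f u
       = h * h * fd (\<lambda>t. fd f t v) (u + a *\<^sub>R v + b *\<^sub>R w) w"
      using a(3) b(3) by (simp add: A_def)
  qed
qed

lemma mixed_derivatives_commute_real:
  fixes f :: "'a::euclidean_space \<Rightarrow> real"
  assumes f: "smooth_on S f" and u: "u \<in> S"
  shows "fd (\<lambda>t. fd f t v) u w = fd (\<lambda>t. fd f t w) u v"
proof (rule ccontr)
  define P where "P t = fd (\<lambda>t. fd f t v) t w" for t
  define Q where "Q t = fd (\<lambda>t. fd f t w) t v" for t
  assume "\<not> ?thesis"
  then have e: "dist (P u) (Q u) / 2 > 0" unfolding P_def Q_def by simp
  have S: "open S" using f by (rule smooth_on_open)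
  have "continuous_on S P" "continuous_on S Q"
    unfolding P_def Q_def by (intro smooth_on_continuous smooth_on_fd f)+
  then have "isCont P u" "isCont Q u" using S u continuous_on_eq_continuous_at by blast+
  then obtain d1 d2 where d: "d1 > 0" "\<And>t. dist t u < d1 \<Longrightarrow> dist (P t) (P u) < dist (P u) (Q u) / 2"
     "d2 > 0" "\<And>t. dist t u < d2 \<Longrightarrow> dist (Q t) (Q u) < dist (P u) (Q u) / 2"
    unfolding continuous_at_eps_delta using e by metis
  obtain r where r: "r > 0" "ball u r \<subseteq> S" using S u open_contains_ball by blast
  define m where "m = min r (min d1 d2)"
  \<comment> \<open>The summand 1 keeps the denominator positive when both vectors vanish.\<close>
  define h where "h = m / (2 * (norm v + norm w + 1))"
  have m: "m > 0" "m \<le> r" "m \<le> d1" "m \<le> d2" using r d unfolding m_def by auto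
  have pos: "norm v + norm w + 1 > 0" by (simp add: add_nonneg_pos)
  then have h: "h > 0" unfolding h_def using m by simp
  have "h * (norm v + norm w) \<le> h * (norm v + norm w + 1)" using h by simp
  also have "\<dots> = m / 2" unfolding h_def using pos by (simp add: field_simps)
  also have "\<dots> < m" using m by simp
  finally have hm: "h * (norm v + norm w) < m" .
  then have hr: "h * (norm v + norm w) < r" "h * (norm w + norm v) < r" using m by (auto simp: add.commute)
  have diff: "f differentiable at t" "(\<lambda>t. fd f t z) differentiable at t" if "t \<in> ball u r" for t z
    using that r smooth_on_differentiable[OF f, of t] smooth_on_differentiable[OF smooth_on_fd[OF f], of t]
    by blast+
  obtain p where p: "dist p u \<le> h * (norm v + norm w)"
     "f (u + h *\<^sub>R v + h *\<^sub>R w) - f (u + h *\<^sub>R v) - f (u + h *\<^sub>R w) + f u = h * h * P p"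
    using mixed_difference_mean_value[OF diff h hr(1)] unfolding P_def by blast
  obtain q where q: "dist q u \<le> h * (norm w + norm v)"
     "f (u + h *\<^sub>R w + h *\<^sub>R v) - f (u + h *\<^sub>R w) - f (u + h *\<^sub>R v) + f u = h * h * Q q"
    using mixed_difference_mean_value[OF diff h hr(2)] unfolding Q_def by blast
  have "h * h * P p = h * h * Q q"
    using p(2) q(2) by (simp add: algebra_simps)
  then have "P p = Q q" using h by simp
  moreover have "dist (P p) (P u) < dist (P u) (Q u) / 2" "dist (Q q) (Q u) < dist (P u) (Q u) / 2"
    using d p(1) q(1) hm m by (auto simp: add.commute)
  ultimately show False
    by (metis dist_commute dist_triangle_half_l less_irrefl)
qed

lemma fd_inner: "f differentiable at t \<Longrightarrow> fd (\<lambda>t. f t \<bullet> b) t v = fd f t v \<bullet> b"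
  using fd_unique[OF has_derivative_inner_left[OF fd_works]] by metis

lemma Ck_on_cong:
  "open S \<Longrightarrow> (\<And>t. t \<in> S \<Longrightarrow> f t = g t) \<Longrightarrow> Ck_on k f S \<Longrightarrow> Ck_on k g S"
proof (induction k arbitrary: f g)
  case 0
  then show ?case by (simp cong: continuous_on_cong)
next
  case (Suc k)
  have "g differentiable_on S"
    using Suc.prems differentiable_cong_open[of S _ f g]
    by (auto simp: differentiable_on_eq_differentiable_at)
  moreover have "Ck_on k (\<lambda>x. fd g x v) S" for v
    by (rule Suc.IH[of "\<lambda>x. fd f x v"]) (use Suc.prems in \<open>auto simp: fd_cong[of S _ f g]\<close>)
  ultimately show ?case by simp
qed

lemma smooth_on_inner:
  assumes "smooth_on S f" shows "smooth_on S (\<lambda>t. f t \<bullet> b)"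
proof -
  have S: "open S" using assms by (rule smooth_on_open)
  have "Ck_on k (\<lambda>t. f t \<bullet> b) S" if "smooth_on S f" for k f
    using that
  proof (induction k arbitrary: f)
    case 0
    then show ?case by (auto intro: continuous_intros dest: smooth_on_continuous)
  next
    case (Suc k)
    have "Ck_on k (\<lambda>x. fd (\<lambda>t. f t \<bullet> b) x v) S" for v
      by (rule Ck_on_cong[OF S _ Suc.IH[OF smooth_on_fd[OF Suc.prems]]])
        (simp add: fd_inner smooth_on_differentiable[OF Suc.prems])
    moreover have "(\<lambda>t. f t \<bullet> b) differentiable_on S"
      using Suc.prems S smooth_on_differentiable differentiable_inner[OF _ differentiable_const]
      unfolding differentiable_on_eq_differentiable_at[OF S] by blast
    ultimately show ?case by simp
  qed
  then show ?thesis using assms S unfolding smooth_on_def by blast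
qed

lemma mixed_derivatives_commute:
  fixes f :: "'a::euclidean_space \<Rightarrow> 'b::euclidean_space"
  assumes f: "smooth_on S f" and u: "u \<in> S"
  shows "fd (\<lambda>t. fd f t v) u w = fd (\<lambda>t. fd f t w) u v"
proof (rule euclidean_eqI)
  fix b :: 'b
  have S: "open S" using f by (rule smooth_on_open)
  have "fd (\<lambda>t. fd f t v) u w \<bullet> b = fd (\<lambda>t. fd (\<lambda>t. f t \<bullet> b) t v) u w" for v w
  proof -
    have "fd (\<lambda>t. fd f t v) u w \<bullet> b = fd (\<lambda>t. fd f t v \<bullet> b) u w"
      by (simp add: fd_inner smooth_on_differentiable[OF smooth_on_fd[OF f] u])
    also have "fd (\<lambda>t. fd f t v \<bullet> b) u = fd (\<lambda>t. fd (\<lambda>t. f t \<bullet> b) t v) u"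
      by (rule fd_cong[OF S u]) (simp add: fd_inner smooth_on_differentiable[OF f])
    finally show ?thesis .
  qed
  then show "fd (\<lambda>t. fd f t v) u w \<bullet> b = fd (\<lambda>t. fd f t w) u v \<bullet> b"
    using mixed_derivatives_commute_real[OF smooth_on_inner[OF f] u] by simp
qed

lemma differentiable_prod:
  fixes f :: "'i \<Rightarrow> 'a::real_normed_vector \<Rightarrow> real"
  shows "(\<And>i. i \<in> I \<Longrightarrow> f i differentiable at u) \<Longrightarrow> (\<lambda>t. \<Prod>i\<in>I. f i t) differentiable at u"
  by (induction I rule: infinite_finite_induct) (auto intro!: differentiable_mult)

lemma differentiable_det:
  fixes M :: "'a::real_normed_vector \<Rightarrow> real ^ 'n ^ 'n"
  assumes "\<And>i j. (\<lambda>t. M t $ i $ j) differentiable at u"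
  shows "(\<lambda>t. det (M t)) differentiable at u"
  unfolding det_def
proof (intro differentiable_sum ballI)
  fix p :: "'n \<Rightarrow> 'n"
  have "(\<lambda>t. \<Prod>i\<in>UNIV. M t $ i $ p i) differentiable at u"
    by (rule differentiable_prod) (rule assms)
  then show "(\<lambda>t. of_int (sign p) * (\<Prod>i\<in>UNIV. M t $ i $ p i)) differentiable at u"
    by (intro differentiable_mult) simp_all
qed (simp add: finite_permutations)

lemma differentiable_vec:
  fixes f :: "'a::real_normed_vector \<Rightarrow> real ^ 'n"
  assumes "\<And>k. (\<lambda>t. f t $ k) differentiable at u"
  shows "f differentiable at u"
  by (subst differentiable_componentwise_within)
    (use assms in \<open>auto simp: Basis_vec_def inner_axis\<close>)

lemma bilinear_axis_expand:
  assumes "bilinear (A :: real ^ 'n \<Rightarrow> real ^ 'm \<Rightarrow> real)"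
  shows "A v w = (\<Sum>j\<in>UNIV. v $ j * A (axis j 1) w)"
proof -
  have l: "linear (\<lambda>v. A v w)" using assms by (simp add: bilinear_def)
  have "v = (\<Sum>j\<in>UNIV. v $ j *\<^sub>R axis j 1)"
    using basis_expansion[of v] by (simp add: scalar_mult_eq_scaleR)
  then have "A v w = A (\<Sum>j\<in>UNIV. v $ j *\<^sub>R axis j 1) w" by simp
  also have "\<dots> = (\<Sum>j\<in>UNIV. v $ j * A (axis j 1) w)"
    using linear_sum[OF l, of "\<lambda>j. v $ j *\<^sub>R axis j 1" UNIV] linear_scale[OF l] by simp
  finally show ?thesis .
qed

text \<open>
  Raising an index preserves differentiability: by Cramer's rule, the solution of a linear system
  is a quotient of determinants. This applies to the Christoffel symbols and to the shape
  operator, both of which are defined by a linear system for the metric.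
\<close>
lemma differentiable_solve_form:
  fixes A :: "'a::real_normed_vector \<Rightarrow> real ^ 'n \<Rightarrow> real ^ 'n \<Rightarrow> real"
  assumes S: "open S" "u \<in> S"
    and bil: "\<And>t. t \<in> S \<Longrightarrow> bilinear (A t)"
    and nondeg: "\<And>t v. t \<in> S \<Longrightarrow> (\<And>w. A t v w = 0) \<Longrightarrow> v = 0"
    and A: "\<And>v w. (\<lambda>t. A t v w) differentiable at u"
    and z: "\<And>t y. t \<in> S \<Longrightarrow> A t (z t) y = b t y"
    and b: "\<And>y. (\<lambda>t. b t y) differentiable at u"
  shows "z differentiable at u"
proof -
  define M :: "'a \<Rightarrow> real ^ 'n ^ 'n" where "M t = (\<chi> i j. A t (axis j 1) (axis i 1))" for t
  define c where "c t = (\<chi> i. b t (axis i 1))" for t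
  have Mv: "(M t *v v) $ i = A t v (axis i 1)" if "t \<in> S" for t v i
    unfolding M_def matrix_vector_mult_def bilinear_axis_expand[OF bil[OF that], of v]
    by (simp add: mult.commute)
  have det: "det (M t) \<noteq> 0" if t: "t \<in> S" for t
  proof -
    have "v = 0" if "M t *v v = 0" for v
    proof (rule nondeg[OF t])
      fix w
      have "bilinear (\<lambda>w v. A t v w)" using bil[OF t] by (simp add: bilinear_def)
      then have "A t v w = (\<Sum>j\<in>UNIV. w $ j * A t v (axis j 1))"
        by (rule bilinear_axis_expand)
      also have "\<dots> = 0" using Mv[OF t, of v] that by simp
      finally show "A t v w = 0" .
    qed
    then have "inj ((*v) (M t))"
      by (simp add: linear_injective_0)
    then show ?thesis
      using invertible_det_nz invertible_left_inverse matrix_left_invertible_injective by blast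
  qed
  have sol: "z t $ k = det (\<chi> i j. if j = k then c t $ i else M t $ i $ j) / det (M t)"
    if t: "t \<in> S" for t k
  proof -
    have "M t *v z t = c t" by (simp add: vec_eq_iff Mv[OF t] z[OF t] c_def)
    then show ?thesis using cramer[OF det[OF t]] by simp
  qed
  have "(\<lambda>t. z t $ k) differentiable at u" for k
  proof (rule differentiable_cong_open[OF S sol[symmetric]])
    have entry: "(\<lambda>t. (\<chi> i j. if j = k then c t $ i else M t $ i $ j) $ i $ j) differentiable at u" for i j
      by (cases "j = k") (simp_all add: M_def c_def A b)
    show "(\<lambda>t. det (\<chi> i j. if j = k then c t $ i else M t $ i $ j) / det (M t)) differentiable at u"
      by (intro differentiable_divide differentiable_det entry)
        (use det S in \<open>auto simp: M_def A\<close>)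
  qed
  then show ?thesis by (rule differentiable_vec)
qed

section \<open>Metrics on open sets and their curvature\<close>

text \<open>
  Every vector that is defined by \<open>THE\<close> from its scalar products exists by this lemma: the map
  \<open>\<Theta>\<close> from vectors to linear forms is injective, and hence surjective for reasons of dimension.
\<close>
lemma bilinear_form_represents:
  fixes B :: "real ^ 'n \<Rightarrow> real ^ 'n \<Rightarrow> real"
  assumes B: "bilinear B" and nondeg: "\<And>v. (\<And>w. B v w = 0) \<Longrightarrow> v = 0" and l: "linear l"
  shows "\<exists>!z. \<forall>y. B z y = l y"
proof -
  have lin: "linear (\<lambda>z. B z y)" "linear (B z)" for y z
    using B by (auto simp: bilinear_def)
  define \<Theta> where "\<Theta> z = (\<Sum>b\<in>Basis. B z b *\<^sub>R b)" for z
  have \<Theta>: "\<Theta> z \<bullet> b = B z b" if "b \<in> Basis" for z b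
    using that by (simp add: \<Theta>_def inner_sum_left inner_Basis if_distrib sum.delta cong: if_cong)
  have expand: "f y = (\<Sum>b\<in>Basis. (y \<bullet> b) * f b)" if "linear f" for f :: "real ^ 'n \<Rightarrow> real" and y
  proof -
    have "f y = f (\<Sum>b\<in>Basis. (y \<bullet> b) *\<^sub>R b)" by (simp add: euclidean_representation)
    then show ?thesis using that by (simp add: linear_sum linear_scale)
  qed
  have "linear \<Theta>"
  proof (rule linearI)
    show "\<Theta> (v + w) = \<Theta> v + \<Theta> w" for v w
      by (simp add: \<Theta>_def linear_add[OF lin(1)] scaleR_left_distrib sum.distrib)
    show "\<Theta> (r *\<^sub>R v) = r *\<^sub>R \<Theta> v" for r v
      by (simp add: \<Theta>_def linear_scale[OF lin(1)] scaleR_right.sum)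
  qed
  moreover have "v = 0" if "\<Theta> v = 0" for v
  proof (rule nondeg)
    fix w
    have "B v b = 0" if "b \<in> Basis" for b using \<Theta>[OF that, of v] \<open>\<Theta> v = 0\<close> by simp
    then show "B v w = 0" using expand[OF lin(2), of v w] by simp
  qed
  ultimately have "surj \<Theta>"
    using linear_injective_imp_surjective linear_injective_0 by blast
  then obtain z where z: "\<Theta> z = (\<Sum>b\<in>Basis. l b *\<^sub>R b)" by (metis surjD)
  have "B z b = l b" if "b \<in> Basis" for b
    using \<Theta>[OF that, of z] that
    by (simp add: z inner_sum_left inner_Basis if_distrib sum.delta cong: if_cong)
  then have "B z y = l y" for y
    using expand[OF lin(2), of z y] expand[OF l, of y] by simp
  moreover have "z' = z" if "\<forall>y. B z' y = l y" for z'
  proof -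
    have "B (z' - z) y = 0" for y
      using that calculation by (simp add: linear_diff[OF lin(1)])
    then show ?thesis using nondeg[of "z' - z"] by simp
  qed
  ultimately show ?thesis by blast
qed

definition metric_deriv ::
    "(real ^ 'n \<Rightarrow> real ^ 'n \<Rightarrow> real ^ 'n \<Rightarrow> real) \<Rightarrow> real ^ 'n \<Rightarrow> real ^ 'n \<Rightarrow> real ^ 'n \<Rightarrow> real ^ 'n \<Rightarrow> real" where
  "metric_deriv G u a v w = fd (\<lambda>t. G t v w) u a"

text \<open>The Christoffel symbols of the first kind.\<close>
definition koszul ::
    "(real ^ 'n \<Rightarrow> real ^ 'n \<Rightarrow> real ^ 'n \<Rightarrow> real) \<Rightarrow> real ^ 'n \<Rightarrow> real ^ 'n \<Rightarrow> real ^ 'n \<Rightarrow> real ^ 'n \<Rightarrow> real" where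
  "koszul G u v w y = (metric_deriv G u v w y + metric_deriv G u w v y - metric_deriv G u y v w) / 2"

locale local_metric =
  fixes D :: "(real ^ 'n) set" and G :: "real ^ 'n \<Rightarrow> real ^ 'n \<Rightarrow> real ^ 'n::finite \<Rightarrow> real"
  assumes open_D: "open D"
    and bil: "u \<in> D \<Longrightarrow> bilinear (G u)"
    and sym: "u \<in> D \<Longrightarrow> G u v w = G u w v"
    and nondeg: "u \<in> D \<Longrightarrow> (\<And>w. G u v w = 0) \<Longrightarrow> v = 0"
    and smooth: "smooth_on D (\<lambda>u. G u v w)"
begin

lemma lin1: "u \<in> D \<Longrightarrow> linear (\<lambda>v. G u v w)" and lin2: "u \<in> D \<Longrightarrow> linear (G u v)"
  using bil by (auto simp: bilinear_def)

lemmas G_simps = linear_add[OF lin1] linear_diff[OF lin1] linear_scale[OF lin1] linear_neg[OF lin1]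
  linear_add[OF lin2] linear_diff[OF lin2] linear_scale[OF lin2] linear_neg[OF lin2]
  linear_0[OF lin1] linear_0[OF lin2]

lemma G_eqI: "u \<in> D \<Longrightarrow> (\<And>w. G u v w = G u v' w) \<Longrightarrow> v = v'"
  using nondeg[of u "v - v'"] by (simp add: G_simps)

lemma G_deriv: "u \<in> D \<Longrightarrow> ((\<lambda>t. G t v w) has_derivative (\<lambda>a. metric_deriv G u a v w)) (at u)"
  unfolding metric_deriv_def by (rule fd_works[OF smooth_on_differentiable[OF smooth]])

lemma md_sym: "u \<in> D \<Longrightarrow> metric_deriv G u a v w = metric_deriv G u a w v"
  unfolding metric_deriv_def using fd_cong[OF open_D, of u "\<lambda>t. G t v w" "\<lambda>t. G t w v"] sym by metis

lemma md_lin1: "u \<in> D \<Longrightarrow> linear (\<lambda>a. metric_deriv G u a v w)"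
  using has_derivative_linear[OF G_deriv] by simp

lemma md_lin2: assumes u: "u \<in> D" shows "linear (\<lambda>v. metric_deriv G u a v w)"
proof (rule linearI)
  have "((\<lambda>t. G t (v + v') w) has_derivative (\<lambda>a. metric_deriv G u a v w + metric_deriv G u a v' w)) (at u)" for v v'
    by (rule has_derivative_transform_within_open[OF has_derivative_add[OF G_deriv[OF u] G_deriv[OF u]] open_D u])
      (simp add: G_simps)
  from has_derivative_unique[OF G_deriv[OF u] this]
  show "metric_deriv G u a (v + v') w = metric_deriv G u a v w + metric_deriv G u a v' w" for v v' by metis
  have "((\<lambda>t. G t (r *\<^sub>R v) w) has_derivative (\<lambda>a. r *\<^sub>R metric_deriv G u a v w)) (at u)" for v r
    by (rule has_derivative_transform_within_open[OF has_derivative_scaleR_right[OF G_deriv[OF u]] open_D u])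
      (simp add: G_simps)
  from has_derivative_unique[OF G_deriv[OF u] this]
  show "metric_deriv G u a (r *\<^sub>R v) w = r *\<^sub>R metric_deriv G u a v w" for v r by metis
qed

lemma md_lin3: "u \<in> D \<Longrightarrow> linear (\<lambda>w. metric_deriv G u a v w)"
  using md_lin2[of u a v] md_sym[of u a v] by simp

lemma koszul_lin1: "u \<in> D \<Longrightarrow> linear (\<lambda>v. koszul G u v w y)"
  and koszul_lin2: "u \<in> D \<Longrightarrow> linear (\<lambda>w. koszul G u v w y)"
  and koszul_lin3: "u \<in> D \<Longrightarrow> linear (\<lambda>y. koszul G u v w y)"
  unfolding koszul_def
  by (rule linearI; simp add: linear_add[OF md_lin1] linear_add[OF md_lin2] linear_add[OF md_lin3]
      linear_scale[OF md_lin1] linear_scale[OF md_lin2] linear_scale[OF md_lin3] field_simps)+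

lemma koszul_bilinear: "u \<in> D \<Longrightarrow> bilinear (koszul G u v)"
  using koszul_lin2 koszul_lin3 by (simp add: bilinear_def)

lemma koszul_sym: "u \<in> D \<Longrightarrow> koszul G u v w y = koszul G u w v y"
  unfolding koszul_def using md_sym[of u y v w] by simp

text \<open>The connection is compatible with the metric.\<close>
lemma koszul_compat: "u \<in> D \<Longrightarrow> koszul G u a v w + koszul G u a w v = metric_deriv G u a v w"
  unfolding koszul_def using md_sym[of u a w v] md_sym[of u v w a] md_sym[of u w v a] by (simp add: field_simps)

lemma koszul_differentiable: "u \<in> D \<Longrightarrow> (\<lambda>t. koszul G t v w y) differentiable at u"
  unfolding koszul_def metric_deriv_def
  by (intro differentiable_divide differentiable_diff differentiable_add
      smooth_on_differentiable[OF smooth_on_fd[OF smooth]]) auto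

lemma christoffel_spec:
  assumes u: "u \<in> D" shows "G u (christoffel G u v w) y = koszul G u v w y"
proof -
  have eq: "christoffel G u v w = (THE z. \<forall>y. G u z y = koszul G u v w y)"
    unfolding christoffel_def koszul_def metric_deriv_def
    by (rule arg_cong[where f = The]) (auto simp: field_simps fun_eq_iff)
  have "\<exists>!z. \<forall>y. G u z y = koszul G u v w y"
    by (rule bilinear_form_represents[OF bil[OF u] nondeg[OF u] koszul_lin3[OF u]])
  from theI'[OF this] show ?thesis unfolding eq by simp
qed

lemma christoffel_lin1: assumes u: "u \<in> D" shows "linear (\<lambda>v. christoffel G u v w)"
  by (rule linearI; rule G_eqI[OF u])
    (simp_all add: G_simps u christoffel_spec linear_add[OF koszul_lin1] linear_scale[OF koszul_lin1])

lemma christoffel_sym: "u \<in> D \<Longrightarrow> christoffel G u v w = christoffel G u w v"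
  by (rule G_eqI, assumption) (metis christoffel_spec koszul_sym)

lemma christoffel_differentiable: "u \<in> D \<Longrightarrow> (\<lambda>t. christoffel G t v w) differentiable at u"
  by (rule differentiable_solve_form[OF open_D, where A = G and b = "\<lambda>t. koszul G t v w"])
    (use bil nondeg christoffel_spec koszul_differentiable smooth_on_differentiable[OF smooth] in blast)+

text \<open>
  The Leibniz rule for \<open>G (christoffel G t y z) w = koszul G t y z w\<close> moves all derivatives to the
  symbols of the first kind, which are explicit in the derivatives of the metric. Their pullback
  along a map can then be differentiated directly.
\<close>
lemma curvature_lowered:
  assumes u: "u \<in> D"
  shows "G u (curvature_field G (\<lambda>_. x) (\<lambda>_. y) (\<lambda>_. z) u) w =
     fd (\<lambda>t. koszul G t y z w) u x - fd (\<lambda>t. koszul G t x z w) u y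
     - G u (christoffel G u x w) (christoffel G u y z) + G u (christoffel G u y w) (christoffel G u x z)"
proof -
  have nab: "nabla G (\<lambda>_. y) (\<lambda>_. z) = (\<lambda>t. christoffel G t y z)" for y
    by (simp add: nabla_def frechet_derivative_const fun_eq_iff)
  have lie: "lie_bracket (\<lambda>_. x) (\<lambda>_. y) = (\<lambda>_. 0)"
    by (simp add: lie_bracket_def frechet_derivative_const fun_eq_iff)
  have part: "G u (nabla G (\<lambda>_. x) (\<lambda>t. christoffel G t y z) u) w =
      fd (\<lambda>t. koszul G t y z w) u x - G u (christoffel G u x w) (christoffel G u y z)" for x y
  proof -
    have d: "((\<lambda>t. christoffel G t y z) has_derivative fd (\<lambda>t. christoffel G t y z) u) (at u)"
      by (rule fd_works[OF christoffel_differentiable[OF u]])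
    have "((\<lambda>t. G t (christoffel G t y z) w) has_derivative
       (\<lambda>h. metric_deriv G u h (christoffel G u y z) w + G u (fd (\<lambda>t. christoffel G t y z) u h) w)) (at u)"
      by (rule has_derivative_linear_family[OF open_D u _ G_deriv[OF u] d]) (rule lin1)
    then have "((\<lambda>t. koszul G t y z w) has_derivative
       (\<lambda>h. metric_deriv G u h (christoffel G u y z) w + G u (fd (\<lambda>t. christoffel G t y z) u h) w)) (at u)"
      by (rule has_derivative_transform_within_open[OF _ open_D u]) (simp add: christoffel_spec)
    then have "fd (\<lambda>t. koszul G t y z w) u x =
       metric_deriv G u x (christoffel G u y z) w + G u (fd (\<lambda>t. christoffel G t y z) u x) w"
      by (simp add: fd_unique)
    also have "metric_deriv G u x (christoffel G u y z) w =
       G u (christoffel G u x (christoffel G u y z)) w + G u (christoffel G u x w) (christoffel G u y z)"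
      by (simp add: christoffel_spec u koszul_compat)
    finally show ?thesis by (simp add: nabla_def G_simps u)
  qed
  have "nabla G (\<lambda>_. 0) (\<lambda>_. z) u = 0"
    using linear_0[OF christoffel_lin1[OF u]] by (simp add: nab)
  then show ?thesis
    unfolding curvature_field_def nab lie by (simp add: G_simps u part)
qed

end

text \<open>
  Two instances matter: an immersion written in charts, where the dimensions differ by one, and a
  change of charts, where they agree.
\<close>
locale local_isometry = M: local_metric D G + N: local_metric E G'
  for D :: "(real ^ 'n) set" and G :: "real ^ 'n \<Rightarrow> real ^ 'n \<Rightarrow> real ^ 'n::finite \<Rightarrow> real"
    and E :: "(real ^ 'm) set" and G' :: "real ^ 'm \<Rightarrow> real ^ 'm \<Rightarrow> real ^ 'm::finite \<Rightarrow> real" +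
  fixes F :: "real ^ 'n \<Rightarrow> real ^ 'm"
  assumes smooth_F: "smooth_on D F" and F_in: "u \<in> D \<Longrightarrow> F u \<in> E"
    and isometry: "u \<in> D \<Longrightarrow> G u v w = G' (F u) (fd F u v) (fd F u w)"
begin

definition hess :: "real ^ 'n \<Rightarrow> real ^ 'n \<Rightarrow> real ^ 'n \<Rightarrow> real ^ 'm" where
  "hess u a v = fd (\<lambda>t. fd F t v) u a"

lemma F_deriv: "u \<in> D \<Longrightarrow> (F has_derivative fd F u) (at u)"
  by (rule fd_works[OF smooth_on_differentiable[OF smooth_F]])

lemma dF_linear: "u \<in> D \<Longrightarrow> linear (fd F u)"
  using F_deriv has_derivative_linear by blast

lemma dF_deriv: "u \<in> D \<Longrightarrow> ((\<lambda>t. fd F t v) has_derivative (\<lambda>a. hess u a v)) (at u)"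
  unfolding hess_def by (rule fd_works[OF smooth_on_differentiable[OF smooth_on_fd[OF smooth_F]]])

lemma hess_sym: "u \<in> D \<Longrightarrow> hess u a v = hess u v a"
  unfolding hess_def by (rule mixed_derivatives_commute[OF smooth_F])

lemma hess_deriv: "u \<in> D \<Longrightarrow> ((\<lambda>t. hess t a v) has_derivative (\<lambda>b. fd (\<lambda>t. hess t a v) u b)) (at u)"
  unfolding hess_def by (rule fd_works[OF smooth_on_differentiable[OF smooth_on_fd[OF smooth_on_fd[OF smooth_F]]]])

lemma third_sym: assumes u: "u \<in> D" shows "fd (\<lambda>t. hess t a v) u b = fd (\<lambda>t. hess t b v) u a"
  unfolding hess_def by (rule mixed_derivatives_commute[OF smooth_on_fd[OF smooth_F] u])

lemma pullback_deriv:
  fixes B :: "real ^ 'm \<Rightarrow> 'b::euclidean_space \<Rightarrow> 'c::euclidean_space \<Rightarrow> 'd::real_normed_vector"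
  assumes u: "u \<in> D"
    and B: "\<And>t. t \<in> E \<Longrightarrow> bilinear (B t)"
    and B': "\<And>v w. ((\<lambda>t. B t v w) has_derivative (\<lambda>a. dB a v w)) (at (F u))"
    and V: "(V has_derivative V') (at u)" and W: "(W has_derivative W') (at u)"
  shows "((\<lambda>t. B (F t) (V t) (W t)) has_derivative
    (\<lambda>h. dB (fd F u h) (V u) (W u) + B (F u) (V' h) (W u) + B (F u) (V u) (W' h))) (at u)"
proof (rule has_derivative_bilinear_family[OF M.open_D u, where B = "\<lambda>t. B (F t)"
      and B' = "\<lambda>v w h. dB (fd F u h) v w", OF _ _ V W])
  show "((\<lambda>t. B (F t) v w) has_derivative (\<lambda>h. dB (fd F u h) v w)) (at u)" for v w
    by (rule has_derivative_compose[OF F_deriv[OF u] B'])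
qed (use B F_in in blast)

lemma metric_deriv_pullback:
  assumes u: "u \<in> D"
  shows "metric_deriv G u a v w = metric_deriv G' (F u) (fd F u a) (fd F u v) (fd F u w)
     + G' (F u) (hess u a v) (fd F u w) + G' (F u) (fd F u v) (hess u a w)"
proof -
  have "((\<lambda>t. G' (F t) (fd F t v) (fd F t w)) has_derivative
    (\<lambda>h. metric_deriv G' (F u) (fd F u h) (fd F u v) (fd F u w)
     + G' (F u) (hess u h v) (fd F u w) + G' (F u) (fd F u v) (hess u h w))) (at u)"
    by (rule pullback_deriv[OF u N.bil N.G_deriv[OF F_in[OF u]] dF_deriv[OF u] dF_deriv[OF u]])
  then have "((\<lambda>t. G t v w) has_derivative
    (\<lambda>h. metric_deriv G' (F u) (fd F u h) (fd F u v) (fd F u w)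
     + G' (F u) (hess u h v) (fd F u w) + G' (F u) (fd F u v) (hess u h w))) (at u)"
    by (rule has_derivative_transform_within_open[OF _ M.open_D u]) (simp add: isometry)
  from has_derivative_unique[OF M.G_deriv[OF u] this] show ?thesis by metis
qed

lemma koszul_pullback:
  assumes u: "u \<in> D"
  shows "koszul G u v w y = koszul G' (F u) (fd F u v) (fd F u w) (fd F u y) + G' (F u) (hess u v w) (fd F u y)"
  unfolding koszul_def metric_deriv_pullback[OF u]
  using hess_sym[OF u, of v w] hess_sym[OF u, of y v] hess_sym[OF u, of y w]
    N.sym[OF F_in[OF u]] by (simp add: field_simps)

text \<open>
  The ambient covariant derivative, in direction of the image of \<open>v\<close>, of the image of the constant
  field \<open>w\<close>; its normal part is the second fundamental form.
\<close>
definition accel :: "real ^ 'n \<Rightarrow> real ^ 'n \<Rightarrow> real ^ 'n \<Rightarrow> real ^ 'm" where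
  "accel u v w = hess u v w + christoffel G' (F u) (fd F u v) (fd F u w)"

lemma accel_sym: "u \<in> D \<Longrightarrow> accel u v w = accel u w v"
  unfolding accel_def using hess_sym N.christoffel_sym F_in by metis

lemma accel_tangential:
  assumes u: "u \<in> D"
  shows "G' (F u) (accel u v w) (fd F u y) = G' (F u) (fd F u (christoffel G u v w)) (fd F u y)"
  unfolding isometry[OF u, symmetric] M.christoffel_spec[OF u] koszul_pullback[OF u]
  by (simp add: accel_def N.G_simps F_in[OF u] N.christoffel_spec)

lemma koszul_deriv:
  assumes u: "u \<in> D"
  shows "fd (\<lambda>t. koszul G t y z w) u x =
     fd (\<lambda>s. koszul G' s (fd F u y) (fd F u z) (fd F u w)) (F u) (fd F u x)
   + koszul G' (F u) (hess u x y) (fd F u z) (fd F u w)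
   + koszul G' (F u) (fd F u y) (hess u x z) (fd F u w)
   + koszul G' (F u) (fd F u y) (fd F u z) (hess u x w)
   + metric_deriv G' (F u) (fd F u x) (hess u y z) (fd F u w)
   + G' (F u) (fd (\<lambda>t. hess t y z) u x) (fd F u w)
   + G' (F u) (hess u y z) (hess u x w)"
proof -
  have Fu: "F u \<in> E" by (rule F_in[OF u])
  have k: "((\<lambda>s. koszul G' s a b c) has_derivative fd (\<lambda>s. koszul G' s a b c) (F u)) (at (F u))" for a b c
    by (rule fd_works[OF N.koszul_differentiable[OF Fu]])
  have 1: "((\<lambda>t. koszul G' (F t) (fd F t y) (fd F t z) (fd F t w)) has_derivative
     (\<lambda>x. fd (\<lambda>s. koszul G' s (fd F u y) (fd F u z) (fd F u w)) (F u) (fd F u x)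
   + koszul G' (F u) (hess u x y) (fd F u z) (fd F u w)
   + koszul G' (F u) (fd F u y) (hess u x z) (fd F u w)
   + koszul G' (F u) (fd F u y) (fd F u z) (hess u x w))) (at u)"
    by (rule has_derivative_trilinear_family[OF M.open_D u _ _
          has_derivative_compose[OF F_deriv[OF u] k] dF_deriv[OF u] dF_deriv[OF u] dF_deriv[OF u]])
      (simp_all add: F_in N.koszul_lin1 N.koszul_bilinear)
  have 2: "((\<lambda>t. G' (F t) (hess t y z) (fd F t w)) has_derivative
     (\<lambda>x. metric_deriv G' (F u) (fd F u x) (hess u y z) (fd F u w)
   + G' (F u) (fd (\<lambda>t. hess t y z) u x) (fd F u w)
   + G' (F u) (hess u y z) (hess u x w))) (at u)"
    by (rule pullback_deriv[OF u N.bil N.G_deriv[OF Fu] hess_deriv[OF u] dF_deriv[OF u]])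
  have "((\<lambda>t. koszul G t y z w) has_derivative
     (\<lambda>x. (fd (\<lambda>s. koszul G' s (fd F u y) (fd F u z) (fd F u w)) (F u) (fd F u x)
   + koszul G' (F u) (hess u x y) (fd F u z) (fd F u w)
   + koszul G' (F u) (fd F u y) (hess u x z) (fd F u w)
   + koszul G' (F u) (fd F u y) (fd F u z) (hess u x w))
   + (metric_deriv G' (F u) (fd F u x) (hess u y z) (fd F u w)
   + G' (F u) (fd (\<lambda>t. hess t y z) u x) (fd F u w)
   + G' (F u) (hess u y z) (hess u x w)))) (at u)"
    by (rule has_derivative_transform_within_open[OF has_derivative_add[OF 1 2] M.open_D u])
      (simp add: koszul_pullback)
  from fd_unique[OF this] show ?thesis by (simp add: add.assoc)
qed

text \<open>
  On subtracting \<open>koszul_deriv\<close> with \<open>x\<close> and \<open>y\<close> exchanged, the third derivatives of \<open>F\<close>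
  and the terms with \<open>hess u x y\<close> cancel by symmetry. Compatibility of the ambient connection
  rewrites the derivative of \<open>G'\<close>; one part cancels a term in \<open>hess u x z\<close>, and the others
  complete the products of second derivatives to products of \<open>accel\<close>.
\<close>
lemma curvature_pullback:
  assumes u: "u \<in> D"
  shows "G u (curvature_field G (\<lambda>_. x) (\<lambda>_. y) (\<lambda>_. z) u) w
      + G u (christoffel G u x w) (christoffel G u y z) - G u (christoffel G u y w) (christoffel G u x z)
    = G' (F u) (curvature_field G' (\<lambda>_. fd F u x) (\<lambda>_. fd F u y) (\<lambda>_. fd F u z) (F u)) (fd F u w)
      + G' (F u) (accel u x w) (accel u y z) - G' (F u) (accel u y w) (accel u x z)"
proof -
  have Fu: "F u \<in> E" by (rule F_in[OF u])
  let ?d = "fd F u" and ?\<Gamma> = "christoffel G' (F u)"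
  have md: "metric_deriv G' (F u) (?d a) (hess u b z) (?d w) =
      koszul G' (F u) (?d a) (hess u b z) (?d w) + G' (F u) (?\<Gamma> (?d a) (?d w)) (hess u b z)" for a b
    by (simp add: N.koszul_compat[OF Fu, symmetric] N.christoffel_spec[OF Fu])
  have k: "koszul G' (F u) (?d a) (?d z) (hess u b w) = G' (F u) (hess u b w) (?\<Gamma> (?d a) (?d z))" for a b
    by (simp add: N.christoffel_spec[OF Fu, symmetric] N.sym[OF Fu])
  have acc: "G' (F u) (accel u x w) (accel u y z) =
       G' (F u) (hess u x w) (hess u y z) + G' (F u) (hess u x w) (?\<Gamma> (?d y) (?d z))
     + G' (F u) (?\<Gamma> (?d x) (?d w)) (hess u y z) + G' (F u) (?\<Gamma> (?d x) (?d w)) (?\<Gamma> (?d y) (?d z))" for x y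
    by (simp add: accel_def N.G_simps Fu)
  show ?thesis
    unfolding M.curvature_lowered[OF u] N.curvature_lowered[OF Fu] koszul_deriv[OF u] md k acc
    using hess_sym[OF u, of x y] third_sym[OF u, of y z x]
      N.sym[OF Fu, of "hess u y z" "hess u x w"] N.sym[OF Fu, of "hess u x z" "hess u y w"]
    by simp
qed

text \<open>
  The transformation law of the Christoffel symbols under a change of charts: nothing is normal to
  the image, so \<open>accel\<close> is equal to its tangential part.
\<close>
lemma christoffel_transform:
  assumes u: "u \<in> D" and onto: "surj (fd F u)"
  shows "fd F u (christoffel G u v w) = accel u v w"
  by (rule N.G_eqI[OF F_in[OF u]]) (metis onto accel_tangential[OF u] surjD)

text \<open>
  Differentiating \<open>G' \<eta> (dF y) = 0\<close> moves the derivative from the normal field to the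
  tangential one. It is this form of the second fundamental tensor that shows its symmetry.
\<close>
lemma Weingarten_tangential:
  assumes u: "u \<in> D" and T: "open T" "u \<in> T"
    and \<eta>: "\<eta> differentiable at u"
    and orth: "\<And>t y. t \<in> T \<Longrightarrow> t \<in> D \<Longrightarrow> G' (F t) (\<eta> t) (fd F t y) = 0"
  shows "G' (F u) (fd \<eta> u x + christoffel G' (F u) (fd F u x) (\<eta> u)) (fd F u y) = - G' (F u) (\<eta> u) (accel u x y)"
proof -
  have Fu: "F u \<in> E" by (rule F_in[OF u])
  have "((\<lambda>t. G' (F t) (\<eta> t) (fd F t y)) has_derivative
    (\<lambda>h. metric_deriv G' (F u) (fd F u h) (\<eta> u) (fd F u y)
     + G' (F u) (fd \<eta> u h) (fd F u y) + G' (F u) (\<eta> u) (hess u h y))) (at u)"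
    by (rule pullback_deriv[OF u N.bil N.G_deriv[OF Fu] fd_works[OF \<eta>] dF_deriv[OF u]])
  then have "((\<lambda>t. 0) has_derivative
    (\<lambda>h. metric_deriv G' (F u) (fd F u h) (\<eta> u) (fd F u y)
     + G' (F u) (fd \<eta> u h) (fd F u y) + G' (F u) (\<eta> u) (hess u h y))) (at u)"
    by (rule has_derivative_transform_within_open[where s = "T \<inter> D"])
      (use T u M.open_D orth in auto)
  from has_derivative_unique[OF this has_derivative_const]
  have "metric_deriv G' (F u) (fd F u x) (\<eta> u) (fd F u y)
     + G' (F u) (fd \<eta> u x) (fd F u y) + G' (F u) (\<eta> u) (hess u x y) = 0" by metis
  then show ?thesis
    unfolding accel_def N.koszul_compat[OF Fu, symmetric]
    by (simp add: N.G_simps Fu N.christoffel_spec[OF Fu] N.sym[OF Fu, of "\<eta> u" "christoffel _ _ _ _"])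
qed

lemma Weingarten_normal:
  assumes u: "u \<in> D" and T: "open T" "u \<in> T"
    and \<eta>: "\<eta> differentiable at u"
    and unit: "\<And>t. t \<in> T \<Longrightarrow> t \<in> D \<Longrightarrow> G' (F t) (\<eta> t) (\<eta> t) = e"
  shows "G' (F u) (fd \<eta> u x + christoffel G' (F u) (fd F u x) (\<eta> u)) (\<eta> u) = 0"
proof -
  have Fu: "F u \<in> E" by (rule F_in[OF u])
  have "((\<lambda>t. G' (F t) (\<eta> t) (\<eta> t)) has_derivative
    (\<lambda>h. metric_deriv G' (F u) (fd F u h) (\<eta> u) (\<eta> u)
     + G' (F u) (fd \<eta> u h) (\<eta> u) + G' (F u) (\<eta> u) (fd \<eta> u h))) (at u)"
    by (rule pullback_deriv[OF u N.bil N.G_deriv[OF Fu] fd_works[OF \<eta>] fd_works[OF \<eta>]])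
  then have "((\<lambda>t. e) has_derivative
    (\<lambda>h. metric_deriv G' (F u) (fd F u h) (\<eta> u) (\<eta> u)
     + G' (F u) (fd \<eta> u h) (\<eta> u) + G' (F u) (\<eta> u) (fd \<eta> u h))) (at u)"
    by (rule has_derivative_transform_within_open[where s = "T \<inter> D"])
      (use T u M.open_D unit in auto)
  from has_derivative_unique[OF this has_derivative_const]
  have "metric_deriv G' (F u) (fd F u x) (\<eta> u) (\<eta> u)
     + G' (F u) (fd \<eta> u x) (\<eta> u) + G' (F u) (\<eta> u) (fd \<eta> u x) = 0" by metis
  then show ?thesis
    unfolding N.koszul_compat[OF Fu, symmetric]
    by (simp add: N.G_simps Fu N.christoffel_spec[OF Fu] N.sym[OF Fu, of "\<eta> u"])
qed

end

section \<open>Algebra on a tangent space where the Gauss equation holds\<close>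

lemma trace_matrix: "trace (matrix f) = (\<Sum>i\<in>UNIV. f (axis i 1) $ i)"
  by (simp add: trace_def matrix_def)

lemma trace_matrix_add: "trace (matrix (\<lambda>z. f z + h z)) = trace (matrix f) + trace (matrix h)"
  and trace_matrix_diff: "trace (matrix (\<lambda>z. f z - h z)) = trace (matrix f) - trace (matrix h)"
  and trace_matrix_scale: "trace (matrix (\<lambda>z. r *\<^sub>R f z)) = r * trace (matrix f)"
  for f h :: "real ^ 'n \<Rightarrow> real ^ 'n::finite"
  by (simp_all add: trace_matrix sum.distrib sum_subtractf sum_distrib_left)

lemma trace_matrix_id: "trace (matrix (\<lambda>z :: real ^ 'n::finite. z)) = real CARD('n)"
  by (simp add: trace_matrix)

lemma trace_matrix_rank_one:
  fixes l :: "real ^ 'n::finite \<Rightarrow> real"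
  assumes "linear l" shows "trace (matrix (\<lambda>z. l z *\<^sub>R v)) = l v"
proof -
  have "v = (\<Sum>j\<in>UNIV. v $ j *\<^sub>R axis j 1)"
    using basis_expansion[of v] by (simp add: scalar_mult_eq_scaleR)
  then have "l v = l (\<Sum>j\<in>UNIV. v $ j *\<^sub>R axis j 1)" by simp
  also have "\<dots> = (\<Sum>j\<in>UNIV. v $ j * l (axis j 1))"
    using assms by (simp add: linear_sum linear_scale)
  finally show ?thesis by (simp add: trace_matrix mult.commute)
qed

locale scalar_product =
  fixes g :: "real ^ 'n::finite \<Rightarrow> real ^ 'n \<Rightarrow> real"
  assumes g_bil: "bilinear g" and g_sym: "g v w = g w v"
    and g_nondeg: "(\<And>w. g v w = 0) \<Longrightarrow> v = 0"
begin

lemma g_lin: "linear (\<lambda>v. g v w)" "linear (g v)"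
  using g_bil by (auto simp: bilinear_def)

lemmas g_simps = linear_add[OF g_lin(1)] linear_diff[OF g_lin(1)] linear_scale[OF g_lin(1)]
  linear_add[OF g_lin(2)] linear_diff[OF g_lin(2)] linear_scale[OF g_lin(2)]

lemma g_eqI: "(\<And>w. g v w = g v' w) \<Longrightarrow> v = v'"
  using g_nondeg[of "v - v'"] by (simp add: g_simps)

lemma the_representing: "linear l \<Longrightarrow> g (THE z. \<forall>y. g z y = l y) w = l w"
  using theI'[OF bilinear_form_represents[OF g_bil g_nondeg, of l]] by blast

lemma assoc_op_spec: "bilinear T \<Longrightarrow> g (assoc_op g T x) y = T x y"
  unfolding assoc_op_def by (rule the_representing) (simp add: bilinear_def)

lemma assoc_op_eqI: "bilinear T \<Longrightarrow> (\<And>y. g v y = T x y) \<Longrightarrow> assoc_op g T x = v"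
  by (rule g_eqI) (simp add: assoc_op_spec)

lemma assoc_op_linear: assumes T: "bilinear T" shows "linear (assoc_op g T)"
proof -
  have l: "linear (\<lambda>v. T v w)" for w using T by (simp add: bilinear_def)
  show ?thesis
    by (intro linearI assoc_op_eqI[OF T])
      (simp_all add: g_simps assoc_op_spec[OF T] linear_add[OF l] linear_scale[OF l])
qed

lemma assoc_endo_eqI:
  assumes "\<And>w. g v w = B x y z w" shows "assoc_endo g B x y z = v"
  unfolding assoc_endo_def
  by (rule the_equality) (use assms in \<open>auto intro: g_eqI\<close>)

lemma form_power_2: "form_power g T 2 x y = T (assoc_op g T x) y"
  and form_power_3: "form_power g T 3 x y = form_power g T 2 (assoc_op g T x) y"
  by (simp_all add: numeral_2_eq_2 numeral_3_eq_3)

text \<open>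
  Apart from multiples of the shape operator and of the identity, the endomorphism whose trace is
  taken is a sum of endomorphisms of rank one, \<open>z \<mapsto> l z *\<^sub>R v\<close>, with trace \<open>l v\<close>.
\<close>
lemma Ricci_of_Gauss_equation:
  assumes H: "bilinear H"
    and Rop: "\<And>x y z w. g (Rop x y z) w
      = \<epsilon> / 2 * kulkarni_nomizu H H x y z w + c / 2 * kulkarni_nomizu g g x y z w"
    and "\<And>x y. H x y = H y x"
  shows "trace (matrix (\<lambda>z. Rop z x y))
    = \<epsilon> * (form_trace g H * H x y - form_power g H 2 x y) + (real CARD('n) - 1) * c * g x y"
proof -
  let ?a = "assoc_op g H"
  have "Rop z x y = \<epsilon> *\<^sub>R (H x y *\<^sub>R ?a z - H z y *\<^sub>R ?a x) + c *\<^sub>R (g x y *\<^sub>R z - g z y *\<^sub>R x)" for z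
    by (rule g_eqI) (simp add: Rop g_simps assoc_op_spec[OF H] kulkarni_nomizu_def field_simps)
  then have "(\<lambda>z. Rop z x y) = (\<lambda>z. \<epsilon> *\<^sub>R (H x y *\<^sub>R ?a z - H z y *\<^sub>R ?a x) + c *\<^sub>R (g x y *\<^sub>R z - g z y *\<^sub>R x))"
    by blast
  moreover have "linear (\<lambda>z. H z y)" using H by (simp add: bilinear_def)
  ultimately show ?thesis
    by (simp add: trace_matrix_add trace_matrix_diff trace_matrix_scale trace_matrix_id
        trace_matrix_rank_one g_lin form_trace_def form_power_2) (simp add: algebra_simps)
qed

end

text \<open>
  The tangent space at a point of \<open>\<U>\<^sub>H\<close>; \<open>Rop\<close> is the curvature operator and \<open>t\<close> the trace of \<open>H\<close>.
\<close>
locale Gauss_point = scalar_product g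
  for g :: "real ^ 'n::finite \<Rightarrow> real ^ 'n \<Rightarrow> real" +
  fixes H :: "'n form2" and Rop :: "real ^ 'n \<Rightarrow> real ^ 'n \<Rightarrow> real ^ 'n \<Rightarrow> real ^ 'n"
    and \<epsilon> c \<phi> \<psi> \<rho> n t :: real
    and S :: "'n form2" and R :: "'n form4"
  assumes H_bil: "bilinear H" and H_sym: "H v w = H w v"
    and eps: "\<epsilon> \<in> {-1, 1}" and n_def: "n = real CARD('n)" and n_ge: "n \<ge> 4"
    and Gauss: "R x y z w = \<epsilon> / 2 * kulkarni_nomizu H H x y z w + c / 2 * kulkarni_nomizu g g x y z w"
    and Rop: "g (Rop x y z) w = R x y z w"
    and S_def: "S x y = trace (matrix (\<lambda>z. Rop z x y))"
    and cubic: "form_power g H 3 x y = \<phi> * form_power g H 2 x y + \<psi> * H x y + \<rho> * g x y"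
    and t_def: "t = form_trace g H"
begin

abbreviation a :: "real ^ 'n \<Rightarrow> real ^ 'n" where "a \<equiv> assoc_op g H"
abbreviation H2 :: "'n form2" where "H2 \<equiv> form_power g H 2"
abbreviation Sop :: "real ^ 'n \<Rightarrow> real ^ 'n" where "Sop \<equiv> assoc_op g S"
abbreviation S2 :: "'n form2" where "S2 \<equiv> form_power g S 2"

definition \<tau> where "\<tau> = \<rho> + (\<phi> - t) * (\<psi> + t * (\<phi> - t))"
definition \<rho>1 where "\<rho>1 = 2 * (n - 1) * c - \<epsilon> * (\<psi> + (\<phi> - t)\<^sup>2)"
definition \<rho>0 where "\<rho>0 = - ((n - 1)\<^sup>2 * c\<^sup>2) + \<epsilon> * (\<psi> + (\<phi> - t)\<^sup>2) * (n - 1) * c + \<rho> * (\<phi> - 2 * t)"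
definition \<beta>1 where "\<beta>1 = \<epsilon> * (\<phi> - t)"

lemma eps_cases: obtains "\<epsilon> = 1" | "\<epsilon> = -1" using eps by blast

lemma H_lin: "linear (\<lambda>v. H v w)" "linear (H v)"
  using H_bil by (auto simp: bilinear_def)

lemma a_spec: "g (a x) y = H x y" by (rule assoc_op_spec[OF H_bil])

lemma H2_eq: "H2 x y = H (a x) y" by (rule form_power_2)

lemma H2_a: "H2 (a x) y = \<phi> * H2 x y + \<psi> * H x y + \<rho> * g x y"
  using cubic by (simp add: form_power_3)

lemma H2_lin: "linear (\<lambda>v. H2 v w)" "linear (H2 v)"
  unfolding H2_eq using linear_compose[OF assoc_op_linear[OF H_bil] H_lin(1)] H_lin(2)
  by (auto simp: o_def)

lemma H2_sym: "H2 x y = H2 y x"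
  by (metis H2_eq H_sym a_spec g_sym)

lemma S_eq: "S x y = \<epsilon> * (t * H x y - H2 x y) + (n - 1) * c * g x y"
  unfolding S_def t_def n_def
  by (rule Ricci_of_Gauss_equation[OF H_bil _ H_sym]) (simp add: Rop Gauss)

lemma S_bil: "bilinear S"
  unfolding bilinear_def S_eq
  by (auto intro!: linearI simp: linear_add[OF H_lin(1)] linear_add[OF H_lin(2)] linear_scale[OF H_lin(1)]
    linear_scale[OF H_lin(2)] linear_add[OF H2_lin(1)] linear_add[OF H2_lin(2)] linear_scale[OF H2_lin(1)]
    linear_scale[OF H2_lin(2)] g_simps algebra_simps)

lemma S_sym: "S x y = S y x"
  using H_sym[of x y] H2_sym[of x y] g_sym[of x y] by (simp add: S_eq)

lemma Sop_spec: "g (Sop x) y = S x y" by (rule assoc_op_spec[OF S_bil])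

lemma Sop_eq: "Sop x = \<epsilon> *\<^sub>R (t *\<^sub>R a x - a (a x)) + ((n - 1) * c) *\<^sub>R x"
  by (rule assoc_op_eqI[OF S_bil]) (simp add: g_simps a_spec S_eq H2_eq)

lemma S_lin: "linear (\<lambda>v. S v w)" "linear (S v)"
  using S_bil by (auto simp: bilinear_def)

lemma S_a: "S (a x) y = \<epsilon> * (t * H2 x y - (\<phi> * H2 x y + \<psi> * H x y + \<rho> * g x y)) + (n - 1) * c * H x y"
  by (simp add: S_eq H2_a a_spec H2_eq[symmetric])

lemma H_Sop: "H (Sop x) y = \<epsilon> * (t * H2 x y - (\<phi> * H2 x y + \<psi> * H x y + \<rho> * g x y)) + (n - 1) * c * H x y"
  by (simp add: Sop_eq linear_add[OF H_lin(1)] linear_diff[OF H_lin(1)] linear_scale[OF H_lin(1)]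
      H2_eq[symmetric] H2_a)

text \<open>
  The key identity \<open>A = \<tau> H\<close>. Since \<open>S\<close> is a quadratic polynomial in the shape operator
  \<open>a\<close>, the form \<open>S\<^sup>2\<close> is one of degree four; the cubic equation reduces it to degree two, and
  \<open>\<rho>\<^sub>1\<close>, \<open>\<rho>\<^sub>0\<close>, \<open>\<tau>\<close> are its coefficients in terms of \<open>S\<close>, \<open>g\<close>, \<open>H\<close>.
\<close>
lemma S2_eq: "S2 x y = \<tau> * H x y + \<rho>1 * S x y + \<rho>0 * g x y"
proof -
  have S2: "S2 x y = \<epsilon> * (t * S (a x) y - S (a (a x)) y) + (n - 1) * c * S x y"
    by (simp add: form_power_2 Sop_eq linear_add[OF S_lin(1)] linear_diff[OF S_lin(1)] linear_scale[OF S_lin(1)])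
  \<comment> \<open>The cubic equation is applied twice here, to \<open>a\<^sup>3\<close> and to \<open>a\<^sup>4\<close>.\<close>
  have S_aa: "S (a (a x)) y = \<epsilon> * (t * (\<phi> * H2 x y + \<psi> * H x y + \<rho> * g x y)
      - (\<phi> * (\<phi> * H2 x y + \<psi> * H x y + \<rho> * g x y) + \<psi> * H2 x y + \<rho> * H x y)) + (n - 1) * c * H2 x y"
    by (simp add: S_a H2_a a_spec H2_eq[symmetric])
  show ?thesis
    unfolding S2 S_aa unfolding S_a S_eq[of x y] \<tau>_def \<rho>0_def \<rho>1_def
    by (rule eps_cases) (simp_all add: power2_eq_square algebra_simps)
qed

lemma curv_dot_eq:
  assumes T: "bilinear T" "\<And>x y. T x y = T y x" and "\<And>x y z w. g (B' x y z) w = B x y z w"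
  shows "curv_dot g B T x1 x2 x y = - T (B' x y x1) x2 - T (B' x y x2) x1"
proof -
  have "assoc_endo g B x y z = B' x y z" for z by (rule assoc_endo_eqI) (rule assms(3))
  then show ?thesis using T(2) unfolding curv_dot_def by metis
qed

lemma Rop_eq: "Rop x y z = \<epsilon> *\<^sub>R (H y z *\<^sub>R a x - H x z *\<^sub>R a y) + c *\<^sub>R (g y z *\<^sub>R x - g x z *\<^sub>R y)"
  by (rule g_eqI) (simp add: Rop Gauss g_simps a_spec kulkarni_nomizu_def field_simps)

lemma tachibana_eq:
  assumes "bilinear T" "\<And>x y. T x y = T y x"
  shows "tachibana E T x1 x2 x y =
    - E y x1 * T x x2 + E x x1 * T y x2 - E y x2 * T x x1 + E x x2 * T y x1"
proof -
  have l: "linear (\<lambda>v. T v w)" for w using assms(1) by (simp add: bilinear_def)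
  have "tachibana E T x1 x2 x y = - T (wedge_op E x y x1) x2 - T (wedge_op E x y x2) x1"
    unfolding tachibana_def using assms(2) by metis
  then show ?thesis by (simp add: wedge_op_def linear_diff[OF l] linear_scale[OF l])
qed

lemma S2_bil: "bilinear S2"
  unfolding bilinear_def S2_eq
  by (auto intro!: linearI simp: linear_add[OF H_lin(1)] linear_add[OF H_lin(2)] linear_scale[OF H_lin(1)]
    linear_scale[OF H_lin(2)] linear_add[OF S_lin(1)] linear_add[OF S_lin(2)] linear_scale[OF S_lin(1)]
    linear_scale[OF S_lin(2)] g_simps algebra_simps)

lemma S2_sym: "S2 x y = S2 y x"
  using H_sym[of x y] S_sym[of x y] g_sym[of x y] by (simp add: S2_eq)

lemmas tach = tachibana_eq[OF H_bil H_sym] tachibana_eq[OF S_bil S_sym] tachibana_eq[OF S2_bil S2_sym]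

text \<open>
  Both follow from \<open>S2_eq\<close>, because \<open>Q(E,T)\<close> is bilinear and changes sign when two symmetric
  forms \<open>E\<close> and \<open>T\<close> are exchanged; in particular \<open>Q(g,g)\<close> and \<open>Q(S,S)\<close> vanish.
\<close>
lemma Q_g_S2: "tachibana g S2 x1 x2 x y = \<tau> * tachibana g H x1 x2 x y + \<rho>1 * tachibana g S x1 x2 x y"
  unfolding tach S2_eq using g_sym[of x x1] by (simp add: algebra_simps)

lemma Q_S_S2: "tachibana S S2 x1 x2 x y = \<tau> * tachibana S H x1 x2 x y - \<rho>0 * tachibana g S x1 x2 x y"
  unfolding tach S2_eq by (simp add: algebra_simps)

text \<open>
  The operator \<open>Rop x y\<close> is \<open>\<epsilon> (a x) \<and> (a y) + c x \<and> y\<close>, so \<open>R \<cdot> S = \<epsilon> Q(H, S(a \<cdot>, \<cdot>)) + c Q(g,S)\<close>,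
  and \<open>S_a\<close> reduces the first term by the cubic equation.
\<close>
lemma R_dot_S_via_H: "curv_dot g R S x1 x2 x y = - \<beta>1 * tachibana S H x1 x2 x y
    + (\<rho> + (n - 1) * c * \<beta>1) * tachibana g H x1 x2 x y + c * tachibana g S x1 x2 x y"
proof -
  have S_Rop: "S (Rop x y z) w = \<epsilon> * (H y z * S (a x) w - H x z * S (a y) w) + c * (g y z * S x w - g x z * S y w)" for z w
    by (simp add: Rop_eq linear_add[OF S_lin(1)] linear_diff[OF S_lin(1)] linear_scale[OF S_lin(1)])
  show ?thesis
    unfolding curv_dot_eq[OF S_bil S_sym Rop] S_Rop tach unfolding S_a \<beta>1_def unfolding S_eq
    by (rule eps_cases) (simp_all add: algebra_simps)
qed

context
  assumes \<tau>_nz: "\<tau> \<noteq> 0"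
begin

lemma H_eq: "H x y = inverse \<tau> * (S2 x y - \<rho>1 * S x y - \<rho>0 * g x y)"
  using \<tau>_nz by (simp add: S2_eq)

lemma Q_g_H: "tachibana g H x1 x2 x y = inverse \<tau> * (tachibana g S2 x1 x2 x y - \<rho>1 * tachibana g S x1 x2 x y)"
  using \<tau>_nz by (simp add: Q_g_S2)

lemma Q_S_H: "tachibana S H x1 x2 x y = inverse \<tau> * (tachibana S S2 x1 x2 x y + \<rho>0 * tachibana g S x1 x2 x y)"
  using \<tau>_nz by (simp add: Q_S_S2)

lemma R_eq: "R x1 x2 x3 x4 = \<epsilon> / 2 * (inverse \<tau>)\<^sup>2 *
      kulkarni_nomizu (\<lambda>x y. S2 x y - \<rho>1 * S x y - \<rho>0 * g x y) (\<lambda>x y. S2 x y - \<rho>1 * S x y - \<rho>0 * g x y) x1 x2 x3 x4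
    + c / 2 * kulkarni_nomizu g g x1 x2 x3 x4"
  using \<tau>_nz by (simp add: Gauss S2_eq kulkarni_nomizu_def power2_eq_square field_simps)

lemma R_dot_S: "curv_dot g R S x1 x2 x y =
    - inverse \<tau> * \<beta>1 * tachibana S S2 x1 x2 x y
    + inverse \<tau> * (\<rho> + (n - 1) * c * \<beta>1) * tachibana g S2 x1 x2 x y
    + (c - inverse \<tau> * \<rho> * \<rho>1 - inverse \<tau> * \<beta>1 * (\<rho>0 + (n - 1) * c * \<rho>1)) * tachibana g S x1 x2 x y"
  unfolding R_dot_S_via_H Q_g_H Q_S_H by (simp add: algebra_simps)

text \<open>
  By \<open>S2_eq\<close>, \<open>S\<^sup>3\<close> is a combination of \<open>S\<^sup>2\<close>, \<open>S\<close> and \<open>H (Sop \<cdot>) \<cdot>\<close>. The last one is a polynomial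
  in the shape operator, so it lies in the span of \<open>g\<close>, \<open>H\<close> and \<open>S\<close>, and \<open>H\<close> lies in the span
  of \<open>S\<^sup>2\<close>, \<open>S\<close> and \<open>g\<close>.
\<close>
lemma S3_combination: "\<exists>p q r. \<forall>x y. form_power g S 3 x y = p * g x y + q * S x y + r * S2 x y"
proof -
  have H2_S: "H2 x y = t * H x y - \<epsilon> * S x y + \<epsilon> * (n - 1) * c * g x y" for x y
    unfolding S_eq by (rule eps_cases) (simp_all add: algebra_simps)
  \<comment> \<open>The coefficients result from eliminating \<open>H2\<close> in favour of \<open>S\<close> by \<open>H2_S\<close>.\<close>
  obtain p q where H_Sop': "\<And>x y. H (Sop x) y = p * g x y + q * H x y + (\<phi> - t) * S x y"
  proof
    show "H (Sop x) y = (\<epsilon> * (\<epsilon> * (n - 1) * c * (t - \<phi>) - \<rho>)) * g x y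
        + (\<epsilon> * ((t - \<phi>) * t - \<psi>) + (n - 1) * c) * H x y + (\<phi> - t) * S x y" for x y
      unfolding H_Sop S_eq[of x y] by (rule eps_cases) (simp_all add: algebra_simps)
  qed
  have S3: "form_power g S 3 x y = \<tau> * H (Sop x) y + \<rho>1 * S2 x y + \<rho>0 * S x y" for x y
    by (simp add: form_power_3 S2_eq[of "Sop x"] form_power_2[symmetric] Sop_spec)
  have "form_power g S 3 x y = (\<tau> * p - q * \<rho>0) * g x y + (\<tau> * (\<phi> - t) - q * \<rho>1 + \<rho>0) * S x y + (q + \<rho>1) * S2 x y" for x y
    unfolding S3 H_Sop' H_eq[of x y] using \<tau>_nz by (simp add: field_simps)
  then show ?thesis by blast
qed

end

lemma partially_Einstein: "\<tau> = 0 \<Longrightarrow> S2 x y = \<rho>1 * S x y + \<rho>0 * g x y"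
  by (simp add: S2_eq)

end

locale Gauss_point_Weyl = Gauss_point +
  fixes C :: "'a form4" and \<kappa> \<kappa>t :: real
  assumes C_def: "C x y z w = R x y z w - 1 / (n - 2) * kulkarni_nomizu g S x y z w
      + \<kappa> / (2 * (n - 2) * (n - 1)) * kulkarni_nomizu g g x y z w"
    and \<kappa>t_eq: "\<kappa>t = n * (n + 1) * c"
begin

definition \<mu> where "\<mu> = 1 / (n - 2) * (\<kappa> / (n - 1) - \<kappa>t / (n + 1))"
definition \<beta>2 where "\<beta>2 = \<mu> + \<epsilon> / (n - 2) * (\<beta>1\<^sup>2 + \<psi>)"
definition \<beta>3 where "\<beta>3 = \<epsilon> * \<mu> * t + 1 / (n - 2) * (\<psi> * (2 * t - \<phi>) + (n - 3) * \<rho>)"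
definition \<beta>4 where "\<beta>4 = \<beta>3 - \<epsilon> * \<beta>2 * t + (n - 1) * \<kappa>t * \<beta>1 / (n * (n + 1))"

lemma \<mu>_eq: "\<mu> = \<kappa> / ((n - 2) * (n - 1)) - n * c / (n - 2)"
proof -
  have "\<kappa>t / (n + 1) = n * c" using n_ge unfolding \<kappa>t_eq by (simp add: field_simps)
  then show ?thesis using n_ge unfolding \<mu>_def by (simp add: diff_divide_distrib)
qed

lemma \<beta>2_eq: "\<beta>2 = c + \<kappa> / ((n - 2) * (n - 1)) - \<rho>1 / (n - 2)"
  unfolding \<beta>2_def \<mu>_eq \<beta>1_def \<rho>1_def using n_ge
  by (cases rule: eps_cases)
    (simp_all add: divide_simps, simp_all add: algebra_simps power2_eq_square)

lemma \<beta>4_eq: "\<beta>4 = \<rho> + (n - 1) * c * \<beta>1 - \<tau> / (n - 2)"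
proof -
  have "\<beta>3 - \<epsilon> * \<beta>2 * t = \<rho> - \<tau> / (n - 2)"
    unfolding \<beta>3_def \<beta>2_def \<beta>1_def \<tau>_def
    using n_ge by (cases rule: eps_cases)
      (simp_all add: divide_simps, simp_all add: algebra_simps power2_eq_square)
  moreover have "(n - 1) * \<kappa>t * \<beta>1 / (n * (n + 1)) = (n - 1) * c * \<beta>1"
  proof -
    have "\<kappa>t / (n * (n + 1)) = c" using n_ge unfolding \<kappa>t_eq by simp
    moreover have "(n - 1) * \<kappa>t * \<beta>1 / (n * (n + 1)) = (n - 1) * (\<kappa>t / (n * (n + 1))) * \<beta>1" by simp
    ultimately show ?thesis by metis
  qed
  ultimately show ?thesis unfolding \<beta>4_def by simp
qed

text \<open>
  Besides \<open>R \<cdot> S\<close>, the Weyl tensor contributes \<open>(g \<and> S) \<cdot> S = Q(g,S\<^sup>2)\<close>, as \<open>Q(S,S) = 0\<close>, and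
  \<open>(g \<and> g) \<cdot> S = 2 Q(g,S)\<close>. The functions \<open>\<beta>2\<close> and \<open>\<beta>4\<close> are the coefficients that result.
\<close>
lemma C_dot_S_via_H: "curv_dot g C S x1 x2 x y = - \<beta>1 * tachibana S H x1 x2 x y
    + \<beta>4 * tachibana g H x1 x2 x y + \<beta>2 * tachibana g S x1 x2 x y"
proof -
  define p where "p = 1 / (n - 2)"
  define q where "q = \<kappa> / ((n - 2) * (n - 1))"
  define Cop where "Cop x y z = Rop x y z
      - p *\<^sub>R (g y z *\<^sub>R Sop x + S y z *\<^sub>R x - g x z *\<^sub>R Sop y - S x z *\<^sub>R y)
      + q *\<^sub>R (g y z *\<^sub>R x - g x z *\<^sub>R y)" for x y z
  have q2: "\<kappa> / (2 * (n - 2) * (n - 1)) = q / 2" unfolding q_def by simp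
  have Cop: "g (Cop x y z) w = C x y z w" for x y z w
    unfolding C_def p_def[symmetric] q2
    by (simp add: Cop_def g_simps Rop Sop_spec kulkarni_nomizu_def algebra_simps)
  have S_Cop: "S (Cop x y z) w = S (Rop x y z) w
      - p * (g y z * S2 x w + S y z * S x w - g x z * S2 y w - S x z * S y w)
      + q * (g y z * S x w - g x z * S y w)" for z w
    by (simp add: Cop_def linear_add[OF S_lin(1)] linear_diff[OF S_lin(1)] linear_scale[OF S_lin(1)] form_power_2)
  have "curv_dot g C S x1 x2 x y = curv_dot g R S x1 x2 x y
      - p * tachibana g S2 x1 x2 x y + q * tachibana g S x1 x2 x y"
    unfolding curv_dot_eq[OF S_bil S_sym Rop] curv_dot_eq[OF S_bil S_sym Cop] S_Cop tach
    by (simp add: algebra_simps)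
  then show ?thesis
    unfolding R_dot_S_via_H Q_g_S2 \<beta>4_eq \<beta>2_eq p_def q_def by (simp add: algebra_simps add_divide_distrib)
qed

lemma C_dot_S:
  assumes "\<tau> \<noteq> 0"
  shows "curv_dot g C S x1 x2 x y =
    - inverse \<tau> * \<beta>1 * tachibana S S2 x1 x2 x y + inverse \<tau> * \<beta>4 * tachibana g S2 x1 x2 x y
    + (\<beta>2 - inverse \<tau> * (\<beta>1 * \<rho>0 + \<beta>4 * \<rho>1)) * tachibana g S x1 x2 x y"
  unfolding C_dot_S_via_H Q_g_H[OF assms] Q_S_H[OF assms] by (simp add: algebra_simps)

end

section \<open>Charts and the Gauss equation of a hypersurface\<close>

lemma fd_compose:
  assumes S: "open S" "u \<in> S" "\<And>t. t \<in> S \<Longrightarrow> h t = g (f t)"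
    and f: "f differentiable at u" and g: "g differentiable at (f u)"
  shows "fd h u v = fd g (f u) (fd f u v)"
proof -
  have "((\<lambda>t. g (f t)) has_derivative (\<lambda>v. fd g (f u) (fd f u v))) (at u)"
    by (rule has_derivative_compose[OF fd_works[OF f] fd_works[OF g]])
  then have "(h has_derivative (\<lambda>v. fd g (f u) (fd f u v))) (at u)"
    by (rule has_derivative_transform_within_open[OF _ S(1,2)]) (simp add: S(3))
  then show ?thesis by (simp add: fd_unique)
qed

lemma local_metric_subset: "local_metric D G \<Longrightarrow> open D' \<Longrightarrow> D' \<subseteq> D \<Longrightarrow> local_metric D' G"
  unfolding local_metric_def by (meson smooth_on_subset subsetD)

text \<open>
  The image of \<open>L\<close> has codimension one, and \<open>\<xi>\<close> is not in it, being orthogonal to the image but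
  not to itself.
\<close>
lemma hyperplane_decomposition:
  fixes L :: "real ^ 'n::finite \<Rightarrow> real ^ 'm::finite"
  assumes L: "linear L" "inj L" and card: "CARD('m) = CARD('n) + 1"
    and B: "bilinear B" and \<xi>: "B \<xi> \<xi> \<noteq> (0::real)" "\<And>v. B \<xi> (L v) = 0"
  obtains a b where "E = L a + b *\<^sub>R \<xi>"
proof -
  have sub: "subspace (range L)" using L(1) linear_subspace_image subspace_UNIV by blast
  have "\<xi> \<notin> range L" using \<xi> by auto
  then have "dim (insert \<xi> (range L)) = CARD('n) + 1"
    using dim_image_eq[of L UNIV] L sub by (simp add: dim_insert span_eq_iff[THEN iffD2])
  then have "span (insert \<xi> (range L)) = UNIV"
    using card dim_eq_full[of "insert \<xi> (range L)"] by simp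
  then obtain b where "E - b *\<^sub>R \<xi> \<in> range L"
    using sub by (metis UNIV_I span_breakdown_eq span_eq_iff)
  then obtain a where "E - b *\<^sub>R \<xi> = L a" by blast
  then have "E = L a + b *\<^sub>R \<xi>" by (simp add: algebra_simps)
  then show ?thesis by (rule that)
qed

locale smooth_charts =
  fixes A :: "('p::t2_space, 'n::finite) chart set"
  assumes A: "smooth_atlas A"
begin

lemma chart:
  assumes "c \<in> A"
  shows chart_open: "open (fst c)" and chart_image_open: "open (snd c ` fst c)"
    and chart_cont: "continuous_on (fst c) (snd c)"
    and chart_inv_cont: "continuous_on (snd c ` fst c) (chart_inv c)"
    and chart_inv_left: "p \<in> fst c \<Longrightarrow> chart_inv c (snd c p) = p"
    and chart_inv_right: "u \<in> snd c ` fst c \<Longrightarrow> snd c (chart_inv c u) = u"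
proof -
  have "open (fst c) \<and> open (snd c ` fst c) \<and> homeomorphism (fst c) (snd c ` fst c) (snd c) (chart_inv c)"
    using A assms unfolding smooth_atlas_def by auto
  then show "open (fst c)" "open (snd c ` fst c)" "continuous_on (fst c) (snd c)"
    "continuous_on (snd c ` fst c) (chart_inv c)"
    "p \<in> fst c \<Longrightarrow> chart_inv c (snd c p) = p"
    "u \<in> snd c ` fst c \<Longrightarrow> snd c (chart_inv c u) = u"
    by (auto simp: homeomorphism_def)
qed

lemma image_open:
  assumes "c \<in> A" "open U" "U \<subseteq> fst c" shows "open (snd c ` U)"
proof -
  have "snd c ` U = (chart_inv c) -` U \<inter> (snd c ` fst c)"
    using assms chart_inv_left[OF assms(1)] by (auto simp: image_iff)
  then show ?thesis
    using continuous_on_open_vimage[OF chart_image_open[OF assms(1)]] chart_inv_cont[OF assms(1)] assms(2) by metis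
qed

lemma transition_smooth:
  "c \<in> A \<Longrightarrow> d \<in> A \<Longrightarrow> smooth_on (snd c ` (fst c \<inter> fst d)) (snd d \<circ> chart_inv c)"
  using A unfolding smooth_atlas_def by blast

lemma transition_differentiable:
  "c \<in> A \<Longrightarrow> d \<in> A \<Longrightarrow> p \<in> fst c \<Longrightarrow> p \<in> fst d \<Longrightarrow> (snd d \<circ> chart_inv c) differentiable at (snd c p)"
  by (rule smooth_on_differentiable[OF transition_smooth]) auto

lemma coord_change_linear:
  "c \<in> A \<Longrightarrow> d \<in> A \<Longrightarrow> p \<in> fst c \<Longrightarrow> p \<in> fst d \<Longrightarrow> linear (coord_change c d p)"
  unfolding coord_change_def by (rule fd_linear[OF transition_differentiable])

lemma coord_change_trans:
  assumes "c \<in> A" "d \<in> A" "e \<in> A" "p \<in> fst c" "p \<in> fst d" "p \<in> fst e"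
  shows "coord_change d e p (coord_change c d p v) = coord_change c e p v"
proof -
  have inv: "chart_inv c (snd c p) = p" using assms by (simp add: chart_inv_left)
  have "fd (snd e \<circ> chart_inv c) (snd c p) v =
      fd (snd e \<circ> chart_inv d) ((snd d \<circ> chart_inv c) (snd c p)) (fd (snd d \<circ> chart_inv c) (snd c p) v)"
  proof (rule fd_compose)
    show "open (snd c ` (fst c \<inter> fst d))"
      using assms by (intro image_open) (auto intro: chart_open)
    show "(snd e \<circ> chart_inv c) t = (snd e \<circ> chart_inv d) ((snd d \<circ> chart_inv c) t)"
      if "t \<in> snd c ` (fst c \<inter> fst d)" for t
      using that assms by (auto simp: chart_inv_left)
    show "(snd d \<circ> chart_inv c) differentiable at (snd c p)"
      by (rule transition_differentiable) (use assms in auto)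
    have "(snd d \<circ> chart_inv c) (snd c p) = snd d p" by (simp add: inv)
    moreover have "(snd e \<circ> chart_inv d) differentiable at (snd d p)"
      by (rule transition_differentiable) (use assms in auto)
    ultimately show "(snd e \<circ> chart_inv d) differentiable at ((snd d \<circ> chart_inv c) (snd c p))" by metis
  qed (use assms in auto)
  then show ?thesis by (simp add: coord_change_def inv)
qed

lemma coord_change_self:
  assumes "c \<in> A" "p \<in> fst c" shows "coord_change c c p v = v"
proof -
  have "fd (snd c \<circ> chart_inv c) (snd c p) = fd (\<lambda>t. t) (snd c p)"
    by (rule fd_cong[OF chart_image_open[OF assms(1)]]) (use assms chart_inv_right in auto)
  then show ?thesis by (simp add: coord_change_def frechet_derivative_ident)
qed

end

locale manifold =
  fixes M :: "('p::t2_space, 'n::finite) semi_riem"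
  assumes semi: "semi_riemannian M"
begin

sublocale smooth_charts "atlas M"
  using semi by (unfold_locales) (simp add: semi_riemannian_def)

lemma chart_at: "chart_at M p \<in> atlas M" "p \<in> fst (chart_at M p)"
proof -
  have "\<exists>c. c \<in> atlas M \<and> p \<in> fst c" using A unfolding smooth_atlas_def by blast
  from someI_ex[OF this] show "chart_at M p \<in> atlas M" "p \<in> fst (chart_at M p)"
    unfolding chart_at_def by auto
qed

lemma metric_scalar_product: "scalar_product (metric M p)"
  using semi unfolding semi_riemannian_def scalar_product_def by blast

text \<open>
  Passage between the components in a chart \<open>c\<close> and the tangent space at \<open>p\<close>, which by convention
  consists of the components in \<open>chart_at M p\<close>.
\<close>
abbreviation to_base :: "('p, 'n) chart \<Rightarrow> 'p \<Rightarrow> real ^ 'n \<Rightarrow> real ^ 'n" where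
  "to_base c p \<equiv> coord_change c (chart_at M p) p"
abbreviation of_base :: "('p, 'n) chart \<Rightarrow> 'p \<Rightarrow> real ^ 'n \<Rightarrow> real ^ 'n" where
  "of_base c p \<equiv> coord_change (chart_at M p) c p"

lemma to_of_base: "c \<in> atlas M \<Longrightarrow> p \<in> fst c \<Longrightarrow> to_base c p (of_base c p v) = v"
  and of_to_base: "c \<in> atlas M \<Longrightarrow> p \<in> fst c \<Longrightarrow> of_base c p (to_base c p v) = v"
  by (simp_all add: coord_change_trans coord_change_self chart_at)

lemma to_base_linear: "c \<in> atlas M \<Longrightarrow> p \<in> fst c \<Longrightarrow> linear (to_base c p)"
  and of_base_linear: "c \<in> atlas M \<Longrightarrow> p \<in> fst c \<Longrightarrow> linear (of_base c p)"
  by (simp_all add: coord_change_linear chart_at)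

lemma metric_in_eq:
  "c \<in> atlas M \<Longrightarrow> p \<in> fst c \<Longrightarrow>
    metric_in M c (snd c p) v w = metric M p (to_base c p v) (to_base c p w)"
  by (simp add: metric_in_def Let_def chart_inv_left)

lemma metric_in_base: "metric_in M (chart_at M p) (snd (chart_at M p) p) v w = metric M p v w"
  by (simp add: metric_in_eq coord_change_self chart_at)

lemma local_metric_chart:
  assumes c: "c \<in> atlas M" shows "local_metric (snd c ` fst c) (metric_in M c)"
proof
  show "open (snd c ` fst c)" by (rule chart_image_open[OF c])
  show "smooth_on (snd c ` fst c) (\<lambda>u. metric_in M c u v w)" for v w
    using semi c unfolding semi_riemannian_def by blast
  fix u assume "u \<in> snd c ` fst c"
  then obtain p where p: "p \<in> fst c" "u = snd c p" by blast
  interpret scalar_product "metric M p" by (rule metric_scalar_product)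
  note eq = metric_in_eq[OF c p(1), folded p(2)]
  show "bilinear (metric_in M c u)"
    unfolding bilinear_def eq
    using linear_compose[OF to_base_linear[OF c p(1)] g_lin(1)] linear_compose[OF to_base_linear[OF c p(1)] g_lin(2)]
    by (auto simp: o_def)
  show "metric_in M c u v w = metric_in M c u w v" for v w
    unfolding eq by (rule g_sym)
  show "v = 0" if "\<And>w. metric_in M c u v w = 0" for v
  proof -
    have "metric M p (to_base c p v) w = 0" for w
      using that[of "of_base c p w"] unfolding eq by (simp add: to_of_base[OF c p(1)])
    then have "to_base c p v = 0" by (rule g_nondeg)
    then show "v = 0" using of_to_base[OF c p(1), of v] of_base_linear[OF c p(1)] by (simp add: linear_0)
  qed
qed

lemma transition_isometry:
  assumes c: "c \<in> atlas M" and d: "d \<in> atlas M"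
  shows "local_isometry (snd c ` (fst c \<inter> fst d)) (metric_in M c) (snd d ` fst d) (metric_in M d) (snd d \<circ> chart_inv c)"
proof -
  let ?D = "snd c ` (fst c \<inter> fst d)"
  have "open ?D" using c d by (intro image_open) (auto intro: chart_open)
  then have 1: "local_metric ?D (metric_in M c)"
    by (rule local_metric_subset[OF local_metric_chart[OF c]]) auto
  show ?thesis
  proof (intro local_isometry.intro local_isometry_axioms.intro 1 local_metric_chart[OF d] transition_smooth[OF c d])
    fix u v w assume "u \<in> ?D"
    then obtain p where p: "p \<in> fst c" "p \<in> fst d" "u = snd c p" by blast
    have F: "(snd d \<circ> chart_inv c) u = snd d p" using c p by (simp add: chart_inv_left)
    then show "(snd d \<circ> chart_inv c) u \<in> snd d ` fst d" using p by simp
    have "fd (snd d \<circ> chart_inv c) u = coord_change c d p" by (simp add: coord_change_def p)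
    then show "metric_in M c u v w = metric_in M d ((snd d \<circ> chart_inv c) u)
         (fd (snd d \<circ> chart_inv c) u v) (fd (snd d \<circ> chart_inv c) u w)"
      unfolding F using c d p by (simp add: metric_in_eq coord_change_trans chart_at)
  qed
qed

end

locale oriented_hypersurface =
  fixes M :: "('p::t2_space, 'n::finite) semi_riem" and N :: "('q::t2_space, 'm::finite) semi_riem"
    and f :: "'p \<Rightarrow> 'q" and W :: "'p set" and \<epsilon> :: real and \<xi> :: "'p \<Rightarrow> real ^ 'm"
  assumes hyp: "hypersurface M N f" and normal: "unit_normal_field M N f W \<epsilon> \<xi>"
begin

sublocale M: manifold M using hyp by (auto intro: manifold.intro simp: hypersurface_def)
sublocale N: manifold N using hyp by (auto intro: manifold.intro simp: hypersurface_def)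

lemma f_immersion: "isometric_immersion M N f" using hyp by (simp add: hypersurface_def)

lemma f_cont: "continuous_on UNIV f"
  using f_immersion by (simp add: isometric_immersion_def smooth_map_def)

abbreviation F :: "('p, 'n) chart \<Rightarrow> ('q, 'm) chart \<Rightarrow> real ^ 'n \<Rightarrow> real ^ 'm" where
  "F c d \<equiv> snd d \<circ> f \<circ> chart_inv c"
abbreviation dom :: "('p, 'n) chart \<Rightarrow> ('q, 'm) chart \<Rightarrow> (real ^ 'n) set" where
  "dom c d \<equiv> snd c ` (fst c \<inter> f -` fst d)"
abbreviation \<eta> :: "('p, 'n) chart \<Rightarrow> ('q, 'm) chart \<Rightarrow> real ^ 'n \<Rightarrow> real ^ 'm" where
  "\<eta> c d \<equiv> field_along_in N f \<xi> c d"
abbreviation df :: "'p \<Rightarrow> real ^ 'n \<Rightarrow> real ^ 'm" where "df p \<equiv> differential M N f p"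

lemma F_smooth: "c \<in> atlas M \<Longrightarrow> d \<in> atlas N \<Longrightarrow> smooth_on (dom c d) (F c d)"
  using f_immersion unfolding isometric_immersion_def smooth_map_def by blast

lemma F_differentiable:
  "c \<in> atlas M \<Longrightarrow> d \<in> atlas N \<Longrightarrow> p \<in> fst c \<Longrightarrow> f p \<in> fst d \<Longrightarrow> F c d differentiable at (snd c p)"
  by (rule smooth_on_differentiable[OF F_smooth]) auto

lemma F_eq: "c \<in> atlas M \<Longrightarrow> p \<in> fst c \<Longrightarrow> F c d (snd c p) = snd d (f p)"
  by (simp add: M.chart_inv_left)

lemma F_transition_left:
  assumes "c \<in> atlas M" "c' \<in> atlas M" "d \<in> atlas N" "p \<in> fst c" "p \<in> fst c'" "f p \<in> fst d"
  shows "fd (F c' d) (snd c' p) (coord_change c c' p v) = fd (F c d) (snd c p) v"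
proof -
  have k: "(snd c' \<circ> chart_inv c) (snd c p) = snd c' p" using assms by (simp add: M.chart_inv_left)
  have "fd (F c d) (snd c p) v = fd (F c' d) ((snd c' \<circ> chart_inv c) (snd c p)) (fd (snd c' \<circ> chart_inv c) (snd c p) v)"
  proof (rule fd_compose)
    show "open (snd c ` (fst c \<inter> fst c'))"
      using assms by (intro M.image_open) (auto intro: M.chart_open)
    show "F c d t = F c' d ((snd c' \<circ> chart_inv c) t)" if "t \<in> snd c ` (fst c \<inter> fst c')" for t
      using that assms by (auto simp: M.chart_inv_left)
    show "(snd c' \<circ> chart_inv c) differentiable at (snd c p)"
      by (rule M.transition_differentiable) (use assms in auto)
    show "F c' d differentiable at ((snd c' \<circ> chart_inv c) (snd c p))"
      unfolding k by (rule F_differentiable) (use assms in auto)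
  qed (use assms in auto)
  then show ?thesis unfolding k coord_change_def by (rule sym)
qed

lemma F_transition_right:
  assumes "c \<in> atlas M" "d \<in> atlas N" "d' \<in> atlas N" "p \<in> fst c" "f p \<in> fst d" "f p \<in> fst d'"
  shows "coord_change d d' (f p) (fd (F c d) (snd c p) v) = fd (F c d') (snd c p) v"
proof -
  have k: "F c d (snd c p) = snd d (f p)" by (rule F_eq[OF assms(1,4)])
  have "fd (F c d') (snd c p) v = fd (snd d' \<circ> chart_inv d) (F c d (snd c p)) (fd (F c d) (snd c p) v)"
  proof (rule fd_compose)
    show "open (dom c d)" using F_smooth[OF assms(1,2)] by (rule smooth_on_open)
    show "F c d' t = (snd d' \<circ> chart_inv d) (F c d t)" if "t \<in> dom c d" for t
      using that assms by (auto simp: M.chart_inv_left N.chart_inv_left)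
    show "F c d differentiable at (snd c p)"
      by (rule F_differentiable) (use assms in auto)
    show "(snd d' \<circ> chart_inv d) differentiable at (F c d (snd c p))"
      unfolding k by (rule N.transition_differentiable) (use assms in auto)
  qed (use assms in auto)
  then show ?thesis unfolding coord_change_def k by metis
qed

lemma df_eq: "df p = fd (F (chart_at M p) (chart_at N (f p))) (snd (chart_at M p) p)"
  by (simp add: differential_def)

lemma fd_F_eq:
  assumes "c \<in> atlas M" "d \<in> atlas N" "p \<in> fst c" "f p \<in> fst d"
  shows "fd (F c d) (snd c p) v = N.of_base d (f p) (df p (M.to_base c p v))"
  unfolding df_eq
  by (simp only: F_transition_left F_transition_right assms M.chart_at N.chart_at)

lemma df_linear: "linear (df p)"
  unfolding df_eq by (rule fd_linear[OF F_differentiable]) (auto simp: M.chart_at N.chart_at)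

lemma df_inj: "inj (df p)" and df_isometry: "metric M p v w = metric N (f p) (df p v) (df p w)"
  using f_immersion unfolding isometric_immersion_def by blast+

lemma metric_in_N_of_base:
  assumes "d \<in> atlas N" "q \<in> fst d"
  shows "metric_in N d (snd d q) (N.of_base d q v) (N.of_base d q w) = metric N q v w"
  using assms by (simp add: N.metric_in_eq N.to_of_base)

lemma chart_isometry:
  assumes c: "c \<in> atlas M" and d: "d \<in> atlas N"
  shows "local_isometry (dom c d) (metric_in M c) (snd d ` fst d) (metric_in N d) (F c d)"
proof -
  have "open (dom c d)" using F_smooth[OF c d] by (rule smooth_on_open)
  then have 1: "local_metric (dom c d) (metric_in M c)"
    by (rule local_metric_subset[OF M.local_metric_chart[OF c]]) auto
  show ?thesis
  proof (intro local_isometry.intro local_isometry_axioms.intro 1 N.local_metric_chart[OF d] F_smooth[OF c d])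
    fix u v w assume "u \<in> dom c d"
    then obtain p where p: "p \<in> fst c" "f p \<in> fst d" "u = snd c p" by blast
    have Fu: "F c d u = snd d (f p)" using F_eq c p by simp
    then show "F c d u \<in> snd d ` fst d" using p by simp
    show "metric_in M c u v w = metric_in N d (F c d u) (fd (F c d) u v) (fd (F c d) u w)"
      unfolding Fu unfolding p(3) fd_F_eq[OF c d p(1,2)]
      by (simp add: metric_in_N_of_base d p M.metric_in_eq c df_isometry)
  qed
qed

lemma W_open: "open W" and eps: "\<epsilon> \<in> {-1, 1}"
  and xi_unit: "p \<in> W \<Longrightarrow> metric N (f p) (\<xi> p) (\<xi> p) = \<epsilon>"
  and xi_normal: "p \<in> W \<Longrightarrow> metric N (f p) (\<xi> p) (df p v) = 0"
  using normal unfolding unit_normal_field_def by auto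

lemma eta_smooth:
  "c \<in> atlas M \<Longrightarrow> d \<in> atlas N \<Longrightarrow> smooth_on (snd c ` (fst c \<inter> W \<inter> f -` fst d)) (\<eta> c d)"
  using normal unfolding unit_normal_field_def by blast

lemma eta_differentiable:
  "c \<in> atlas M \<Longrightarrow> d \<in> atlas N \<Longrightarrow> p \<in> fst c \<Longrightarrow> p \<in> W \<Longrightarrow> f p \<in> fst d \<Longrightarrow> \<eta> c d differentiable at (snd c p)"
  by (rule smooth_on_differentiable[OF eta_smooth]) auto

lemma eta_eq: "c \<in> atlas M \<Longrightarrow> p \<in> fst c \<Longrightarrow> \<eta> c d (snd c p) = N.of_base d (f p) (\<xi> p)"
  by (simp add: field_along_in_def Let_def M.chart_inv_left)

text \<open>
  The covariant derivative of the unit normal field, in components with respect to arbitrary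
  charts.
\<close>
definition cov :: "('p, 'n) chart \<Rightarrow> ('q, 'm) chart \<Rightarrow> real ^ 'n \<Rightarrow> real ^ 'n \<Rightarrow> real ^ 'm" where
  "cov c d u v = fd (\<eta> c d) u v + christoffel (metric_in N d) (F c d u) (fd (F c d) u v) (\<eta> c d u)"

lemma cov_deriv_along_eq:
  "cov_deriv_along M N f \<xi> p x = cov (chart_at M p) (chart_at N (f p)) (snd (chart_at M p) p) x"
  unfolding cov_deriv_along_def cov_def Let_def
  by (simp add: df_eq F_eq[unfolded comp_def] comp_def eta_eq M.chart_at N.chart_at N.coord_change_self)

text \<open>
  Let \<open>h\<close> be the change of charts in \<open>N\<close>. The normal fields in the two pairs of charts are related
  by the differential of \<open>h\<close>, and its derivative adds a term with the second derivative of \<open>h\<close>.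
  The transformation law of the Christoffel symbols contains the same term.
\<close>
lemma cov_transition:
  assumes c: "c \<in> atlas M" and c': "c' \<in> atlas M" and d: "d \<in> atlas N" and d': "d' \<in> atlas N"
    and p: "p \<in> fst c" "p \<in> fst c'" "f p \<in> fst d" "f p \<in> fst d'" "p \<in> W"
  shows "cov c' d' (snd c' p) (coord_change c c' p v) = coord_change d d' (f p) (cov c d (snd c p) v)"
proof -
  let ?u = "snd c p" and ?h = "snd d' \<circ> chart_inv d" and ?k = "snd c' \<circ> chart_inv c"
  interpret h: local_isometry "snd d ` (fst d \<inter> fst d')" "metric_in N d" "snd d' ` fst d'" "metric_in N d'" ?h
    by (rule N.transition_isometry[OF d d'])
  define O' where "O' = fst c \<inter> fst c' \<inter> W \<inter> f -` fst d \<inter> f -` fst d'"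
  have "open (f -` fst d)" "open (f -` fst d')"
    using f_cont N.chart_open[OF d] N.chart_open[OF d'] by (simp_all add: continuous_on_open_vimage)
  then have O': "open (snd c ` O')"
    using c c' W_open by (intro M.image_open) (auto simp: O'_def intro!: open_Int M.chart_open)
  have pO: "?u \<in> snd c ` O'" using p by (auto simp: O'_def)
  have Fu: "F c d ?u = snd d (f p)" by (rule F_eq[OF c p(1)])
  have Fu': "F c' d' (snd c' p) = snd d' (f p)" by (rule F_eq[OF c' p(2)])
  have hdf: "snd d (f p) \<in> snd d ` (fst d \<inter> fst d')" using p by auto
  have hu: "?h (snd d (f p)) = snd d' (f p)" using p d by (simp add: N.chart_inv_left)
  have dh: "fd ?h (snd d (f p)) = coord_change d d' (f p)" by (simp add: coord_change_def)
  have ku: "?k ?u = snd c' p" using p c by (simp add: M.chart_inv_left)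
  have eta': "\<eta> c' d' (?k t) = fd ?h (F c d t) (\<eta> c d t)" if t: "t \<in> snd c ` O'" for t
  proof -
    obtain q where q: "q \<in> O'" "t = snd c q" using t by blast
    then have q': "q \<in> fst c" "q \<in> fst c'" "f q \<in> fst d" "f q \<in> fst d'" by (auto simp: O'_def)
    have "\<eta> c' d' (?k t) = N.of_base d' (f q) (\<xi> q)"
      using q' q(2) c c' by (simp add: M.chart_inv_left eta_eq)
    moreover have "fd ?h (F c d t) = coord_change d d' (f q)"
      using F_eq[OF c q'(1)] q(2) by (simp add: coord_change_def)
    ultimately show ?thesis
      using q' q(2) c d d' by (simp add: eta_eq N.coord_change_trans N.chart_at)
  qed
  have 1: "fd (\<lambda>t. fd ?h (F c d t) (\<eta> c d t)) ?u v =
      h.hess (snd d (f p)) (fd (F c d) ?u v) (\<eta> c d ?u) + coord_change d d' (f p) (fd (\<eta> c d) ?u v)"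
  proof -
    have hess': "((\<lambda>t. fd ?h t a) has_derivative (\<lambda>b. h.hess (F c d ?u) b a)) (at (F c d ?u))" for a
      unfolding Fu using h.dF_deriv[OF hdf] .
    have "((\<lambda>t. fd ?h (F c d t) (\<eta> c d t)) has_derivative
      (\<lambda>v. h.hess (F c d ?u) (fd (F c d) ?u v) (\<eta> c d ?u) + fd ?h (F c d ?u) (fd (\<eta> c d) ?u v))) (at ?u)"
    proof (rule has_derivative_linear_family[OF O' pO, where L = "\<lambda>t. fd ?h (F c d t)" and V = "\<eta> c d"
          and L' = "\<lambda>a v. h.hess (F c d ?u) (fd (F c d) ?u v) a" and V' = "fd (\<eta> c d) ?u"])
      show "linear (fd ?h (F c d t))" if t: "t \<in> snd c ` O'" for t
      proof (rule h.dF_linear)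
        obtain q where "q \<in> O'" "t = snd c q" using t by blast
        then show "F c d t \<in> snd d ` (fst d \<inter> fst d')" using F_eq[OF c, of q d] by (auto simp: O'_def)
      qed
      show "((\<lambda>t. fd ?h (F c d t) a) has_derivative (\<lambda>v. h.hess (F c d ?u) (fd (F c d) ?u v) a)) (at ?u)" for a
        by (rule has_derivative_compose[OF fd_works[OF F_differentiable[OF c d p(1,3)]] hess'])
      show "(\<eta> c d has_derivative fd (\<eta> c d) ?u) (at ?u)"
        by (rule fd_works[OF eta_differentiable[OF c d p(1,5,3)]])
    qed
    then show ?thesis by (simp add: fd_unique Fu dh del: comp_apply)
  qed
  have "fd (\<lambda>t. fd ?h (F c d t) (\<eta> c d t)) ?u v = fd (\<eta> c' d') (?k ?u) (fd ?k ?u v)"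
  proof (rule fd_compose[OF O' pO])
    show "?k differentiable at ?u" by (rule M.transition_differentiable[OF c c' p(1,2)])
    show "\<eta> c' d' differentiable at (?k ?u)" unfolding ku by (rule eta_differentiable[OF c' d' p(2,5,4)])
  qed (simp only: eta')
  then have 2: "fd (\<eta> c' d') (snd c' p) (coord_change c c' p v) =
      h.hess (snd d (f p)) (fd (F c d) ?u v) (\<eta> c d ?u) + coord_change d d' (f p) (fd (\<eta> c d) ?u v)"
    unfolding 1 ku by (simp add: coord_change_def)
  have "fd (F c' d') (snd c' p) (coord_change c c' p v) = coord_change d d' (f p) (fd (F c d) ?u v)"
    using assms by (simp only: F_transition_left F_transition_right)
  moreover have "\<eta> c' d' (snd c' p) = coord_change d d' (f p) (\<eta> c d ?u)"
    using assms by (simp add: eta_eq N.coord_change_trans N.chart_at)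
  moreover have "surj (coord_change d d' (f p))"
    by (rule surjI[of _ "coord_change d' d (f p)"])
      (use assms in \<open>simp add: N.coord_change_trans N.coord_change_self\<close>)
  moreover note h.christoffel_transform[OF hdf, unfolded dh h.accel_def hu, of "fd (F c d) ?u v" "\<eta> c d ?u"]
  moreover have "linear (coord_change d d' (f p))" using d d' p by (simp add: N.coord_change_linear)
  ultimately show ?thesis
    unfolding cov_def 2 Fu Fu' by (simp add: linear_add)
qed

abbreviation II :: "'p \<Rightarrow> 'n form2" where "II \<equiv> second_fundamental M N f \<xi>"

lemma orthogonal_chart:
  assumes "c \<in> atlas M" "d \<in> atlas N" "t \<in> snd c ` (fst c \<inter> W \<inter> f -` fst d)"
  shows "metric_in N d (F c d t) (\<eta> c d t) (fd (F c d) t y) = 0"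
    and "metric_in N d (F c d t) (\<eta> c d t) (\<eta> c d t) = \<epsilon>"
proof -
  obtain p where p: "p \<in> fst c" "p \<in> W" "f p \<in> fst d" "t = snd c p" using assms by blast
  have Ft: "F c d t = snd d (f p)" using F_eq[OF assms(1) p(1)] p(4) by simp
  show "metric_in N d (F c d t) (\<eta> c d t) (fd (F c d) t y) = 0"
    unfolding Ft unfolding p(4) using assms p
    by (simp only: fd_F_eq eta_eq metric_in_N_of_base xi_normal)
  show "metric_in N d (F c d t) (\<eta> c d t) (\<eta> c d t) = \<epsilon>"
    unfolding Ft unfolding p(4) using assms p
    by (simp only: eta_eq metric_in_N_of_base xi_unit)
qed

lemma dom_W_open: "c \<in> atlas M \<Longrightarrow> d \<in> atlas N \<Longrightarrow> open (snd c ` (fst c \<inter> W \<inter> f -` fst d))"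
  by (rule smooth_on_open[OF eta_smooth])

lemma tangent_normal_decomposition:
  assumes "p \<in> W" obtains a b where "E = df p a + b *\<^sub>R \<xi> p"
proof -
  interpret scalar_product "metric N (f p)" by (rule N.metric_scalar_product)
  show ?thesis
  proof (rule hyperplane_decomposition[OF df_linear df_inj _ g_bil])
    show "CARD('m) = CARD('n) + 1" using hyp by (simp add: hypersurface_def)
    show "metric N (f p) (\<xi> p) (\<xi> p) \<noteq> 0" using xi_unit[OF assms] eps by auto
  qed (use xi_normal assms that in auto)
qed

text \<open>
  A unit field is orthogonal to its covariant derivative. Hence the derivative of \<open>\<xi>\<close> is
  tangential, and the shape operator exists.
\<close>
lemma shape_operator_spec:
  assumes p: "p \<in> W"
  shows "df p (shape_operator M N f \<xi> p x) = - cov_deriv_along M N f \<xi> p x"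
proof -
  let ?c = "chart_at M p" and ?d = "chart_at N (f p)"
  let ?u = "snd ?c p"
  note ch = M.chart_at[of p] N.chart_at[of "f p"]
  interpret sp: scalar_product "metric N (f p)" by (rule N.metric_scalar_product)
  interpret iso: local_isometry "dom ?c ?d" "metric_in M ?c" "snd ?d ` fst ?d" "metric_in N ?d" "F ?c ?d"
    by (rule chart_isometry[OF ch(1,3)])
  have u: "?u \<in> dom ?c ?d" "?u \<in> snd ?c ` (fst ?c \<inter> W \<inter> f -` fst ?d)" using ch p by auto
  have Fu: "F ?c ?d ?u = snd ?d (f p)" by (rule F_eq[OF ch(1,2)])
  have eta: "\<eta> ?c ?d ?u = \<xi> p" by (simp add: eta_eq ch N.coord_change_self)
  have "metric N (f p) (cov ?c ?d ?u x) (\<xi> p) = 0"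
    using iso.Weingarten_normal[OF u(1) dom_W_open[OF ch(1,3)] u(2) eta_differentiable[OF ch(1,3,2) p ch(4)] orthogonal_chart(2)[OF ch(1,3)], of x]
    unfolding cov_def Fu by (simp add: eta N.metric_in_base)
  moreover obtain a b where ab: "cov ?c ?d ?u x = df p a + b *\<^sub>R \<xi> p"
    by (rule tangent_normal_decomposition[OF p])
  ultimately have "b = 0"
    using xi_normal[OF p, of a] xi_unit[OF p] sp.g_sym[of "df p a" "\<xi> p"] eps by (auto simp: sp.g_simps)
  then have "df p (- a) = - cov_deriv_along M N f \<xi> p x"
    unfolding cov_deriv_along_eq ab by (simp add: linear_neg[OF df_linear])
  then have "\<exists>!a. df p a = - cov_deriv_along M N f \<xi> p x"
    using df_inj by (metis injD)
  from theI'[OF this] show ?thesis unfolding shape_operator_def .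
qed

lemma II_eq_cov: "p \<in> W \<Longrightarrow> II p x y = - metric N (f p) (cov_deriv_along M N f \<xi> p x) (df p y)"
proof -
  assume p: "p \<in> W"
  interpret sp: scalar_product "metric N (f p)" by (rule N.metric_scalar_product)
  show ?thesis
    unfolding second_fundamental_def df_isometry shape_operator_spec[OF p]
    by (simp add: linear_neg[OF sp.g_lin(1)])
qed

text \<open>
  Here \<open>c\<close> and \<open>d\<close> need not be the charts chosen at \<open>p\<close> and \<open>f p\<close>, so they can be kept fixed
  while \<open>p\<close> varies.
\<close>
lemma II_in_charts:
  assumes c: "c \<in> atlas M" and d: "d \<in> atlas N" and p: "p \<in> fst c" "f p \<in> fst d" "p \<in> W"
  shows "II p (M.to_base c p v) (M.to_base c p w) =
     - metric_in N d (F c d (snd c p)) (cov c d (snd c p) v) (fd (F c d) (snd c p) w)"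
proof -
  have "cov_deriv_along M N f \<xi> p (M.to_base c p v) = N.to_base d (f p) (cov c d (snd c p) v)"
    unfolding cov_deriv_along_eq by (rule cov_transition) (use assms M.chart_at N.chart_at in auto)
  then have "II p (M.to_base c p v) (M.to_base c p w) =
     - metric N (f p) (N.to_base d (f p) (cov c d (snd c p) v)) (df p (M.to_base c p w))"
    by (simp add: II_eq_cov[OF p(3)])
  moreover have "df p (M.to_base c p w) = N.to_base d (f p) (fd (F c d) (snd c p) w)"
    using assms by (simp only: fd_F_eq N.to_of_base)
  moreover have "F c d (snd c p) = snd d (f p)" by (rule F_eq[OF c p(1)])
  ultimately show ?thesis using assms by (simp only: N.metric_in_eq)
qed

lemma II_eq_accel:
  assumes p: "p \<in> W"
  defines "c \<equiv> chart_at M p" and "d \<equiv> chart_at N (f p)"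
  shows "II p x y = metric N (f p) (\<xi> p) (local_isometry.accel (metric_in N d) (F c d) (snd c p) x y)"
proof -
  let ?u = "snd c p"
  have ch: "c \<in> atlas M" "p \<in> fst c" "d \<in> atlas N" "f p \<in> fst d"
    using M.chart_at[of p] N.chart_at[of "f p"] by (auto simp: c_def d_def)
  interpret sp: scalar_product "metric N (f p)" by (rule N.metric_scalar_product)
  interpret iso: local_isometry "dom c d" "metric_in M c" "snd d ` fst d" "metric_in N d" "F c d"
    by (rule chart_isometry[OF ch(1,3)])
  have u: "?u \<in> dom c d" "?u \<in> snd c ` (fst c \<inter> W \<inter> f -` fst d)" using ch p by auto
  have Fu: "F c d ?u = snd d (f p)" by (rule F_eq[OF ch(1,2)])
  have eta: "\<eta> c d ?u = \<xi> p" unfolding eta_eq[OF ch(1,2)] using ch by (simp add: d_def N.coord_change_self)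
  have df: "df p = fd (F c d) ?u" unfolding c_def d_def by (rule df_eq)
  have met: "metric_in N d (snd d (f p)) v w = metric N (f p) v w" for v w
    unfolding d_def by (rule N.metric_in_base)
  show ?thesis
    using iso.Weingarten_tangential[OF u(1) dom_W_open[OF ch(1,3)] u(2) eta_differentiable[OF ch(1,3,2) p ch(4)] orthogonal_chart(1)[OF ch(1,3)], of x y]
    unfolding II_eq_cov[OF p] cov_deriv_along_eq c_def[symmetric] d_def[symmetric] cov_def Fu eta met df by simp
qed

lemma II_bilinear: "p \<in> W \<Longrightarrow> bilinear (II p)" and II_sym: "p \<in> W \<Longrightarrow> II p x y = II p y x"
proof -
  assume p: "p \<in> W"
  let ?c = "chart_at M p" and ?d = "chart_at N (f p)"
  note ch = M.chart_at[of p] N.chart_at[of "f p"]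
  interpret sp: scalar_product "metric N (f p)" by (rule N.metric_scalar_product)
  interpret iso: local_isometry "dom ?c ?d" "metric_in M ?c" "snd ?d ` fst ?d" "metric_in N ?d" "F ?c ?d"
    by (rule chart_isometry[OF ch(1,3)])
  have u: "snd ?c p \<in> dom ?c ?d" using ch by auto
  show sym: "II p x y = II p y x" for x y
    unfolding II_eq_accel[OF p] by (simp only: iso.accel_sym[OF u, of x y])
  have l: "linear (II p x)" for x
    unfolding second_fundamental_def
    by (rule scalar_product.g_lin(2)[OF M.metric_scalar_product])
  have "(\<lambda>x. II p x y) = II p y" for y by (rule ext) (rule sym)
  then show "bilinear (II p)" unfolding bilinear_def using l by metis
qed

text \<open>
  In \<open>curvature_pullback\<close>, the decomposition of \<open>accel\<close> into its tangential part \<open>df p (?\<Gamma> x y)\<close>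
  and its normal part cancels the products of Christoffel symbols of \<open>M\<close> and leaves those of the
  second fundamental tensor.
\<close>
lemma Gauss_equation:
  assumes p: "p \<in> W" and curv: "constant_curvature N k"
  shows "riemann M p x y z w = \<epsilon> / 2 * kulkarni_nomizu (II p) (II p) x y z w
     + k / 2 * kulkarni_nomizu (metric M p) (metric M p) x y z w"
proof -
  define c d where "c = chart_at M p" and "d = chart_at N (f p)"
  let ?u = "snd c p"
  have ch: "c \<in> atlas M" "p \<in> fst c" "d \<in> atlas N" "f p \<in> fst d"
    using M.chart_at[of p] N.chart_at[of "f p"] by (auto simp: c_def d_def)
  interpret sp: scalar_product "metric N (f p)" by (rule N.metric_scalar_product)
  interpret spM: scalar_product "metric M p" by (rule M.metric_scalar_product)
  interpret iso: local_isometry "dom c d" "metric_in M c" "snd d ` fst d" "metric_in N d" "F c d"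
    by (rule chart_isometry[OF ch(1,3)])
  have u: "?u \<in> dom c d" using ch by auto
  have Fu: "F c d ?u = snd d (f p)" by (rule F_eq[OF ch(1,2)])
  have df: "fd (F c d) ?u = df p" unfolding c_def d_def by (rule df_eq[symmetric])
  have metN: "metric_in N d (snd d (f p)) = metric N (f p)"
    unfolding d_def by (intro ext) (rule N.metric_in_base)
  have metM: "metric_in M c ?u = metric M p"
    unfolding c_def by (intro ext) (rule M.metric_in_base)
  let ?acc = "iso.accel ?u" and ?\<Gamma> = "christoffel (metric_in M c) ?u"
  have acc: "?acc x y = df p (?\<Gamma> x y) + (\<epsilon> * II p x y) *\<^sub>R \<xi> p" for x y
  proof -
    obtain a b where ab: "?acc x y = df p a + b *\<^sub>R \<xi> p"
      by (rule tangent_normal_decomposition[OF p])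
    have "metric M p a v = metric M p (?\<Gamma> x y) v" for v
      using iso.accel_tangential[OF u, of x y v] xi_normal[OF p]
      unfolding Fu metN df ab by (simp add: sp.g_simps df_isometry)
    then have "a = ?\<Gamma> x y" by (rule spM.g_eqI)
    moreover have "b = \<epsilon> * II p x y"
    proof -
      have "II p x y = b * \<epsilon>"
        unfolding II_eq_accel[OF p] c_def[symmetric] d_def[symmetric] ab
        using xi_normal[OF p] xi_unit[OF p] by (simp add: sp.g_simps)
      then show ?thesis using eps by auto
    qed
    ultimately show ?thesis using ab by simp
  qed
  have acc2: "metric N (f p) (?acc x w) (?acc y z) =
      metric M p (?\<Gamma> x w) (?\<Gamma> y z) + \<epsilon> * (II p x w * II p y z)" for x y z w
  proof -
    have "metric N (f p) (df p v) (\<xi> p) = 0" for v using xi_normal[OF p] sp.g_sym by metis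
    then show ?thesis
      using eps xi_normal[OF p] xi_unit[OF p] unfolding acc df_isometry by (auto simp: sp.g_simps)
  qed
  have R: "riemann M p x y z w = metric_in M c ?u (curvature_field (metric_in M c) (\<lambda>_. x) (\<lambda>_. y) (\<lambda>_. z) ?u) w"
    unfolding metM by (simp add: riemann_def curvature_op_def c_def)
  have "riemann N (f p) (df p x) (df p y) (df p z) (df p w) =
      metric_in N d (F c d ?u) (curvature_field (metric_in N d) (\<lambda>_. df p x) (\<lambda>_. df p y) (\<lambda>_. df p z) (F c d ?u)) (df p w)"
    unfolding Fu metN by (simp add: riemann_def curvature_op_def d_def)
  with iso.curvature_pullback[OF u, of x y z w] R
  have "riemann M p x y z w = riemann N (f p) (df p x) (df p y) (df p z) (df p w)
     + \<epsilon> * (II p x w * II p y z - II p y w * II p x z)"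
    unfolding df Fu metN metM acc2 by (simp add: algebra_simps)
  moreover have "riemann N (f p) (df p x) (df p y) (df p z) (df p w) =
     k / 2 * kulkarni_nomizu (metric M p) (metric M p) x y z w"
    using curv unfolding constant_curvature_def kulkarni_nomizu_def df_isometry by simp
  ultimately show ?thesis unfolding kulkarni_nomizu_def by (simp add: field_simps)
qed

text \<open>
  A space of constant curvature satisfies the Gauss equation with vanishing second fundamental
  tensor, so its Ricci tensor is obtained from the same trace.
\<close>
lemma scalar_curvature_ambient:
  assumes curv: "constant_curvature N k"
  shows "scalar_curvature N q = real CARD('n) * (real CARD('n) + 1) * k"
proof -
  interpret sp: scalar_product "metric N q" by (rule N.metric_scalar_product)
  have card: "CARD('m) = CARD('n) + 1" using hyp by (simp add: hypersurface_def)
  \<comment> \<open>The Gauss equation with coefficient 0 in place of \<open>\<epsilon>\<close>, in dimension \<open>n + 1\<close>.\<close>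
  have "ricci N q x y = 0 * (form_trace (metric N q) (\<lambda>_ _. 0) * 0 - form_power (metric N q) (\<lambda>_ _. 0) 2 x y)
      + (real CARD('m) - 1) * k * metric N q x y" for x y
    unfolding ricci_def
  proof (rule sp.Ricci_of_Gauss_equation[where H = "\<lambda>_ _. 0"])
    show "bilinear (\<lambda>_ _. 0 :: real)" by (simp add: bilinear_def linear_zero)
  qed (use curv in \<open>simp_all add: constant_curvature_def riemann_def kulkarni_nomizu_def\<close>)
  then have ric: "ricci N q x y = metric N q ((real CARD('n) * k) *\<^sub>R x) y" for x y
    by (simp add: card sp.g_simps)
  then have "ricci N q = (\<lambda>x y. metric N q ((real CARD('n) * k) *\<^sub>R x) y)" by (intro ext)
  moreover have "bilinear (\<lambda>x y. metric N q ((real CARD('n) * k) *\<^sub>R x) y)"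
    unfolding bilinear_def by (auto intro!: linearI simp: sp.g_simps algebra_simps)
  ultimately have "assoc_op (metric N q) (ricci N q) = (\<lambda>x. (real CARD('n) * k) *\<^sub>R x)"
    by (intro ext sp.assoc_op_eqI) auto
  then show ?thesis
    by (simp add: scalar_curvature_def form_trace_def trace_matrix_scale trace_matrix_id card)
qed

end

section \<open>Stability of a nonzero \<open>\<tau>\<close>\<close>

definition det3 :: "('z \<Rightarrow> real) \<Rightarrow> ('z \<Rightarrow> real) \<Rightarrow> ('z \<Rightarrow> real) \<Rightarrow> 'z \<Rightarrow> 'z \<Rightarrow> 'z \<Rightarrow> real" where
  "det3 A B C x y z = A x * (B y * C z - B z * C y) - A y * (B x * C z - B z * C x) + A z * (B x * C y - B y * C x)"

text \<open>
  The points are found one after the other: a minor of order two that does not vanish turns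
  the vanishing of all determinants \<open>det3 A B C x y z\<close> in \<open>z\<close> into a linear relation that
  expresses \<open>C\<close> by \<open>A\<close> and \<open>B\<close>.
\<close>
lemma independent_imp_det3:
  assumes A: "A x \<noteq> 0" and B: "\<And>r. \<exists>z. B z \<noteq> r * A z" and C: "\<And>r s. \<exists>z. C z \<noteq> r * B z + s * A z"
  shows "\<exists>x y z. det3 A B C x y z \<noteq> 0"
proof -
  obtain y where "B y \<noteq> B x / A x * A y" using B by blast
  then have nz: "A x * B y - A y * B x \<noteq> 0" using A by (simp add: field_simps)
  define m where "m = A x * B y - A y * B x"
  obtain z where z: "C z \<noteq> (A x * C y - A y * C x) / m * B z + (B y * C x - B x * C y) / m * A z"
    using C by blast
  have m: "m \<noteq> 0" using nz by (simp add: m_def)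
  have "det3 A B C x y z = m * C z - (A x * C y - A y * C x) * B z - (B y * C x - B x * C y) * A z"
    by (simp add: det3_def m_def algebra_simps)
  also have "\<dots> = m * (C z - ((A x * C y - A y * C x) / m * B z + (B y * C x - B x * C y) / m * A z))"
    using m by (simp add: right_diff_distrib distrib_left)
  finally have "det3 A B C x y z \<noteq> 0" using m z by simp
  then show ?thesis by blast
qed

context scalar_product
begin

text \<open>
  If \<open>H\<close> were a multiple of \<open>g\<close>, its operator would be a multiple of the identity and \<open>H\<^sup>2\<close> a
  multiple of \<open>H\<close>. Thus all three forms are independent as soon as \<open>H\<^sup>2\<close> is not a combination of
  the other two.
\<close>
lemma independent_forms:
  assumes H: "bilinear H" and ind: "\<not> (\<exists>r s. \<forall>v w. form_power g H 2 v w = r * H v w + s * g v w)"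
  shows "\<exists>x y z. det3 (\<lambda>(v, w). g v w) (\<lambda>(v, w). H v w) (\<lambda>(v, w). form_power g H 2 v w) x y z \<noteq> 0"
proof -
  have l: "linear (\<lambda>v. H v w)" for w using H by (simp add: bilinear_def)
  have "\<exists>v w. g v w \<noteq> 0"
  proof (rule ccontr)
    assume "\<not> ?thesis"
    then have "v = 0" for v :: "real ^ 'n" using g_nondeg by blast
    then have "assoc_op g H v = 0" for v by blast
    then have "form_power g H 2 v w = 0 * H v w + 0 * g v w" for v w
      by (simp add: form_power_2 linear_0[OF l])
    then show False using ind by blast
  qed
  then obtain x where x: "(\<lambda>(v, w). g v w) x \<noteq> 0" by auto
  show ?thesis
  proof (rule independent_imp_det3[where x = x], rule x)
    fix r
    show "\<exists>z. (\<lambda>(v, w). H v w) z \<noteq> r * (\<lambda>(v, w). g v w) z"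
    proof (rule ccontr)
      assume "\<not> ?thesis"
      then have eq: "H v w = r * g v w" for v w by auto
      have "assoc_op g H v = r *\<^sub>R v" for v by (rule assoc_op_eqI[OF H]) (simp add: g_simps eq)
      then have "form_power g H 2 v w = r * H v w + 0 * g v w" for v w
        by (simp add: form_power_2 linear_scale[OF l])
      then show False using ind by blast
    qed
    fix s
    show "\<exists>z. (\<lambda>(v, w). form_power g H 2 v w) z \<noteq> r * (\<lambda>(v, w). H v w) z + s * (\<lambda>(v, w). g v w) z"
      using ind by (auto simp: split_def)
  qed
qed

end

text \<open>
  The coefficients \<open>\<phi>\<close>, \<open>\<psi>\<close>, \<open>\<rho>\<close> are arbitrary functions, but on \<open>I\<close> the cubic equation
  determines them. Near \<open>u0\<close> they are quotients of determinants \<open>\<Delta> i j l\<close> formed from the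
  components of the powers \<open>i\<close>, \<open>j\<close>, \<open>l\<close> of \<open>h\<close>, and these are continuous. The open set is the
  set where the denominator \<open>\<Delta> 0 1 2\<close> and the function \<open>T\<close> are both nonzero.
\<close>
lemma cubic_nonvanishing_stable:
  fixes G h :: "'a::real_normed_vector \<Rightarrow> 'n::finite form2" and \<phi> \<psi> \<rho> :: "'a \<Rightarrow> real"
  assumes D: "open D" "u0 \<in> D"
    and G: "\<And>u. u \<in> D \<Longrightarrow> scalar_product (G u)" and h: "\<And>u. u \<in> D \<Longrightarrow> bilinear (h u)"
    and dG: "\<And>u v w. u \<in> D \<Longrightarrow> (\<lambda>t. G t v w) differentiable at u"
    and dh: "\<And>u v w. u \<in> D \<Longrightarrow> (\<lambda>t. h t v w) differentiable at u"
  defines "I \<equiv> {u \<in> D. \<not> (\<exists>r s. \<forall>v w. form_power (G u) (h u) 2 v w = r * h u v w + s * G u v w)}"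
    and "t \<equiv> \<lambda>u. form_trace (G u) (h u)"
  defines "T \<equiv> \<lambda>u. \<rho> u + (\<phi> u - t u) * (\<psi> u + t u * (\<phi> u - t u))"
  assumes cubic: "\<And>u v w. u \<in> I \<Longrightarrow>
      form_power (G u) (h u) 3 v w = \<phi> u * form_power (G u) (h u) 2 v w + \<psi> u * h u v w + \<rho> u * G u v w"
    and u0: "u0 \<in> I" "T u0 \<noteq> 0"
  shows "\<exists>V. open V \<and> u0 \<in> V \<and> V \<subseteq> I \<and> (\<forall>u\<in>V. T u \<noteq> 0)"
proof -
  define b where "b u = assoc_op (G u) (h u)" for u
  have G_bil: "bilinear (G u)" and G_nondeg: "\<And>v. (\<And>w. G u v w = 0) \<Longrightarrow> v = 0" if "u \<in> D" for u
    using scalar_product.g_bil[OF G[OF that]] scalar_product.g_nondeg[OF G[OF that]] by blast+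
  have b_spec: "G u (b u v) w = h u v w" if "u \<in> D" for u v w
    unfolding b_def by (rule scalar_product.assoc_op_spec[OF G[OF that] h[OF that]])
  have b_lin: "linear (b u)" if "u \<in> D" for u
    unfolding b_def by (rule scalar_product.assoc_op_linear[OF G[OF that] h[OF that]])
  have h_lin: "linear (\<lambda>v. h u v w)" if "u \<in> D" for u w using h[OF that] by (simp add: bilinear_def)
  have db: "(\<lambda>u. b u v) differentiable at u" if u: "u \<in> D" for u v
    by (rule differentiable_solve_form[OF D(1) u G_bil G_nondeg dG[OF u] b_spec dh[OF u]])
  have h_comp: "(\<lambda>u. h u (V u) w) differentiable at u" if u: "u \<in> D" and V: "V differentiable at u" for u V w
    using has_derivative_linear_family[OF D(1) u h_lin fd_works[OF dh[OF u]] fd_works[OF V]]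
    by (rule differentiableI)
  have b_comp: "(\<lambda>u. b u (b u v)) differentiable at u" if u: "u \<in> D" for u v
    using has_derivative_linear_family[OF D(1) u b_lin fd_works[OF db[OF u]] fd_works[OF db[OF u]]]
    by (rule differentiableI)
  have cont: "continuous_on D f" if "\<And>u. u \<in> D \<Longrightarrow> f differentiable at u" for f :: "'a \<Rightarrow> real"
    using that by (intro continuous_at_imp_continuous_on ballI differentiable_imp_continuous_within)
  define k where "k i u = (\<lambda>(v, w). form_power (G u) (h u) i v w)" for i u
  have k: "k 0 u = (\<lambda>(v, w). G u v w)" "k 1 u = (\<lambda>(v, w). h u v w)"
     "k 2 u = (\<lambda>(v, w). h u (b u v) w)" "k 3 u = (\<lambda>(v, w). h u (b u (b u v)) w)" for u
    by (simp_all add: k_def b_def numeral_2_eq_2 numeral_3_eq_3)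
  have k_cont: "continuous_on D (\<lambda>u. k 0 u z)" "continuous_on D (\<lambda>u. k 1 u z)"
     "continuous_on D (\<lambda>u. k 2 u z)" "continuous_on D (\<lambda>u. k 3 u z)" for z
    unfolding k split_def by (intro cont dG dh h_comp db b_comp; assumption)+
  have t_cont: "continuous_on D t"
    unfolding t_def form_trace_def b_def[symmetric] trace_matrix
  proof (intro cont differentiable_sum finite ballI)
    fix u i assume "u \<in> D"
    then show "(\<lambda>u. b u (axis i 1) $ i) differentiable at u"
      using differentiable_componentwise_within[of "\<lambda>u. b u (axis i 1)" u UNIV] db
        differentiable_inner[OF db differentiable_const, of u "axis i 1" "axis i 1"]
      by (simp add: inner_axis)
  qed
  have "u0 \<in> D" "\<not> (\<exists>r s. \<forall>v w. form_power (G u0) (h u0) 2 v w = r * h u0 v w + s * G u0 v w)"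
    using u0(1) by (auto simp: I_def)
  from scalar_product.independent_forms[OF G[OF this(1)] h[OF this(1)] this(2)]
  obtain x y z where xyz: "det3 (k 0 u0) (k 1 u0) (k 2 u0) x y z \<noteq> 0"
    unfolding k_def by auto
  define \<Delta> where "\<Delta> i j l u = det3 (k i u) (k j u) (k l u) x y z" for i j l u
  have \<Delta>_cont: "continuous_on D (\<Delta> 0 1 2)" "continuous_on D (\<Delta> 0 1 3)"
      "continuous_on D (\<Delta> 0 3 2)" "continuous_on D (\<Delta> 3 1 2)"
    unfolding \<Delta>_def det3_def by (intro continuous_intros k_cont)+
  define V1 where "V1 = {u \<in> D. \<Delta> 0 1 2 u \<noteq> 0}"
  have V1: "open V1"
  proof -
    have "V1 = D \<inter> \<Delta> 0 1 2 -` (- {0})" unfolding V1_def by auto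
    then show ?thesis using continuous_open_preimage[OF \<Delta>_cont(1) D(1) open_Compl[OF closed_singleton]] by metis
  qed
  have V1_I: "V1 \<subseteq> I"
  proof
    fix u assume u: "u \<in> V1"
    have zero: "\<Delta> 0 1 2 u = 0" if eq: "\<And>v w. form_power (G u) (h u) 2 v w = r * h u v w + s * G u v w" for r s
    proof -
      have k2: "k 2 u p = r * k 1 u p + s * k 0 u p" for p
        using eq by (cases p) (simp add: k_def)
      show ?thesis unfolding \<Delta>_def det3_def k2 by (simp add: algebra_simps)
    qed
    have "u \<in> D" "\<Delta> 0 1 2 u \<noteq> 0" using u unfolding V1_def by blast+
    then show "u \<in> I" unfolding I_def using zero by blast
  qed
  \<comment> \<open>The column that belongs to the coefficient is replaced by the cubic power.\<close>
  have cramer: "\<phi> u = \<Delta> 0 1 3 u / \<Delta> 0 1 2 u \<and> \<psi> u = \<Delta> 0 3 2 u / \<Delta> 0 1 2 u \<and> \<rho> u = \<Delta> 3 1 2 u / \<Delta> 0 1 2 u"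
    if u: "u \<in> V1" for u
  proof -
    have k3: "k 3 u p = \<phi> u * k 2 u p + \<psi> u * k 1 u p + \<rho> u * k 0 u p" for p
      using cubic[of u "fst p" "snd p"] u V1_I by (cases p) (auto simp: k_def)
    have "\<Delta> 0 1 3 u = \<phi> u * \<Delta> 0 1 2 u" "\<Delta> 0 3 2 u = \<psi> u * \<Delta> 0 1 2 u" "\<Delta> 3 1 2 u = \<rho> u * \<Delta> 0 1 2 u"
      unfolding \<Delta>_def det3_def k3 by (simp_all add: algebra_simps)
    moreover have "\<Delta> 0 1 2 u \<noteq> 0" using u by (simp add: V1_def)
    ultimately show ?thesis by simp
  qed
  have "continuous_on V1 (\<lambda>u. \<Delta> 3 1 2 u / \<Delta> 0 1 2 u + (\<Delta> 0 1 3 u / \<Delta> 0 1 2 u - t u)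
       * (\<Delta> 0 3 2 u / \<Delta> 0 1 2 u + t u * (\<Delta> 0 1 3 u / \<Delta> 0 1 2 u - t u)))"
    by (intro continuous_intros continuous_on_subset[OF \<Delta>_cont(1)] continuous_on_subset[OF \<Delta>_cont(2)]
        continuous_on_subset[OF \<Delta>_cont(3)] continuous_on_subset[OF \<Delta>_cont(4)] continuous_on_subset[OF t_cont])
      (auto simp: V1_def)
  then have T_cont: "continuous_on V1 T"
    by (rule continuous_on_eq) (simp add: T_def cramer)
  define V where "V = V1 \<inter> T -` (- {0})"
  have "open V" unfolding V_def by (rule continuous_open_preimage[OF T_cont V1 open_Compl[OF closed_singleton]])
  moreover have "u0 \<in> V1" using xyz D(2) by (simp add: V1_def \<Delta>_def)
  ultimately show ?thesis using V1_I u0(2) by (intro exI[of _ V]) (auto simp: V_def)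
qed

text \<open>
  Powers and traces of forms are invariant under linear isomorphisms: the associated operators
  are conjugate.
\<close>
lemma transport_forms:
  fixes L :: "real ^ 'n::finite \<Rightarrow> real ^ 'n"
  assumes g: "scalar_product g" and g': "scalar_product g'"
    and H: "bilinear H" and H': "bilinear H'"
    and L: "linear L" "linear K" "\<And>v. K (L v) = v" "\<And>v. L (K v) = v"
    and gL: "\<And>v w. g' v w = g (L v) (L w)" and HL: "\<And>v w. H' v w = H (L v) (L w)"
  shows "form_power g' H' 2 v w = form_power g H 2 (L v) (L w)"
    and "form_power g' H' 3 v w = form_power g H 3 (L v) (L w)"
    and "form_trace g' H' = form_trace g H"
proof -
  interpret g: scalar_product g by (rule g)
  interpret g': scalar_product g' by (rule g')
  have op: "assoc_op g' H' v = K (assoc_op g H (L v))" for v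
    by (rule g'.assoc_op_eqI[OF H']) (simp add: gL HL L g.assoc_op_spec[OF H])
  show p2: "form_power g' H' 2 v w = form_power g H 2 (L v) (L w)" for v w
    by (simp add: g'.form_power_2 g.form_power_2 op HL L)
  show "form_power g' H' 3 v w = form_power g H 3 (L v) (L w)"
    by (simp add: g'.form_power_3 g.form_power_3 p2 op L)
  let ?a = "assoc_op g H"
  note lin = g.assoc_op_linear[OF H]
  have "assoc_op g' H' = K \<circ> (?a \<circ> L)" by (auto simp: op)
  then have "form_trace g' H' = trace (matrix K ** (matrix (?a \<circ> L)))"
    unfolding form_trace_def using L lin by (simp add: matrix_compose linear_compose)
  also have "\<dots> = trace (matrix (?a \<circ> L) ** matrix K)" by (rule trace_mul_sym)
  also have "\<dots> = trace (matrix ((?a \<circ> L) \<circ> K))"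
    using L lin by (simp add: matrix_compose linear_compose)
  also have "(?a \<circ> L) \<circ> K = ?a" by (auto simp: L)
  finally show "form_trace g' H' = form_trace g H" by (simp add: form_trace_def)
qed

context oriented_hypersurface
begin

lemma II_chart_differentiable:
  assumes c: "c \<in> atlas M" and d: "d \<in> atlas N" and u: "u \<in> snd c ` (fst c \<inter> W \<inter> f -` fst d)"
  shows "(\<lambda>u. - metric_in N d (F c d u) (cov c d u v) (fd (F c d) u w)) differentiable at u"
proof -
  interpret iso: local_isometry "dom c d" "metric_in M c" "snd d ` fst d" "metric_in N d" "F c d"
    by (rule chart_isometry[OF c d])
  let ?D = "snd c ` (fst c \<inter> W \<inter> f -` fst d)"
  have uD: "u \<in> dom c d" using u by blast
  have Fu: "F c d u \<in> snd d ` fst d" by (rule iso.F_in[OF uD])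
  have eta: "(\<eta> c d has_derivative fd (\<eta> c d) u) (at u)"
    by (rule fd_works[OF smooth_on_differentiable[OF eta_smooth[OF c d] u]])
  have eta2: "((\<lambda>t. fd (\<eta> c d) t v) has_derivative fd (\<lambda>t. fd (\<eta> c d) t v) u) (at u)"
    by (rule fd_works[OF smooth_on_differentiable[OF smooth_on_fd[OF eta_smooth[OF c d]] u]])
  have k: "((\<lambda>s. koszul (metric_in N d) s a b e) has_derivative fd (\<lambda>s. koszul (metric_in N d) s a b e) (F c d u))
      (at (F c d u))" for a b e
    by (rule fd_works[OF iso.N.koszul_differentiable[OF Fu]])
  have 1: "(\<lambda>t. metric_in N d (F c d t) (fd (\<eta> c d) t v) (fd (F c d) t w)) differentiable at u"
    by (rule differentiableI, rule iso.pullback_deriv[OF uD iso.N.bil iso.N.G_deriv[OF Fu] eta2 iso.dF_deriv[OF uD]])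
  have 2: "(\<lambda>t. koszul (metric_in N d) (F c d t) (fd (F c d) t v) (\<eta> c d t) (fd (F c d) t w)) differentiable at u"
    by (rule differentiableI,
      rule has_derivative_trilinear_family[OF iso.M.open_D uD _ _
          has_derivative_compose[OF iso.F_deriv[OF uD] k] iso.dF_deriv[OF uD] eta iso.dF_deriv[OF uD]])
      (simp_all only: iso.F_in iso.N.koszul_lin1 iso.N.koszul_bilinear)
  have eq: "- (metric_in N d (F c d t) (fd (\<eta> c d) t v) (fd (F c d) t w) +
        koszul (metric_in N d) (F c d t) (fd (F c d) t v) (\<eta> c d t) (fd (F c d) t w)) =
      - metric_in N d (F c d t) (cov c d t v) (fd (F c d) t w)" if "t \<in> ?D" for t
  proof -
    have "F c d t \<in> snd d ` fst d" using that by (intro iso.F_in) blast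
    then show ?thesis by (simp only: cov_def iso.N.G_simps iso.N.christoffel_spec)
  qed
  show ?thesis
    by (rule differentiable_cong_open[OF dom_W_open[OF c d] u eq], assumption)
      (intro differentiable_minus differentiable_add 1 2)
qed

text \<open>
  In charts \<open>c\<close> and \<open>d\<close> that stay fixed near \<open>x\<close>, the components \<open>G\<close> of the metric and \<open>h\<close> of the
  second fundamental tensor are differentiable, and the isomorphisms \<open>to_base\<close> identify them
  with the tensors at each point. This reduces the claim to \<open>cubic_nonvanishing_stable\<close>.
\<close>
lemma tau_nonzero_stable:
  fixes \<phi> \<psi> \<rho> :: "'p \<Rightarrow> real"
  defines "UH \<equiv> U_H M N f W \<xi>"
  defines "t \<equiv> \<lambda>p. form_trace (metric M p) (II p)"
  defines "\<tau> \<equiv> \<lambda>p. \<rho> p + (\<phi> p - t p) * (\<psi> p + t p * (\<phi> p - t p))"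
  assumes cubic: "\<And>p v w. p \<in> UH \<Longrightarrow> form_power (metric M p) (II p) 3 v w =
      \<phi> p * form_power (metric M p) (II p) 2 v w + \<psi> p * II p v w + \<rho> p * metric M p v w"
    and x: "x \<in> UH" "\<tau> x \<noteq> 0"
  shows "\<exists>U. open U \<and> x \<in> U \<and> U \<subseteq> UH \<and> (\<forall>p\<in>U. \<tau> p \<noteq> 0)"
proof -
  define c where "c = chart_at M x"
  define d where "d = chart_at N (f x)"
  have c: "c \<in> atlas M" "x \<in> fst c" and d: "d \<in> atlas N" "f x \<in> fst d"
    using M.chart_at[of x] N.chart_at[of "f x"] by (auto simp: c_def d_def)
  define O' where "O' = fst c \<inter> W \<inter> f -` fst d"
  define D where "D = snd c ` O'"
  define G where "G = metric_in M c"
  define h where "h u v w = - metric_in N d (F c d u) (cov c d u v) (fd (F c d) u w)" for u v w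
  interpret lm: local_metric "snd c ` fst c" "metric_in M c" by (rule M.local_metric_chart[OF c(1)])
  have O': "open O'"
    unfolding O'_def using f_cont N.chart_open[OF d(1)] M.chart_open[OF c(1)] W_open
    by (intro open_Int) (simp_all add: continuous_on_open_vimage)
  have D: "open D" unfolding D_def O'_def by (rule dom_W_open[OF c(1) d(1)])
  have xO: "x \<in> O'" using c d x by (auto simp: O'_def UH_def U_H_def)
  have G_eq: "G (snd c p) v w = metric M p (M.to_base c p v) (M.to_base c p w)"
    and h_eq: "h (snd c p) v w = II p (M.to_base c p v) (M.to_base c p w)" if "p \<in> O'" for p v w
    using that c d by (auto simp: O'_def G_def h_def M.metric_in_eq II_in_charts)
  have sp: "scalar_product (G u)" if "u \<in> D" for u
    using that lm.bil lm.sym lm.nondeg unfolding scalar_product_def D_def O'_def G_def by blast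
  have h_bil: "bilinear (h u)" if u: "u \<in> D" for u
  proof -
    obtain p where p: "p \<in> O'" "u = snd c p" using u by (auto simp: D_def)
    then have "p \<in> W" "p \<in> fst c" by (auto simp: O'_def)
    then have "linear (\<lambda>v. II p v w)" "linear (II p v)" "linear (M.to_base c p)" for v w
      using II_bilinear M.to_base_linear[OF c(1)] by (auto simp: bilinear_def)
    then show ?thesis
      using linear_compose[of "M.to_base c p"] unfolding bilinear_def p(2) h_eq[OF p(1)] by (auto simp: o_def)
  qed
  have transport: "form_power (G (snd c p)) (h (snd c p)) 2 v w = form_power (metric M p) (II p) 2 (M.to_base c p v) (M.to_base c p w)"
      "form_power (G (snd c p)) (h (snd c p)) 3 v w = form_power (metric M p) (II p) 3 (M.to_base c p v) (M.to_base c p w)"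
      "form_trace (G (snd c p)) (h (snd c p)) = t p" if p: "p \<in> O'" for p v w
    unfolding t_def
    using transport_forms[OF M.metric_scalar_product sp II_bilinear h_bil
        M.to_base_linear[OF c(1)] M.of_base_linear[OF c(1)] M.of_to_base[OF c(1)] M.to_of_base[OF c(1)] G_eq h_eq] p
    by (auto simp: D_def O'_def)
  have inv: "chart_inv c (snd c p) = p" if "p \<in> O'" for p
    using that M.chart_inv_left[OF c(1)] by (auto simp: O'_def)
  have I_iff: "(\<exists>r s. \<forall>v w. form_power (G (snd c p)) (h (snd c p)) 2 v w = r * h (snd c p) v w + s * G (snd c p) v w)
      \<longleftrightarrow> (\<exists>r s. \<forall>v w. form_power (metric M p) (II p) 2 v w = r * II p v w + s * metric M p v w)" if p: "p \<in> O'" for p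
  proof -
    have pc: "p \<in> fst c" using p by (auto simp: O'_def)
    have "(\<forall>v w. P (M.to_base c p v) (M.to_base c p w)) \<longleftrightarrow> (\<forall>v w. P v w)" for P
      using M.to_of_base[OF c(1) pc] by metis
    from this[of "\<lambda>v w. form_power (metric M p) (II p) 2 v w = r * II p v w + s * metric M p v w" for r s]
    show ?thesis unfolding transport[OF p] G_eq[OF p] h_eq[OF p] by simp
  qed
  define I where "I = {u \<in> D. \<not> (\<exists>r s. \<forall>v w. form_power (G u) (h u) 2 v w = r * h u v w + s * G u v w)}"
  have I_UH: "snd c p \<in> I \<longleftrightarrow> p \<in> UH" if "p \<in> O'" for p
  proof -
    have "snd c p \<in> D" "p \<in> W" using that by (auto simp: D_def O'_def)
    then show ?thesis unfolding I_def UH_def U_H_def mem_Collect_eq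
      by (simp only: I_iff[OF that] simp_thms)
  qed
  let ?c = "\<lambda>r u. r (chart_inv c u)"
  have "\<exists>V. open V \<and> snd c x \<in> V \<and> V \<subseteq> I \<and>
     (\<forall>u\<in>V. \<rho> (chart_inv c u) + (\<phi> (chart_inv c u) - form_trace (G u) (h u)) *
       (\<psi> (chart_inv c u) + form_trace (G u) (h u) * (\<phi> (chart_inv c u) - form_trace (G u) (h u))) \<noteq> 0)"
    unfolding I_def
  proof (rule cubic_nonvanishing_stable[OF D _ sp h_bil])
    show "snd c x \<in> D" using xO by (simp add: D_def)
    show "(\<lambda>u. G u v w) differentiable at u" if "u \<in> D" for u v w
      using that unfolding G_def by (intro smooth_on_differentiable[OF lm.smooth]) (auto simp: D_def O'_def)
    show "(\<lambda>u. h u v w) differentiable at u" if "u \<in> D" for u v w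
      using that unfolding h_def D_def O'_def by (rule II_chart_differentiable[OF c(1) d(1)])
    fix u v w
    assume u: "u \<in> {u \<in> D. \<not> (\<exists>r s. \<forall>v w. form_power (G u) (h u) 2 v w = r * h u v w + s * G u v w)}"
    then obtain p where p: "p \<in> O'" "u = snd c p" by (auto simp: D_def)
    then have "p \<in> UH" using u I_UH by (simp add: I_def)
    then show "form_power (G u) (h u) 3 v w = ?c \<phi> u * form_power (G u) (h u) 2 v w + ?c \<psi> u * h u v w + ?c \<rho> u * G u v w"
      unfolding p(2) transport[OF p(1)] G_eq[OF p(1)] h_eq[OF p(1)] inv[OF p(1)] by (rule cubic)
  next
    show "snd c x \<in> {u \<in> D. \<not> (\<exists>r s. \<forall>v w. form_power (G u) (h u) 2 v w = r * h u v w + s * G u v w)}"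
      using I_UH[OF xO] x(1) unfolding I_def by blast
    show "?c \<rho> (snd c x) + (?c \<phi> (snd c x) - form_trace (G (snd c x)) (h (snd c x))) *
       (?c \<psi> (snd c x) + form_trace (G (snd c x)) (h (snd c x)) * (?c \<phi> (snd c x) - form_trace (G (snd c x)) (h (snd c x)))) \<noteq> 0"
      using x(2) unfolding transport[OF xO] inv[OF xO] \<tau>_def .
  qed
  then obtain V where V: "open V" "snd c x \<in> V" "V \<subseteq> I"
     "\<And>u. u \<in> V \<Longrightarrow> \<rho> (chart_inv c u) + (\<phi> (chart_inv c u) - form_trace (G u) (h u)) *
       (\<psi> (chart_inv c u) + form_trace (G u) (h u) * (\<phi> (chart_inv c u) - form_trace (G u) (h u))) \<noteq> 0"
    by blast
  define U where "U = O' \<inter> snd c -` V"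
  have "open U"
    unfolding U_def
    by (rule continuous_open_preimage[OF continuous_on_subset[OF M.chart_cont[OF c(1)]] O' V(1)])
      (auto simp: O'_def)
  moreover have "x \<in> U" using xO V(2) by (simp add: U_def)
  moreover have "U \<subseteq> UH" using V(3) I_UH by (auto simp: U_def)
  moreover have "\<tau> p \<noteq> 0" if "p \<in> U" for p
  proof -
    have "p \<in> O'" "snd c p \<in> V" using that by (auto simp: U_def)
    then show ?thesis using V(4)[of "snd c p"] by (simp add: transport inv \<tau>_def)
  qed
  ultimately show ?thesis by blast
qed

end

section \<open>Hypersurfaces with a cubic second fundamental tensor\<close>

context oriented_hypersurface
begin

text \<open>
  From here on the geometry enters only through the Gauss equation and the scalar curvature of the
  ambient space.
\<close>
lemma Gauss_point_at:
  assumes curv: "constant_curvature N c" and dim: "CARD('n) \<ge> 4" and p: "p \<in> W"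
    and cubic: "\<And>v w. form_power (metric M p) (II p) 3 v w =
      \<phi> * form_power (metric M p) (II p) 2 v w + \<psi> * II p v w + \<rho> * metric M p v w"
  shows "Gauss_point_Weyl (metric M p) (II p) (curvature_op M p) \<epsilon> c \<phi> \<psi> \<rho> (real CARD('n))
    (form_trace (metric M p) (II p)) (ricci M p) (riemann M p) (weyl M p) (scalar_curvature M p) (scalar_curvature N (f p))"
proof (intro Gauss_point_Weyl.intro Gauss_point.intro Gauss_point_axioms.intro Gauss_point_Weyl_axioms.intro)
  show "scalar_product (metric M p)" by (rule M.metric_scalar_product)
  show "real CARD('n) \<ge> 4" using dim by simp
  show "scalar_curvature N (f p) = real CARD('n) * (real CARD('n) + 1) * c"
    by (rule scalar_curvature_ambient[OF curv])
  show "metric M p (curvature_op M p x y z) w = riemann M p x y z w" for x y z w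
    by (simp add: riemann_def)
  show "ricci M p x y = trace (matrix (\<lambda>z. curvature_op M p z x y))" for x y
    by (simp add: ricci_def)
  show "\<epsilon> \<in> {-1, 1}" by (rule eps)
qed (auto simp: II_bilinear[OF p] II_sym[OF p] cubic weyl_def Let_def
    Gauss_equation[OF p curv])

end

theorem theorem6p1:
  fixes M :: "('p::t2_space, 'n::finite) semi_riem"
    and N :: "('q::t2_space, 'm::finite) semi_riem"
    and f :: "'p \<Rightarrow> 'q" and W UH :: "'p set" and \<xi> :: "'p \<Rightarrow> real ^ 'm"
    and s :: nat and n c \<epsilon> :: real
    and g H S A :: "'p \<Rightarrow> 'n form2" and R C :: "'p \<Rightarrow> 'n form4"
    and \<phi> \<psi> \<rho> \<tau> trH \<kappa> \<kappa>t \<rho>0 \<rho>1 \<mu> \<beta>1 \<beta>2 \<beta>3 \<beta>4 :: "'p \<Rightarrow> real"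
  assumes hyp: "hypersurface M N f"
    and sig: "has_index N s"
    and const_curv: "constant_curvature N c"
    and n: "n = real CARD('n)" "CARD('n) \<ge> 4"
    and normal: "unit_normal_field M N f W \<epsilon> \<xi>"
    and g: "g = metric M"
    and H: "H = second_fundamental M N f \<xi>"
    and S: "S = ricci M"
    and R: "R = riemann M"
    and C: "C = weyl M"
    and UH: "UH = U_H M N f W \<xi>"
    and cubic: "\<And>p X Y. p \<in> UH \<Longrightarrow>
      form_power (g p) (H p) 3 X Y = \<phi> p * form_power (g p) (H p) 2 X Y + \<psi> p * H p X Y + \<rho> p * g p X Y"
    and trH: "\<And>p. trH p = form_trace (g p) (H p)"
    and \<kappa>: "\<And>p. \<kappa> p = scalar_curvature M p"
    and \<kappa>t: "\<And>p. \<kappa>t p = scalar_curvature N (f p)"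
    and \<tau>: "\<And>p. \<tau> p = \<rho> p + (\<phi> p - trH p) * (\<psi> p + trH p * (\<phi> p - trH p))"
    and \<rho>1: "\<And>p. \<rho>1 p = 2 * (n - 1) * c - \<epsilon> * (\<psi> p + (\<phi> p - trH p)^2)"
    and \<rho>0: "\<And>p. \<rho>0 p = - ((n - 1)^2 * c^2) + \<epsilon> * (\<psi> p + (\<phi> p - trH p)^2) * (n - 1) * c
                          + \<rho> p * (\<phi> p - 2 * trH p)"
    and A: "\<And>p X Y. A p X Y = form_power (g p) (S p) 2 X Y - \<rho>1 p * S p X Y - \<rho>0 p * g p X Y"
    and \<mu>: "\<And>p. \<mu> p = 1 / (n - 2) * (\<kappa> p / (n - 1) - \<kappa>t p / (n + 1))"
    and \<beta>1: "\<And>p. \<beta>1 p = \<epsilon> * (\<phi> p - trH p)"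
    and \<beta>2: "\<And>p. \<beta>2 p = \<mu> p + \<epsilon> / (n - 2) * ((\<beta>1 p)^2 + \<psi> p)"
    and \<beta>3: "\<And>p. \<beta>3 p = \<epsilon> * \<mu> p * trH p
                          + 1 / (n - 2) * (\<psi> p * (2 * trH p - \<phi> p) + (n - 3) * \<rho> p)"
    and \<beta>4: "\<And>p. \<beta>4 p = \<beta>3 p - \<epsilon> * \<beta>2 p * trH p + (n - 1) * \<kappa>t p * \<beta>1 p / (n * (n + 1))"
  shows "\<forall>x\<in>UH.
    (\<tau> x = 0 \<longrightarrow> partially_einstein_at M x) \<and>
    (\<tau> x \<noteq> 0 \<longrightarrow>
      (\<exists>U. open U \<and> x \<in> U \<and> U \<subseteq> UH \<and>
        (\<forall>p\<in>U. \<tau> p \<noteq> 0 \<and>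
          (\<forall>X Y. H p X Y = inverse (\<tau> p) * A p X Y \<and>
            H p X Y = inverse (\<tau> p) *
              (form_power (g p) (S p) 2 X Y - \<rho>1 p * S p X Y - \<rho>0 p * g p X Y)) \<and>
          (\<forall>X1 X2 X3 X4.
            R p X1 X2 X3 X4 =
              \<epsilon> / 2 * (inverse (\<tau> p))^2 * kulkarni_nomizu (A p) (A p) X1 X2 X3 X4
              + c / 2 * kulkarni_nomizu (g p) (g p) X1 X2 X3 X4 \<and>
            R p X1 X2 X3 X4 =
              \<epsilon> / 2 * (inverse (\<tau> p))^2 *
                kulkarni_nomizu
                  (\<lambda>X Y. form_power (g p) (S p) 2 X Y - \<rho>1 p * S p X Y - \<rho>0 p * g p X Y)
                  (\<lambda>X Y. form_power (g p) (S p) 2 X Y - \<rho>1 p * S p X Y - \<rho>0 p * g p X Y)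
                  X1 X2 X3 X4
              + c / 2 * kulkarni_nomizu (g p) (g p) X1 X2 X3 X4) \<and>
          (\<forall>X1 X2 X Y.
            curv_dot (g p) (R p) (S p) X1 X2 X Y =
              - inverse (\<tau> p) * \<beta>1 p * tachibana (S p) (form_power (g p) (S p) 2) X1 X2 X Y
              + inverse (\<tau> p) * (\<rho> p + (n - 1) * c * \<beta>1 p)
                  * tachibana (g p) (form_power (g p) (S p) 2) X1 X2 X Y
              + (c - inverse (\<tau> p) * \<rho> p * \<rho>1 p
                   - inverse (\<tau> p) * \<beta>1 p * (\<rho>0 p + (n - 1) * c * \<rho>1 p))
                  * tachibana (g p) (S p) X1 X2 X Y) \<and>
          (\<forall>X1 X2 X Y.
            curv_dot (g p) (C p) (S p) X1 X2 X Y =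
              - inverse (\<tau> p) * \<beta>1 p * tachibana (S p) (form_power (g p) (S p) 2) X1 X2 X Y
              + inverse (\<tau> p) * \<beta>4 p * tachibana (g p) (form_power (g p) (S p) 2) X1 X2 X Y
              + (\<beta>2 p - inverse (\<tau> p) * (\<beta>1 p * \<rho>0 p + \<beta>4 p * \<rho>1 p))
                  * tachibana (g p) (S p) X1 X2 X Y) \<and>
          (\<exists>a b d. \<forall>X Y. form_power (g p) (S p) 3 X Y =
              a * g p X Y + b * S p X Y + d * form_power (g p) (S p) 2 X Y))))"
proof -
  \<comment> \<open>This matching extracts from the goal the assertion about a single point of the neighbourhood.\<close>
  let "\<forall>x\<in>UH. (\<tau> x = 0 \<longrightarrow> partially_einstein_at M x) \<and> (\<tau> x \<noteq> 0 \<longrightarrow>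
      (\<exists>U. open U \<and> x \<in> U \<and> U \<subseteq> UH \<and> (\<forall>p\<in>U. \<tau> p \<noteq> 0 \<and> ?formulas p)))" = ?thesis
  interpret oriented_hypersurface M N f W \<epsilon> \<xi>
    by unfold_locales (rule hyp, rule normal)
  have UH_W: "p \<in> W" if "p \<in> UH" for p using that by (simp add: UH U_H_def)
  have point: "Gauss_point_Weyl (g p) (H p) (curvature_op M p) \<epsilon> c (\<phi> p) (\<psi> p) (\<rho> p) n (trH p) (S p) (R p) (C p)
      (\<kappa> p) (\<kappa>t p)" if p: "p \<in> UH" for p
    unfolding g H S R C \<kappa> \<kappa>t trH n(1)
    by (rule Gauss_point_at[OF const_curv n(2) UH_W[OF p] cubic[OF p, unfolded g H]])
  have partially_einstein: "partially_einstein_at M x" if x: "x \<in> UH" "\<tau> x = 0" for x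
  proof -
    interpret x: Gauss_point_Weyl "g x" "H x" "curvature_op M x" \<epsilon> c "\<phi> x" "\<psi> x" "\<rho> x" n "trH x" "S x" "R x"
      "C x" "\<kappa> x" "\<kappa>t x" by (rule point[OF x(1)])
    have zero: "x.\<tau> = 0" using x(2) by (simp add: x.\<tau>_def \<tau>)
    show ?thesis
      unfolding partially_einstein_at_def g[symmetric] S[symmetric]
      by (intro exI[of _ x.\<rho>1] exI[of _ x.\<rho>0] allI x.partially_Einstein[OF zero])
  qed
  have stable: "\<exists>U. open U \<and> x \<in> U \<and> U \<subseteq> UH \<and> (\<forall>p\<in>U. \<tau> p \<noteq> 0)"
    if "x \<in> UH" "\<tau> x \<noteq> 0" for x
    using tau_nonzero_stable[OF cubic[unfolded UH g H] that[unfolded UH \<tau> trH g H]]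
    unfolding UH \<tau> trH g H .
  have formulas: "?formulas p"
    if p: "p \<in> UH" "\<tau> p \<noteq> 0" for p
  proof -
    interpret p: Gauss_point_Weyl "g p" "H p" "curvature_op M p" \<epsilon> c "\<phi> p" "\<psi> p" "\<rho> p" n "trH p" "S p" "R p"
      "C p" "\<kappa> p" "\<kappa>t p" by (rule point[OF p(1)])
    have eqs: "p.\<tau> = \<tau> p" "p.\<rho>1 = \<rho>1 p" "p.\<rho>0 = \<rho>0 p" "p.\<beta>1 = \<beta>1 p"
      by (simp_all add: p.\<tau>_def \<tau> p.\<rho>1_def \<rho>1 p.\<rho>0_def \<rho>0 p.\<beta>1_def \<beta>1)
    have "p.\<mu> = \<mu> p" by (simp add: p.\<mu>_def \<mu>)
    then have eqs2: "p.\<beta>2 = \<beta>2 p" "p.\<beta>3 = \<beta>3 p"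
      by (simp_all add: p.\<beta>2_def \<beta>2 p.\<beta>3_def \<beta>3 eqs)
    then have eqs3: "p.\<beta>4 = \<beta>4 p" by (simp add: p.\<beta>4_def \<beta>4 eqs)
    have A_eq: "A p = (\<lambda>X Y. form_power (g p) (S p) 2 X Y - \<rho>1 p * S p X Y - \<rho>0 p * g p X Y)"
      by (intro ext) (rule A)
    have \<tau>_nz: "p.\<tau> \<noteq> 0" using p(2) by (simp add: eqs)
    show ?thesis
      unfolding A_eq
      by (intro conjI allI p.H_eq[OF \<tau>_nz, unfolded eqs] p.R_eq[OF \<tau>_nz, unfolded eqs]
          p.R_dot_S[OF \<tau>_nz, unfolded eqs] p.C_dot_S[OF \<tau>_nz, unfolded eqs eqs2 eqs3]
          p.S3_combination[OF \<tau>_nz])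
  qed
  show ?thesis
  proof (intro ballI conjI impI)
    fix x assume x: "x \<in> UH" "\<tau> x \<noteq> 0"
    then obtain U where U: "open U" "x \<in> U" "U \<subseteq> UH" "\<forall>p\<in>U. \<tau> p \<noteq> 0" using stable by blast
    show "\<exists>U. open U \<and> x \<in> U \<and> U \<subseteq> UH \<and> (\<forall>p\<in>U. \<tau> p \<noteq> 0 \<and> ?formulas p)"
    proof (rule exI[of _ U], rule conjI[OF U(1) conjI[OF U(2) conjI[OF U(3)]]], rule ballI)
      fix p assume "p \<in> U"
      then have p: "p \<in> UH" "\<tau> p \<noteq> 0" using U(3,4) by auto
      show "\<tau> p \<noteq> 0 \<and> ?formulas p" by (rule conjI[OF p(2) formulas[OF p]])
    qed
  qed (rule partially_einstein)
qed

end
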